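(* Fix $s>0$ and write $H_s(G)=(-1)^{|V(G)|}\chi_G(-s)$, which equals $s\,T_G(1+s,0)$ for connected $G$. (a) For fixed $k\geq1$, as $r\to\infty$, $$H_s(K_{\underbrace{k,\ldots,k}_{r}})=\frac{(kr)!(kr)^{s-1}}{\Gamma(s)}e^{-(k-1)/2}\left(1+\frac{\Delta_{k,s}}{kr}+O(r^{-2})\right),$$ where $$\Delta_{k,s}=-\frac{(k-1)(5k-7)}{24}+\frac{s(s-1)}2+\frac{(s-1)(k-1)}2.$$ In particular $\Delta_{k,1}=-(k-1)(5k-7)/24$. (b) Fix $m\ge1$, and for nonnegative integers $r_1,\ldots,r_m$ let $G$ be the complete multipartite graph with $r_j$ parts of size $j$ ($1\le j\le m$). Put $N=\sum_{j=1}^mjr_j$, $A_j=-\frac{j(j-1)}2$, $B_j=\frac{j(j-1)(j-2)(3j-5)}{24}$, $E_j=B_j-\frac{A_j^2}2$, $\mu_1=N^{-1}\sum_jr_jA_j$, $\mu_2=N^{-1}\sum_jr_jE_j$. Then, as $N\to\infty$, $$H_s(G)=\frac{N!N^{s-1}}{\Gamma(s)}e^{\mu_1}\left(1+\frac{\mu_2+(1-s)\mu_1+\mu_1^2/2+s(s-1)/2}{N}+O(N^{-2})\right),$$ with implicit constant depending only on $m$ and $s$. (c) For each fixed $J\geq1$ and $C<\infty$, uniformly for $1\leq m\leq Cn^J$, $$H_s(K_{\underbrace{m,\ldots,m}_{n}})=\frac{(mn)!(mn)^{s-1}}{\Gamma(s)}\exp\!\left(-\frac m2+\frac12+\sum_{j=1}^J\gamma_j\frac{m}{n^j}+O_{C,J,s}(n^{-1})\right),$$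 where the rational constants $\gamma_j$ are the same as those in the expansion of the number of acyclic orientations of $K_{m,\ldots,m}$ recalled in the context.
   Context: $\chi_G$ and $T_G(x,y)$ are the chromatic and Tutte polynomials of $G$. $K_{m,\ldots,m}$ with $n$ indices is the complete $n$-partite graph with all parts of size $m$. The constants $\gamma_1,\gamma_2,\ldots$ are the (uniquely determined) rational numbers such that for every integer $J\ge1$ and every $C<\infty$, uniformly for $1\le m\le Cn^J$, the number $D_{m,n}$ of acyclic orientations of $K_{m,\ldots,m}$ ($n$ parts) satisfies $$D_{m,n}=(mn)!\exp\Bigl(-\tfrac m2+\tfrac12+\sum_{j=1}^J\gamma_j\tfrac{m}{n^j}+O_{C,J}(n^{-1})\Bigr);$$ their existence is established in the paper, and $\gamma_1=-\frac5{24}$, $\gamma_2=-\frac18$, $\gamma_3=-\frac{251}{2880}$, $\gamma_4=-\frac{19}{288}$, $\gamma_5=-\frac{19087}{362880}$. Subscripts on $O$ indicate the parameters on which the implicit constant may depend. *)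

theory Defs
  imports "HOL-Analysis.Analysis" "HOL-Computational_Algebra.Polynomial"
    "HOL-Library.Landau_Symbols" "HOL-Library.FuncSet"
begin

type_synonym 'a graph = "'a set \<times> 'a set set"

abbreviation verts :: "'a graph \<Rightarrow> 'a set" where "verts \<equiv> fst"
abbreviation edges :: "'a graph \<Rightarrow> 'a set set" where "edges \<equiv> snd"

definition simple_graph :: "'a graph \<Rightarrow> bool" where
  "simple_graph G \<longleftrightarrow> finite (verts G) \<and> (\<forall>e\<in>edges G. e \<subseteq> verts G \<and> card e = 2)"

text \<open>Connected components of the spanning subgraph with edge set \<open>A\<close>; isolated vertices
  are components of their own.\<close>

definition reach :: "'a set \<Rightarrow> 'a set set \<Rightarrow> ('a \<times> 'a) set" where
  "reach V A = {(u, v) \<in> V \<times> V. (u, v) \<in> {(x, y). {x, y} \<in> A}\<^sup>*}"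

definition num_components :: "'a set \<Rightarrow> 'a set set \<Rightarrow> nat" where
  "num_components V A = card (V // reach V A)"

definition connected_graph :: "'a graph \<Rightarrow> bool" where
  "connected_graph G \<longleftrightarrow> verts G \<noteq> {} \<and> reach (verts G) (edges G) = verts G \<times> verts G"

definition complete_multipartite :: "'i set \<Rightarrow> ('i \<Rightarrow> nat) \<Rightarrow> ('i \<times> nat) graph" where
  "complete_multipartite I p =
     (SIGMA i:I. {..<p i},
      {{u, v} | u v. u \<in> (SIGMA i:I. {..<p i}) \<and> v \<in> (SIGMA i:I. {..<p i}) \<and> fst u \<noteq> fst v})"

lemma simple_graph_complete_multipartite:
  assumes "finite I"
  shows "simple_graph (complete_multipartite I p)"
  using assms unfolding simple_graph_def complete_multipartite_def
  by (auto simp: card_insert_if)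

definition equal_multipartite :: "nat \<Rightarrow> nat \<Rightarrow> (nat \<times> nat) graph" where
  "equal_multipartite m n = complete_multipartite {..<n} (\<lambda>_. m)"

text \<open>The complete multipartite graph with \<open>r j\<close> parts of size \<open>j\<close> for \<open>1 \<le> j \<le> m\<close>;
  the parts are indexed by pairs \<open>(j, i)\<close> with \<open>i < r j\<close>.\<close>

definition mixed_multipartite :: "nat \<Rightarrow> (nat \<Rightarrow> nat) \<Rightarrow> ((nat \<times> nat) \<times> nat) graph" where
  "mixed_multipartite m r = complete_multipartite (SIGMA j:{1..m}. {..<r j}) fst"

definition proper_colorings :: "'a graph \<Rightarrow> 'c set \<Rightarrow> ('a \<Rightarrow> 'c) set" where
  "proper_colorings G S =
     {f \<in> verts G \<rightarrow>\<^sub>E S. \<forall>u v. {u, v} \<in> edges G \<longrightarrow> f u \<noteq> f v}"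

definition chromatic_poly :: "'a graph \<Rightarrow> real poly" where
  "chromatic_poly G =
     (THE p. \<forall>q::nat. poly p (real q) = real (card (proper_colorings G {..<q})))"

text \<open>The Tutte polynomial as a function of its two arguments, by the rank-nullity expansion
  \<open>T(x,y) = (\<Sum>A\<subseteq>E. (x-1)^(r(E)-r(A)) * (y-1)^(|A|-r(A)))\<close> with \<open>r(A) = |V| - k(A)\<close>.
  For a finite graph \<open>k(A) \<ge> k(E)\<close> and \<open>|A| + k(A) \<ge> |V|\<close>, so the natural number
  subtractions do not truncate.\<close>

definition tutte :: "'a graph \<Rightarrow> real \<Rightarrow> real \<Rightarrow> real" where
  "tutte G x y =
     (\<Sum>A\<in>Pow (edges G).
        (x - 1) ^ (num_components (verts G) A - num_components (verts G) (edges G)) *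
        (y - 1) ^ (card A + num_components (verts G) A - card (verts G)))"

definition acyclic_orientations :: "'a graph \<Rightarrow> ('a \<times> 'a) set set" where
  "acyclic_orientations G =
     {R. (\<forall>(u, v)\<in>R. {u, v} \<in> edges G) \<and>
         (\<forall>u v. {u, v} \<in> edges G \<longrightarrow> ((u, v) \<in> R \<longleftrightarrow> (v, u) \<notin> R)) \<and>
         acyclic R}"

lemma finite_proper_colorings:
  assumes "finite (verts G)" "finite S"
  shows "finite (proper_colorings G S)"
  unfolding proper_colorings_def
  by (rule finite_subset[OF _ finite_PiE[OF assms(1), of "\<lambda>_. S"]]) (use assms in auto)

lemma card_onto_colorings_le:
  fixes h :: "'b \<Rightarrow> 'c"
  assumes G: "simple_graph G" and h: "bij_betw h A B" and "finite B"
  shows "card {f \<in> proper_colorings G A. f ` verts G = A} \<le>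
         card {f \<in> proper_colorings G B. f ` verts G = B}"
proof (rule card_inj_on_le)
  let ?\<phi> = "\<lambda>f. restrict (h \<circ> f) (verts G)"
  have inj: "inj_on h A" and im: "h ` A = B" using h by (auto simp: bij_betw_def)
  show "inj_on ?\<phi> {f \<in> proper_colorings G A. f ` verts G = A}"
  proof (rule inj_onI)
    fix f g assume f: "f \<in> {f \<in> proper_colorings G A. f ` verts G = A}"
      and g: "g \<in> {f \<in> proper_colorings G A. f ` verts G = A}" and eq: "?\<phi> f = ?\<phi> g"
    show "f = g"
    proof (rule extensionalityI[of f "verts G"])
      show "f \<in> extensional (verts G)" "g \<in> extensional (verts G)"
        using f g by (auto simp: proper_colorings_def PiE_def)
      fix x assume x: "x \<in> verts G"
      have "h (f x) = h (g x)" using fun_cong[OF eq, of x] x by simp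
      moreover have "f x \<in> A" "g x \<in> A" using f g x by (auto simp: proper_colorings_def)
      ultimately show "f x = g x" using inj by (auto dest: inj_onD)
    qed
  qed
  show "?\<phi> ` {f \<in> proper_colorings G A. f ` verts G = A}
          \<subseteq> {f \<in> proper_colorings G B. f ` verts G = B}"
  proof (rule image_subsetI, rule CollectI, rule conjI)
    fix f assume "f \<in> {f \<in> proper_colorings G A. f ` verts G = A}"
    then have f: "f \<in> proper_colorings G A" "f ` verts G = A" by auto
    have "?\<phi> f ` verts G = h ` (f ` verts G)" by auto
    then show B: "?\<phi> f ` verts G = B" using f(2) im by simp
    have "?\<phi> f u \<noteq> ?\<phi> f v" if e: "{u, v} \<in> edges G" for u v
    proof -
      from G e have uv: "u \<in> verts G" "v \<in> verts G" by (auto simp: simple_graph_def)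
      then have "f u \<in> A" "f v \<in> A" using f(2) by auto
      moreover have "f u \<noteq> f v" using f(1) e by (auto simp: proper_colorings_def)
      ultimately show ?thesis using inj uv by (auto dest: inj_onD)
    qed
    moreover have "?\<phi> f \<in> verts G \<rightarrow>\<^sub>E B" using B by (auto simp: PiE_def)
    ultimately show "?\<phi> f \<in> proper_colorings G B" by (auto simp: proper_colorings_def)
  qed
  show "finite {f \<in> proper_colorings G B. f ` verts G = B}"
    using finite_proper_colorings[of G B] G \<open>finite B\<close> by (auto simp: simple_graph_def)
qed

lemma card_onto_colorings:
  assumes G: "simple_graph G" and "finite S"
  shows "card {f \<in> proper_colorings G S. f ` verts G = S} =
         card {f \<in> proper_colorings G {..<card S}. f ` verts G = {..<card S}}"
proof -
  obtain h where h: "bij_betw h S {..<card S}"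
    using ex_bij_betw_finite_nat[OF \<open>finite S\<close>] by (auto simp: atLeast0LessThan)
  show ?thesis
    by (intro antisym card_onto_colorings_le[OF G h]
        card_onto_colorings_le[OF G bij_betw_inv_into[OF h]]) (use \<open>finite S\<close> in auto)
qed

lemma card_proper_colorings:
  assumes G: "simple_graph G"
  shows "card (proper_colorings G {..<q}) =
         (\<Sum>k\<le>card (verts G). (q choose k) *
            card {f \<in> proper_colorings G {..<k}. f ` verts G = {..<k}})"
proof -
  let ?a = "\<lambda>k. card {f \<in> proper_colorings G {..<k}. f ` verts G = {..<k}}"
  let ?P = "\<lambda>S. {f \<in> proper_colorings G S. f ` verts G = S}"
  let ?n = "card (verts G)"
  have fin: "finite (verts G)" using G by (simp add: simple_graph_def)
  have "proper_colorings G {..<q} = (\<Union>S\<in>Pow {..<q}. ?P S)"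
    by (fastforce simp: proper_colorings_def PiE_def)
  then have "card (proper_colorings G {..<q}) = (\<Sum>S\<in>Pow {..<q}. card (?P S))"
  proof (simp only:, intro card_UN_disjoint ballI impI)
    fix S assume "S \<in> Pow {..<q}"
    then show "finite (?P S)"
      using finite_proper_colorings[OF fin, of S] by (auto intro: finite_subset)
  qed auto
  also have "\<dots> = (\<Sum>S\<in>Pow {..<q}. ?a (card S))"
    by (intro sum.cong refl card_onto_colorings G) (auto intro: finite_subset)
  also have "\<dots> = (\<Sum>k\<le>q. \<Sum>S | S \<in> Pow {..<q} \<and> card S = k. ?a (card S))"
  proof (rule sum.group[symmetric])
    show "card ` Pow {..<q} \<subseteq> {..q}"
      using card_mono[of "{..<q}"] by auto
  qed auto
  also have "\<dots> = (\<Sum>k\<le>q. (q choose k) * ?a k)"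
    using n_subsets[of "{..<q}"] by (intro sum.cong refl) simp
  also have "\<dots> = (\<Sum>k\<le>max q ?n. (q choose k) * ?a k)"
    by (rule sum.mono_neutral_left) auto
  also have "\<dots> = (\<Sum>k\<le>?n. (q choose k) * ?a k)"
  proof (rule sum.mono_neutral_right)
    have "?a k = 0" if "k > ?n" for k
    proof -
      have "{f \<in> proper_colorings G {..<k}. f ` verts G = {..<k}} = {}"
        using card_image_le[OF fin] that by (metis (mono_tags, lifting) Collect_empty_eq
            card_lessThan not_less)
      then show ?thesis by (simp only: card.empty)
    qed
    then show "\<forall>k\<in>{..max q ?n} - {..?n}. (q choose k) * ?a k = 0" by auto
  qed auto
  finally show ?thesis .
qed

lemma chromatic_poly_unique:
  fixes p p' :: "real poly"
  assumes "\<And>q::nat. poly p (real q) = poly p' (real q)"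
  shows "p = p'"
proof (rule ccontr)
  assume "p \<noteq> p'"
  then have "finite {x. poly (p - p') x = 0}" by (intro poly_roots_finite) auto
  moreover have "range real \<subseteq> {x. poly (p - p') x = 0}" using assms by auto
  ultimately have "finite (range real)" by (rule rev_finite_subset)
  then show False using finite_imageD[of real UNIV] by (auto simp: inj_on_def)
qed

theorem poly_chromatic_poly:
  assumes "simple_graph G"
  shows "poly (chromatic_poly G) (real q) = real (card (proper_colorings G {..<q}))"
proof -
  define a where "a k = real (card {f \<in> proper_colorings G {..<k}. f ` verts G = {..<k}})" for k :: nat
  define p where "p = (\<Sum>k\<le>card (verts G).
    smult (a k / fact k) (\<Prod>i<k. [:- real i, 1:]))"
  have p: "poly p (real q) = real (card (proper_colorings G {..<q}))" for q
    by (simp add: p_def a_def card_proper_colorings[OF assms] poly_sum poly_prod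
        binomial_gbinomial gbinomial_prod_rev atLeast0LessThan mult.commute)
  have "(THE p. \<forall>q::nat. poly p (real q) = real (card (proper_colorings G {..<q}))) = p"
    by (rule the_equality) (use p in \<open>auto intro!: chromatic_poly_unique\<close>)
  then show ?thesis using p unfolding chromatic_poly_def by simp
qed

definition H :: "real \<Rightarrow> 'a graph \<Rightarrow> real" where
  "H s G = (-1) ^ card (verts G) * poly (chromatic_poly G) (- s)"

definition Delta :: "nat \<Rightarrow> real \<Rightarrow> real" where
  "Delta k s = - ((real k - 1) * (5 * real k - 7)) / 24 + s * (s - 1) / 2
                + (s - 1) * (real k - 1) / 2"

definition A_coeff :: "nat \<Rightarrow> real" where
  "A_coeff j = - (real j * (real j - 1)) / 2"

definition B_coeff :: "nat \<Rightarrow> real" where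
  "B_coeff j = real j * (real j - 1) * (real j - 2) * (3 * real j - 5) / 24"

definition E_coeff :: "nat \<Rightarrow> real" where
  "E_coeff j = B_coeff j - (A_coeff j)\<^sup>2 / 2"

definition mixed_size :: "nat \<Rightarrow> (nat \<Rightarrow> nat) \<Rightarrow> nat" where
  "mixed_size m r = (\<Sum>j=1..m. j * r j)"

definition mu1 :: "nat \<Rightarrow> (nat \<Rightarrow> nat) \<Rightarrow> real" where
  "mu1 m r = (\<Sum>j=1..m. real (r j) * A_coeff j) / real (mixed_size m r)"

definition mu2 :: "nat \<Rightarrow> (nat \<Rightarrow> nat) \<Rightarrow> real" where
  "mu2 m r = (\<Sum>j=1..m. real (r j) * E_coeff j) / real (mixed_size m r)"

text \<open>The property that singles out the constants \<open>\<gamma>\<^sub>1, \<gamma>\<^sub>2, \<dots>\<close>: the asymptotic expansion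
  of the number of acyclic orientations. The value \<open>\<gamma> 0\<close> is not used.\<close>

definition acyclic_orientation_expansion :: "(nat \<Rightarrow> rat) \<Rightarrow> bool" where
  "acyclic_orientation_expansion \<gamma> \<longleftrightarrow>
     (\<forall>J\<ge>1. \<forall>C::real. \<exists>K::real. \<forall>n\<ge>1. \<forall>m\<ge>1. real m \<le> C * real n ^ J \<longrightarrow>
        (\<exists>\<epsilon>. \<bar>\<epsilon>\<bar> \<le> K / real n \<and>
           real (card (acyclic_orientations (equal_multipartite m n))) =
             fact (m * n) *
             exp (- real m / 2 + 1 / 2
                  + (\<Sum>j=1..J. of_rat (\<gamma> j) * real m / real n ^ j) + \<epsilon>)))"

end

theory Submission
  imports Defs "HOL-Real_Asymp.Real_Asymp"
begin

text \<open>Colouring the parts of a complete multipartite graph one after the other shows that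
  \<open>\<Gamma>(s) H\<^sub>s(G)\<close> is the integral of \<open>x\<^sup>s\<^sup>-\<^sup>1 e\<^sup>-\<^sup>x\<close> times the product of \<open>P\<^sub>p(x)\<close> over the part
  sizes \<open>p\<close>, where \<open>P\<^sub>0 = 1\<close> and \<open>P\<^sub>p\<^sub>+\<^sub>1 = x (P\<^sub>p - P\<^sub>p')\<close> are the Touchard polynomials with
  alternating signs. By Rolle's theorem \<open>P\<^sub>p\<close> has \<open>p\<close> distinct real roots, and a barrier argument
  places them in \<open>[0, 4p)\<close>. Beyond \<open>4p\<close> the integrand is therefore positive and its logarithmic
  derivative is under control, while the range below contributes a negligible amount.

  For bounded part sizes the integrand divided by \<open>x\<^sup>N\<close> is expanded in \<open>u = N/x\<close> around
  \<open>u = 1\<close>, and the moments of \<open>u\<close> under the Gamma distribution of shape \<open>N + s\<close> yield the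
  expansion.

  For \<open>n\<close> parts of size \<open>m\<close>, integration by parts shows that consecutive moments of \<open>x/(mn)\<close> agree
  up to a factor \<open>1 + O(1/n)\<close>, uniformly in \<open>m\<close>. Convexity in the exponent extends this to real
  exponents, so that \<open>\<Gamma>(s) H\<^sub>s = (mn)\<^sup>s\<^sup>-\<^sup>1 H\<^sub>1 (1 + O(1/n))\<close>. Finally \<open>H\<^sub>1\<close> counts acyclic orientations
  (Stanley): both satisfy the same recursion over independent sets, namely over the colour class of
  one colour and over sets of sinks.\<close>

section \<open>Whitney expansion and the Tutte polynomial\<close>

text \<open>The exponential weight is forced by the evaluation at \<open>-s\<close>: a part
  contributes falling factorials of the number of colours, these turn into
  \<open>pochhammer s b\<close> together with a shift of \<open>s\<close> to \<open>s + b\<close>,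
  and \<open>Gamma (s + b) = pochhammer s b * Gamma s\<close> makes that shift a factor x^b under
  the integral. The obstacle is uniformity: for bounded part sizes the top three coefficients of
  each factor suffice, but when m may grow like n^J no fixed number of coefficients does, and below
  its largest root a factor can change sign. Hence the location of the roots. The constant 4 is
  where the barrier closes: each step shifts the argument by 2, which bounds p'/p by n/(x - 2n), and
  this is at most 1/2 once x >= 4n. For equal parts only the ratio of H at s and at 1 is estimated,
  since the reference moment cancels; the constants gamma enter through the assumed expansion at s =
  1. Positivity of H for every graph, from deletion and contraction, makes the logarithm of that
  ratio meaningful also for the finitely many pairs (m, n) with small n.\<close>

lemma equiv_reach: "equiv V (reach V A)"
proof (rule equivI)
  let ?R = "{(x, y). {x, y} \<in> A}"
  show "reach V A \<subseteq> V \<times> V" by (auto simp: reach_def)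
  show "refl_on V (reach V A)" by (auto simp: refl_on_def reach_def)
  have "sym (?R\<^sup>*)" by (rule sym_rtrancl) (auto simp: sym_def insert_commute)
  then show "sym (reach V A)" unfolding reach_def sym_def by blast
  show "trans (reach V A)" unfolding reach_def by (auto intro!: transI)
qed


text \<open>A colouring constant on every edge of \<open>A\<close> is constant on the components of
  (V, A), so it factors through the quotient. The inverse map reads the colour off a chosen
  representative of each class.\<close>

lemma card_monochromatic:
  assumes "finite V" "finite S" "\<And>e. e \<in> A \<Longrightarrow> e \<subseteq> V \<and> card e = 2"
  shows "card {f \<in> V \<rightarrow>\<^sub>E S. \<forall>e\<in>A. \<forall>u\<in>e. \<forall>v\<in>e. f u = f v} = card S ^ num_components V A"
proof -
  let ?r = "reach V A"
  let ?\<phi> = "\<lambda>g. \<lambda>v\<in>V. g (?r `` {v})"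
  note eq = equiv_reach[of V A]
  have "bij_betw ?\<phi> (V // ?r \<rightarrow>\<^sub>E S) {f \<in> V \<rightarrow>\<^sub>E S. \<forall>e\<in>A. \<forall>u\<in>e. \<forall>v\<in>e. f u = f v}"
  proof (rule bij_betw_byWitness[where f' = "\<lambda>f. \<lambda>X\<in>V // ?r. f (SOME v. v \<in> X)"])
    have some: "?r `` {SOME v. v \<in> X} = X \<and> (SOME v. v \<in> X) \<in> V" if X: "X \<in> V // ?r" for X
    proof -
      have "X \<noteq> {}" using that eq in_quotient_imp_non_empty by blast
      then have *: "(SOME v. v \<in> X) \<in> X" by (simp add: some_in_eq)
      then have "(SOME v. v \<in> X) \<in> V" using that eq in_quotient_imp_subset by blast
      moreover obtain y where y: "X = ?r `` {y}" using X by (auto elim: quotientE)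
      then have "?r `` {SOME v. v \<in> X} = X"
        using * equiv_class_eq[OF eq, of y "SOME v. v \<in> X"] by blast
      ultimately show ?thesis by blast
    qed
    show "\<forall>g\<in>V // ?r \<rightarrow>\<^sub>E S. (\<lambda>X\<in>V // ?r. ?\<phi> g (SOME v. v \<in> X)) = g"
      using some by (auto simp: fun_eq_iff PiE_def extensional_def)
    have const: "f v = f w" if "\<forall>e\<in>A. \<forall>u\<in>e. \<forall>v\<in>e. f u = f v" "(v, w) \<in> ?r" for f :: "'a \<Rightarrow> 'b" and v w
    proof -
      have "(v, w) \<in> {(x, y). {x, y} \<in> A}\<^sup>*" using that(2) by (simp add: reach_def)
      then show ?thesis by induction (use that(1) in auto)
    qed
    show "\<forall>f\<in>{f \<in> V \<rightarrow>\<^sub>E S. \<forall>e\<in>A. \<forall>u\<in>e. \<forall>v\<in>e. f u = f v}. ?\<phi> (\<lambda>X\<in>V // ?r. f (SOME v. v \<in> X)) = f"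
    proof (clarify, rule ext)
      fix f v assume f: "f \<in> V \<rightarrow>\<^sub>E S" "\<forall>e\<in>A. \<forall>u\<in>e. \<forall>v\<in>e. f u = f v"
      show "?\<phi> (\<lambda>X\<in>V // ?r. f (SOME v. v \<in> X)) v = f v"
      proof (cases "v \<in> V")
        case True
        then have X: "?r `` {v} \<in> V // ?r" by (rule quotientI)
        have "v \<in> ?r `` {v}" using True eq by (rule equiv_class_self[rotated])
        then have "(SOME w. w \<in> ?r `` {v}) \<in> ?r `` {v}" by (rule someI)
        then have "f (SOME w. w \<in> ?r `` {v}) = f v" using const[OF f(2)] by force
        then show ?thesis using True X by simp
      qed (use f in auto)
    qed
    show "?\<phi> ` (V // ?r \<rightarrow>\<^sub>E S) \<subseteq> {f \<in> V \<rightarrow>\<^sub>E S. \<forall>e\<in>A. \<forall>u\<in>e. \<forall>v\<in>e. f u = f v}"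
    proof clarify
      fix g assume g: "g \<in> V // ?r \<rightarrow>\<^sub>E S"
      have "?\<phi> g \<in> V \<rightarrow>\<^sub>E S" using g quotientI[of _ V ?r] by (auto simp: PiE_def Pi_def)
      moreover have "?\<phi> g u = ?\<phi> g v" if "e \<in> A" "u \<in> e" "v \<in> e" for e u v
      proof -
        have "u \<in> V" "v \<in> V" "u = v \<or> e = {u, v}"
          using assms(3)[OF that(1)] that by (auto simp: card_2_iff)
        then have "(u, v) \<in> ?r" using that(1) by (auto simp: reach_def)
        then have "?r `` {u} = ?r `` {v}" using eq equiv_class_eq by metis
        then show ?thesis using \<open>u \<in> V\<close> \<open>v \<in> V\<close> by simp
      qed
      ultimately show "?\<phi> g \<in> V \<rightarrow>\<^sub>E S \<and> (\<forall>e\<in>A. \<forall>u\<in>e. \<forall>v\<in>e. ?\<phi> g u = ?\<phi> g v)" by blast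
    qed
    show "(\<lambda>f. \<lambda>X\<in>V // ?r. f (SOME v. v \<in> X)) ` {f \<in> V \<rightarrow>\<^sub>E S. \<forall>e\<in>A. \<forall>u\<in>e. \<forall>v\<in>e. f u = f v}
      \<subseteq> V // ?r \<rightarrow>\<^sub>E S"
      using some by (auto simp: PiE_def Pi_def)
  qed
  then have "card {f \<in> V \<rightarrow>\<^sub>E S. \<forall>e\<in>A. \<forall>u\<in>e. \<forall>v\<in>e. f u = f v} = card (V // ?r \<rightarrow>\<^sub>E S)"
    by (simp add: bij_betw_same_card)
  also have "\<dots> = card S ^ num_components V A"
    using assms(1) finite_quotient[OF \<open>finite V\<close>, of ?r]
    by (subst card_PiE) (auto simp: num_components_def reach_def)
  finally show ?thesis .
qed

lemma finite_edges: "simple_graph G \<Longrightarrow> finite (edges G)"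
  unfolding simple_graph_def by (rule finite_subset[of _ "Pow (verts G)"]) auto

text \<open>Inclusion-exclusion over violated edges: the indicator of a proper colouring is the
  product over all edges of 1 minus the indicator of being monochromatic, and expanding it leaves
  sums counted by \<open>card_monochromatic\<close>. Agreement at all natural numbers of colours
  gives equality of polynomials.\<close>

theorem chromatic_poly_whitney:
  assumes G: "simple_graph G"
  shows "poly (chromatic_poly G) x =
    (\<Sum>A\<in>Pow (edges G). (-1) ^ card A * x ^ num_components (verts G) A)"
proof -
  let ?V = "verts G" and ?E = "edges G"
  have fV: "finite ?V" and E: "\<And>e. e \<in> ?E \<Longrightarrow> e \<subseteq> ?V \<and> card e = 2"
    using G by (auto simp: simple_graph_def)
  have fE: "finite ?E" using G by (rule finite_edges)
  define mono where "mono f e \<longleftrightarrow> (\<forall>u\<in>e. \<forall>v\<in>e. f u = f v)" for f :: "'a \<Rightarrow> nat" and e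
  define p where "p = (\<Sum>A\<in>Pow ?E. monom ((-1) ^ card A :: real) (num_components ?V A))"
  have "chromatic_poly G = p"
  proof (rule chromatic_poly_unique)
    fix q :: nat
    let ?F = "?V \<rightarrow>\<^sub>E {..<q}"
    have fF: "finite ?F" using fV by (intro finite_PiE) auto
    have "proper_colorings G {..<q} = {f \<in> ?F. \<forall>e\<in>?E. \<not> mono f e}"
    proof -
      have "(\<forall>u v. {u, v} \<in> ?E \<longrightarrow> f u \<noteq> f v) \<longleftrightarrow> (\<forall>e\<in>?E. \<not> mono f e)" for f
      proof (intro iffI allI impI ballI notI)
        fix e assume *: "\<forall>u v. {u, v} \<in> ?E \<longrightarrow> f u \<noteq> f v" "e \<in> ?E" "mono f e"
        obtain u v where "e = {u, v}" using E[OF *(2)] by (auto simp: card_2_iff)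
        then show False using * by (auto simp: mono_def)
      next
        fix u v assume *: "\<forall>e\<in>?E. \<not> mono f e" "{u, v} \<in> ?E" "f u = f v"
        then have "mono f {u, v}" by (auto simp: mono_def)
        then show False using * by blast
      qed
      then show ?thesis by (simp add: proper_colorings_def)
    qed
    then have "real (card (proper_colorings G {..<q})) = (\<Sum>f\<in>?F. of_bool (\<forall>e\<in>?E. \<not> mono f e))"
      using fF by (simp add: Int_def)
    also have "\<dots> = (\<Sum>f\<in>?F. \<Prod>e\<in>?E. 1 - of_bool (mono f e))"
      using fE by (intro sum.cong refl) (auto simp: prod_zero_iff)
    also have "\<dots> = (\<Sum>f\<in>?F. \<Sum>A\<in>Pow ?E. (-1) ^ card A * of_bool (\<forall>e\<in>A. mono f e))"
    proof (intro sum.cong refl)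
      fix f
      have "(\<Prod>e\<in>A. of_bool (mono f e)) = (of_bool (\<forall>e\<in>A. mono f e) :: real)" if "A \<in> Pow ?E" for A
        using finite_subset[of A, OF _ fE] that by (auto simp: prod_zero_iff)
      then show "(\<Prod>e\<in>?E. 1 - of_bool (mono f e) :: real) =
        (\<Sum>A\<in>Pow ?E. (-1) ^ card A * of_bool (\<forall>e\<in>A. mono f e))"
        by (subst prod_diff_conv_sum[OF fE]) (auto intro!: sum.cong)
    qed
    also have "\<dots> = (\<Sum>A\<in>Pow ?E. (-1) ^ card A * (\<Sum>f\<in>?F. of_bool (\<forall>e\<in>A. mono f e)))"
      by (subst sum.swap) (simp add: sum_distrib_left)
    also have "\<dots> = (\<Sum>A\<in>Pow ?E. (-1) ^ card A * real q ^ num_components ?V A)"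
    proof (intro sum.cong refl arg_cong2[where f = "(*)"])
      fix A assume A: "A \<in> Pow ?E"
      have "(\<Sum>f\<in>?F. of_bool (\<forall>e\<in>A. mono f e)) = real (card {f \<in> ?F. \<forall>e\<in>A. mono f e})"
        using fF by (simp add: Int_def)
      also have "\<dots> = real q ^ num_components ?V A"
        using card_monochromatic[OF fV, of "{..<q}" A] A E by (auto simp: mono_def)
      finally show "(\<Sum>f\<in>?F. of_bool (\<forall>e\<in>A. mono f e)) = real q ^ num_components ?V A" .
    qed
    finally show "poly (chromatic_poly G) (real q) = poly p (real q)"
      using poly_chromatic_poly[OF G] by (simp add: p_def poly_sum poly_monom)
  qed
  then show ?thesis by (simp add: p_def poly_sum poly_monom)
qed

text \<open>Components avoiding both \<open>a\<close> and \<open>b\<close> survive unchanged and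
  differ from the component that now contains \<open>a\<close>. At most two old components and
  exactly one new one are left out of this comparison.\<close>

lemma num_components_insert:
  assumes V: "finite V" and ab: "a \<in> V" "b \<in> V" and A: "\<And>e. e \<in> A \<Longrightarrow> e \<subseteq> V"
  shows "num_components V A \<le> Suc (num_components V (insert {a, b} A))"
proof -
  let ?r = "reach V A" and ?r' = "reach V (insert {a, b} A)"
  have fin: "finite (V // ?r)" "finite (V // ?r')"
    using V by (auto intro!: finite_quotient simp: reach_def)
  have sub: "V // ?r - {?r `` {a}, ?r `` {b}} \<subseteq> V // ?r' - {?r' `` {a}}"
  proof
    fix X assume X: "X \<in> V // ?r - {?r `` {a}, ?r `` {b}}"
    then obtain x where x: "x \<in> V" "X = ?r `` {x}" by (auto elim: quotientE)
    have nab: "a \<notin> X" "b \<notin> X"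
      using X x equiv_class_eq[OF equiv_reach, of x _ V A] by auto
    have "(x, y) \<in> {(x, y). {x, y} \<in> A}\<^sup>*"
      if "(x, y) \<in> {(x, y). {x, y} \<in> insert {a, b} A}\<^sup>*" for y
      using that
    proof induction
      case (step y z)
      have "y \<noteq> a" "y \<noteq> b" using nab x ab step by (auto simp: reach_def)
      then have "{y, z} \<in> A" using step.hyps(2) by (auto simp: doubleton_eq_iff)
      then show ?case using step.IH by (auto intro: rtrancl.rtrancl_into_rtrancl)
    qed simp
    moreover have "{(x, y). {x, y} \<in> A}\<^sup>* \<subseteq> {(x, y). {x, y} \<in> insert {a, b} A}\<^sup>*"
      by (rule rtrancl_mono) auto
    ultimately have "?r `` {x} = ?r' `` {x}" by (auto simp: reach_def)
    moreover have "a \<in> ?r' `` {a}" using ab by (auto simp: reach_def)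
    ultimately show "X \<in> V // ?r' - {?r' `` {a}}" using x nab by (auto intro: quotientI)
  qed
  have "card {?r `` {a}, ?r `` {b}} \<le> 2" by (simp add: card_insert_if)
  then have "card (V // ?r) - 2 \<le> card (V // ?r - {?r `` {a}, ?r `` {b}})"
    using diff_card_le_card_Diff[of "{?r `` {a}, ?r `` {b}}" "V // ?r"] by simp
  also have "\<dots> \<le> card (V // ?r' - {?r' `` {a}})" by (rule card_mono) (use fin sub in auto)
  also have "\<dots> = card (V // ?r') - 1" using fin ab by (simp add: quotientI)
  finally have "card (V // ?r) - 2 \<le> card (V // ?r') - 1" .
  \<comment> \<open>The truncated subtraction on the right is exact because the new count is
    positive; if the one on the left truncates, the old count is below 2 and the claim is
    immediate.\<close>
  moreover have "card (V // ?r') > 0" using fin ab by (auto simp: card_gt_0_iff intro: quotientI)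
  ultimately show ?thesis by (simp add: num_components_def)
qed

text \<open>Makes the exponent of \<open>y - 1\<close> in \<open>tutte\<close> a true difference:
  starting from isolated vertices, each edge lowers the number of components by at most one.\<close>

lemma card_verts_le:
  assumes V: "finite V" and "finite A" and "\<And>e. e \<in> A \<Longrightarrow> e \<subseteq> V \<and> card e = 2"
  shows "card V \<le> card A + num_components V A"
  using assms(2,3)
proof induction
  case empty
  have "reach V {} = Id_on V" by (auto simp: reach_def)
  then have "V // reach V {} = (\<lambda>v. {v}) ` V" by (auto simp: quotient_def Id_on_def)
  then show ?case by (simp add: num_components_def card_image)
next
  case (insert e A)
  obtain a b where e: "e = {a, b}" using insert.prems[of e] by (auto simp: card_2_iff)
  have "num_components V A \<le> Suc (num_components V (insert e A))"
    unfolding e by (rule num_components_insert[OF V]) (use insert.prems e in auto)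
  then show ?case using insert by auto
qed

text \<open>Whitney's expansion at \<open>-s\<close> and the rank-nullity expansion agree term by
  term: \<open>x - 1\<close> is \<open>s\<close>, \<open>y - 1\<close> is -1 and carries the sign.
  Connectedness gives k(E) = 1, so the exponent k(A) - k(E) is one short of k(A), which the factor
  \<open>s\<close> in front makes up.\<close>

theorem H_eq_tutte:
  assumes G: "simple_graph G" and C: "connected_graph G"
  shows "H s G = s * tutte G (1 + s) 0"
proof -
  let ?V = "verts G" and ?E = "edges G"
  let ?k = "num_components ?V"
  have fV: "finite ?V" and E: "\<And>e. e \<in> ?E \<Longrightarrow> e \<subseteq> ?V \<and> card e = 2"
    using G by (auto simp: simple_graph_def)
  have fE: "finite ?E" using G by (rule finite_edges)
  have ne: "?V \<noteq> {}" and r: "reach ?V ?E = ?V \<times> ?V" using C by (auto simp: connected_graph_def)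
  have "?V // (?V \<times> ?V) = {?V}" using ne by (auto simp: quotient_def)
  then have kE: "?k ?E = 1" by (simp add: num_components_def r)
  have "(-1) ^ card ?V * ((-1) ^ card A * (- s) ^ ?k A) =
    s * ((1 + s - 1) ^ (?k A - ?k ?E) * (0 - 1) ^ (card A + ?k A - card ?V))" if A: "A \<in> Pow ?E" for A
  proof -
    have "?k A > 0"
      using fV ne by (auto simp: num_components_def card_gt_0_iff reach_def quotient_def
          intro!: finite_quotient)
    then have s: "s * s ^ (?k A - 1) = s ^ ?k A" by (cases "?k A") auto
    have le: "card ?V \<le> card A + ?k A"
      using A E fE by (intro card_verts_le fV) (auto intro: finite_subset)
    define d where "d = card A + ?k A - card ?V"
    have d: "card A + ?k A = card ?V + d" using le by (simp add: d_def)
    have "(-1) ^ card ?V * ((-1) ^ card A * (- s) ^ ?k A) = (-1) ^ card ?V * (-1) ^ (card A + ?k A) * s ^ ?k A"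
      by (subst power_minus) (simp add: power_add mult_ac)
    also have "(-1) ^ card ?V * (-1) ^ (card A + ?k A) = (-1 :: real) ^ d"
      by (simp add: d power_add flip: mult.assoc power_mult_distrib)
    finally show ?thesis using s kE by (simp add: d_def mult.assoc[symmetric]) 
  qed
  then show ?thesis
    unfolding H_def tutte_def chromatic_poly_whitney[OF G] sum_distrib_left
    by (intro sum.cong refl) auto
qed

section \<open>Positivity and acyclic orientations\<close>

text \<open>Injectivity on edges, unlike the condition on ordered pairs, passes directly through
  images of edges, as contraction requires.\<close>

lemma proper_colorings_inj_on:
  assumes "simple_graph G"
  shows "proper_colorings G S = {f \<in> verts G \<rightarrow>\<^sub>E S. \<forall>e\<in>edges G. inj_on f e}"
proof -
  have "(\<forall>u v. {u, v} \<in> edges G \<longrightarrow> f u \<noteq> f v) \<longleftrightarrow> (\<forall>e\<in>edges G. inj_on f e)" for f :: "'a \<Rightarrow> 'b"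
  proof (intro iffI allI impI ballI notI)
    fix e assume *: "\<forall>u v. {u, v} \<in> edges G \<longrightarrow> f u \<noteq> f v" "e \<in> edges G"
    then have "card e = 2" using assms by (simp add: simple_graph_def)
    then obtain u v where "e = {u, v}" by (auto simp: card_2_iff)
    then show "inj_on f e" using * by auto
  next
    fix u v assume *: "\<forall>e\<in>edges G. inj_on f e" "{u, v} \<in> edges G" "f u = f v"
    then have "u = v" by (auto dest!: bspec)
    then show False using assms *(2) by (auto simp: simple_graph_def)
  qed
  then show ?thesis by (simp add: proper_colorings_def)
qed

definition delete_edge :: "'a graph \<Rightarrow> 'a \<Rightarrow> 'a \<Rightarrow> 'a graph" where
  "delete_edge G u v = (verts G, edges G - {{u, v}})"

text \<open>Edges form a set of images, so parallel edges arising from the contraction merge. Only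
  \<open>{u, v}\<close> itself would collapse to a singleton, and it is removed beforehand.\<close>

definition contract_edge :: "'a graph \<Rightarrow> 'a \<Rightarrow> 'a \<Rightarrow> 'a graph" where
  "contract_edge G u v = (verts G - {v}, (`) (\<lambda>x. if x = v then u else x) ` (edges G - {{u, v}}))"

text \<open>Proper colourings of the graph without the edge split according to whether
  \<open>u\<close> and \<open>v\<close> get different colours (proper for \<open>G\<close>) or the
  same colour (proper for the contraction, by restriction to the remaining vertices).\<close>

lemma deletion_contraction:
  assumes G: "simple_graph G" and uv: "{u, v} \<in> edges G"
  shows "simple_graph (delete_edge G u v)" "simple_graph (contract_edge G u v)"
    "chromatic_poly (delete_edge G u v) = chromatic_poly G + chromatic_poly (contract_edge G u v)"
proof -
  let ?V = "verts G" and ?E = "edges G - {{u, v}}"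
  let ?G1 = "delete_edge G u v" and ?G2 = "contract_edge G u v"
  let ?g = "\<lambda>x. if x = v then u else x"
  have fV: "finite ?V" and E: "\<And>e. e \<in> edges G \<Longrightarrow> e \<subseteq> ?V \<and> card e = 2"
    using G by (auto simp: simple_graph_def)
  have u: "u \<in> ?V" "v \<in> ?V" "u \<noteq> v" using E[OF uv] by auto
  have inj: "inj_on ?g d" if "d \<in> ?E" for d
  proof -
    have d: "card d = 2" "d \<noteq> {u, v}" using that E by auto
    then obtain a b where "d = {a, b}" "a \<noteq> b" by (auto simp: card_2_iff)
    then show ?thesis using d by (auto simp: insert_commute)
  qed
  have img: "?g ` d \<subseteq> ?V - {v}" if "d \<in> ?E" for d
    using that E[of d] u by auto
  show G1: "simple_graph ?G1" using G by (auto simp: simple_graph_def delete_edge_def)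
  show G2: "simple_graph ?G2"
    unfolding simple_graph_def contract_edge_def fst_conv snd_conv
  proof (intro conjI ballI)
    fix e assume "e \<in> (`) ?g ` ?E"
    then obtain d where d: "d \<in> ?E" "e = ?g ` d" by blast
    show "e \<subseteq> ?V - {v}" using img[OF d(1)] d(2) by simp
    show "card e = 2" using card_image[OF inj[OF d(1)]] E[of d] d by simp
  qed (use fV in simp)
  show "chromatic_poly ?G1 = chromatic_poly G + chromatic_poly ?G2"
  proof (rule chromatic_poly_unique)
    fix q :: nat
    let ?S = "{..<q}"
    let ?M = "{f \<in> proper_colorings ?G1 ?S. f u = f v}"
    have fin: "finite (proper_colorings ?G1 ?S)"
      by (rule finite_proper_colorings) (use fV in \<open>auto simp: delete_edge_def\<close>)
    have "proper_colorings G ?S = {f \<in> proper_colorings ?G1 ?S. f u \<noteq> f v}"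
      using uv unfolding proper_colorings_def delete_edge_def
      by (auto simp: doubleton_eq_iff) metis
    then have "proper_colorings ?G1 ?S = proper_colorings G ?S \<union> ?M" by auto
    moreover have "proper_colorings G ?S \<inter> ?M = {}"
      using uv by (auto simp: proper_colorings_def)
    ultimately have "card (proper_colorings ?G1 ?S) = card (proper_colorings G ?S) + card ?M"
      using fin finite_proper_colorings[OF fV, of ?S] card_Un_disjoint[of "proper_colorings G ?S" ?M]
      by simp
    moreover have "bij_betw (\<lambda>f. restrict f (?V - {v})) ?M (proper_colorings ?G2 ?S)"
    proof (rule bij_betw_byWitness[where f' = "\<lambda>h. \<lambda>x\<in>?V. h (?g x)"])
      show "\<forall>f\<in>?M. (\<lambda>x\<in>?V. restrict f (?V - {v}) (?g x)) = f"
        using u by (auto simp: proper_colorings_def delete_edge_def PiE_def extensional_def fun_eq_iff)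
      show "\<forall>h\<in>proper_colorings ?G2 ?S. restrict (\<lambda>x\<in>?V. h (?g x)) (?V - {v}) = h"
        by (auto simp: proper_colorings_def contract_edge_def PiE_def extensional_def fun_eq_iff)
      show "(\<lambda>f. restrict f (?V - {v})) ` ?M \<subseteq> proper_colorings ?G2 ?S"
      proof clarify
        fix f assume f: "f \<in> proper_colorings ?G1 ?S" "f u = f v"
        have "inj_on (restrict f (?V - {v})) (?g ` d)" if d: "d \<in> ?E" for d
        proof -
          have "inj_on f d" using f(1)[unfolded proper_colorings_inj_on[OF G1]] d
            by (simp add: delete_edge_def)
          moreover have "(restrict f (?V - {v}) \<circ> ?g) x = f x" if "x \<in> d" for x
            using that img[OF d] f(2) u E[of d] d by auto
          ultimately have "inj_on (restrict f (?V - {v}) \<circ> ?g) d"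
            using inj_on_cong[of d "restrict f (?V - {v}) \<circ> ?g" f] by blast
          then show ?thesis by (rule inj_on_imageI)
        qed
        then show "restrict f (?V - {v}) \<in> proper_colorings ?G2 ?S"
          using f(1) unfolding proper_colorings_inj_on[OF G2]
          by (auto simp: contract_edge_def proper_colorings_def delete_edge_def)
      qed
      show "(\<lambda>h. \<lambda>x\<in>?V. h (?g x)) ` proper_colorings ?G2 ?S \<subseteq> ?M"
      proof clarify
        fix h assume h: "h \<in> proper_colorings ?G2 ?S"
        have "inj_on (\<lambda>x\<in>?V. h (?g x)) d" if d: "d \<in> ?E" for d
        proof -
          have "inj_on h (?g ` d)" using h d
            unfolding proper_colorings_inj_on[OF G2] by (auto simp: contract_edge_def)
          then have "inj_on (h \<circ> ?g) d" using inj[OF d] by (rule comp_inj_on[rotated])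
          moreover have "(\<lambda>x\<in>?V. h (?g x)) x = (h \<circ> ?g) x" if "x \<in> d" for x
            using that E[of d] d by auto
          ultimately show ?thesis
            using inj_on_cong[of d "\<lambda>x\<in>?V. h (?g x)" "h \<circ> ?g"] by blast
        qed
        moreover have "(\<lambda>x\<in>?V. h (?g x)) \<in> ?V \<rightarrow>\<^sub>E ?S"
          using h u by (auto simp: proper_colorings_def contract_edge_def)
        ultimately show "(\<lambda>x\<in>?V. h (?g x)) \<in> proper_colorings ?G1 ?S \<and>
            (\<lambda>x\<in>?V. h (?g x)) u = (\<lambda>x\<in>?V. h (?g x)) v"
          using u unfolding proper_colorings_inj_on[OF G1] by (auto simp: delete_edge_def)
      qed
    qed
    ultimately show "poly (chromatic_poly ?G1) (real q) =
        poly (chromatic_poly G + chromatic_poly ?G2) (real q)"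
      using poly_chromatic_poly[OF G] poly_chromatic_poly[OF G1] poly_chromatic_poly[OF G2]
      by (simp add: bij_betw_same_card)
  qed
qed

text \<open>The contraction has one vertex fewer, so the sign in \<open>H\<close> turns the
  difference of chromatic polynomials into a sum: H of G is H of the deletion plus H of the
  contraction. The recursion ends at edgeless graphs with the value s^|V|.\<close>

lemma H_pos:
  assumes "simple_graph G" and s: "s > 0"
  shows "H s G > 0"
  using assms(1)
proof (induction "card (edges G)" arbitrary: G rule: less_induct)
  case less
  note G = less.prems
  have fV: "finite (verts G)" using G by (simp add: simple_graph_def)
  have fE: "finite (edges G)" using G by (rule finite_edges)
  show ?case
  proof (cases "edges G = {}")
    case True
    have "proper_colorings G {..<q} = verts G \<rightarrow>\<^sub>E {..<q}" for q :: nat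
      using True by (auto simp: proper_colorings_def)
    then have "chromatic_poly G = monom 1 (card (verts G))"
      using poly_chromatic_poly[OF G] fV
      by (intro chromatic_poly_unique) (simp add: card_PiE poly_monom)
    then show ?thesis using s by (simp add: H_def poly_monom power_minus[of s])
  next
    case False
    then obtain e where e: "e \<in> edges G" by blast
    then have "card e = 2" using G by (auto simp: simple_graph_def)
    then obtain u v where uv: "e = {u, v}" by (auto simp: card_2_iff)
    note dc = deletion_contraction[OF G e[unfolded uv]]
    have card: "card (edges G - {{u, v}}) < card (edges G)"
      using e uv fE by (intro psubset_card_mono) auto
    then have 1: "H s (delete_edge G u v) > 0"
      by (intro less.hyps dc) (simp add: delete_edge_def)
    have 2: "H s (contract_edge G u v) > 0"
      using card_image_le[of "edges G - {{u, v}}" "(`) (\<lambda>x. if x = v then u else x)"] fE card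
      by (intro less.hyps dc) (simp add: contract_edge_def)
    have "v \<in> verts G" using e uv G by (auto simp: simple_graph_def)
    then have "card (verts G) = Suc (card (verts G - {v}))" using fV by (rule card.remove[rotated])
    then have "H s G = H s (delete_edge G u v) + H s (contract_edge G u v)"
      using dc(3) by (simp add: H_def delete_edge_def contract_edge_def algebra_simps)
    then show ?thesis using 1 2 by simp
  qed
qed

section \<open>Recursion of the chromatic polynomial over independent sets\<close>

definition induced :: "'a graph \<Rightarrow> 'a set \<Rightarrow> 'a graph" where
  "induced G U = (U, {e \<in> edges G. e \<subseteq> U})"

definition independent_sets :: "'a graph \<Rightarrow> 'a set set" where
  "independent_sets G = {S. S \<subseteq> verts G \<and> (\<forall>e\<in>edges G. \<not> e \<subseteq> S)}"

lemma simple_graph_induced: "simple_graph G \<Longrightarrow> U \<subseteq> verts G \<Longrightarrow> simple_graph (induced G U)"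
  using finite_subset[of U "verts G"] by (auto simp: simple_graph_def induced_def)

lemma finite_independent_sets: "simple_graph G \<Longrightarrow> finite (independent_sets G)"
  by (rule finite_subset[of _ "Pow (verts G)"]) (auto simp: independent_sets_def simple_graph_def)

text \<open>The class of the last colour \<open>q\<close> is an independent set, and what remains is
  an arbitrary proper colouring of its complement with \<open>q\<close> colours.\<close>

lemma card_proper_colorings_Suc:
  assumes G: "simple_graph G"
  shows "card (proper_colorings G {..<Suc q}) =
    (\<Sum>S\<in>independent_sets G. card (proper_colorings (induced G (verts G - S)) {..<q}))"
proof -
  let ?V = "verts G"
  let ?F = "\<lambda>S. {f \<in> proper_colorings G {..<Suc q}. {x \<in> ?V. f x = q} = S}"
  have fV: "finite ?V" and E: "\<And>e. e \<in> edges G \<Longrightarrow> e \<subseteq> ?V \<and> card e = 2"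
    using G by (auto simp: simple_graph_def)
  have fin: "finite (proper_colorings G {..<Suc q})" by (rule finite_proper_colorings) (use fV in auto)
  have "{x \<in> ?V. f x = q} \<in> independent_sets G" if "f \<in> proper_colorings G {..<Suc q}" for f
  proof -
    have "inj_on f e" if "e \<in> edges G" for e
      using that \<open>f \<in> _\<close> by (simp add: proper_colorings_inj_on[OF G])
    moreover have "\<not> inj_on f e" if e: "e \<in> edges G" "e \<subseteq> {x \<in> ?V. f x = q}" for e
    proof -
      obtain a b where "e = {a, b}" "a \<noteq> b" using E[OF e(1)] by (auto simp: card_2_iff)
      then show ?thesis using e(2) by auto
    qed
    ultimately show ?thesis by (auto simp: independent_sets_def)
  qed
  then have "(\<Union>S\<in>independent_sets G. ?F S) = proper_colorings G {..<Suc q}" by auto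
  moreover have "card (\<Union>S\<in>independent_sets G. ?F S) = (\<Sum>S\<in>independent_sets G. card (?F S))"
    by (intro card_UN_disjoint finite_independent_sets[OF G] ballI impI) (use fin in auto)
  ultimately have "card (proper_colorings G {..<Suc q}) = (\<Sum>S\<in>independent_sets G. card (?F S))"
    by simp
  also have "\<dots> = (\<Sum>S\<in>independent_sets G. card (proper_colorings (induced G (?V - S)) {..<q}))"
  proof (intro sum.cong refl bij_betw_same_card)
    fix S assume S: "S \<in> independent_sets G"
    then have SV: "S \<subseteq> ?V" by (simp add: independent_sets_def)
    let ?P = "proper_colorings (induced G (?V - S)) {..<q}"
    show "bij_betw (\<lambda>f. restrict f (?V - S)) (?F S) ?P"
    proof (rule bij_betw_byWitness[where f' = "\<lambda>h. \<lambda>x\<in>?V. if x \<in> S then q else h x"])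
      show "\<forall>f\<in>?F S. (\<lambda>x\<in>?V. if x \<in> S then q else restrict f (?V - S) x) = f"
        by (auto simp: proper_colorings_def PiE_def extensional_def fun_eq_iff)
      show "\<forall>h\<in>?P. restrict (\<lambda>x\<in>?V. if x \<in> S then q else h x) (?V - S) = h"
        by (auto simp: proper_colorings_def induced_def PiE_def extensional_def fun_eq_iff)
      show "(\<lambda>f. restrict f (?V - S)) ` ?F S \<subseteq> ?P"
        by (fastforce simp: proper_colorings_def induced_def less_Suc_eq PiE_iff)
      show "(\<lambda>h. \<lambda>x\<in>?V. if x \<in> S then q else h x) ` ?P \<subseteq> ?F S"
      proof clarify
        fix h assume h: "h \<in> ?P"
        let ?f = "\<lambda>x\<in>?V. if x \<in> S then q else h x"
        have hq: "h x < q" if "x \<in> ?V - S" for x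
          using h that by (auto simp: proper_colorings_def induced_def)
        have "?f u \<noteq> ?f v" if e: "{u, v} \<in> edges G" for u v
        proof -
          have "u \<in> ?V" "v \<in> ?V" using E[OF e] by auto
          moreover have "\<not> (u \<in> S \<and> v \<in> S)" using S e by (auto simp: independent_sets_def)
          moreover have "h u \<noteq> h v" if "u \<notin> S" "v \<notin> S"
            using h that e calculation(1,2) by (auto simp: proper_colorings_def induced_def)
          ultimately show ?thesis using hq[of u] hq[of v] by auto
        qed
        moreover have "?f \<in> ?V \<rightarrow>\<^sub>E {..<Suc q}" using hq by (auto simp: less_Suc_eq)
        moreover have "{x \<in> ?V. ?f x = q} = S"
          using SV by (auto dest: hq[OF DiffI, THEN less_imp_neq] split: if_splits)
        ultimately show "?f \<in> proper_colorings G {..<Suc q} \<and> {x \<in> ?V. ?f x = q} = S"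
          by (auto simp: proper_colorings_def)
      qed
    qed
  qed
  finally show ?thesis .
qed

text \<open>Used at \<open>x = -1\<close>, where the left-hand side becomes the value at 0, which
  vanishes as a nonempty vertex set cannot be coloured with no colours.\<close>

lemma chromatic_poly_plus_one:
  assumes G: "simple_graph G"
  shows "poly (chromatic_poly G) (x + 1) =
    (\<Sum>S\<in>independent_sets G. poly (chromatic_poly (induced G (verts G - S))) x)"
proof -
  have "pcompose (chromatic_poly G) [:1, 1:] =
    (\<Sum>S\<in>independent_sets G. chromatic_poly (induced G (verts G - S)))"
  proof (rule chromatic_poly_unique)
    fix q :: nat
    have "poly (chromatic_poly G) (1 + real q) = real (card (proper_colorings G {..<Suc q}))"
      using poly_chromatic_poly[OF G, of "Suc q"] by simp
    also have "\<dots> = (\<Sum>S\<in>independent_sets G. poly (chromatic_poly (induced G (verts G - S))) (real q))"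
      unfolding card_proper_colorings_Suc[OF G] of_nat_sum
      by (intro sum.cong refl poly_chromatic_poly[symmetric] simple_graph_induced G) auto
    finally show "poly (pcompose (chromatic_poly G) [:1, 1:]) (real q) =
        poly (\<Sum>S\<in>independent_sets G. chromatic_poly (induced G (verts G - S))) (real q)"
      by (simp add: poly_pcompose poly_sum)
  qed
  from arg_cong[OF this, of "\<lambda>p. poly p x"] show ?thesis
    by (simp add: poly_pcompose poly_sum add.commute)
qed

section \<open>Acyclic orientations and their sets of sinks\<close>

lemma finite_acyclic_orientations:
  assumes "simple_graph G"
  shows "finite (acyclic_orientations G)"
proof (rule finite_subset)
  show "acyclic_orientations G \<subseteq> Pow (verts G \<times> verts G)"
    using assms by (fastforce simp: acyclic_orientations_def simple_graph_def)
  show "finite (Pow (verts G \<times> verts G))" using assms by (simp add: simple_graph_def)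
qed

definition sinks :: "'a graph \<Rightarrow> ('a \<times> 'a) set \<Rightarrow> 'a set" where
  "sinks G R = {v \<in> verts G. \<forall>w. (v, w) \<notin> R}"

text \<open>Arrows of \<open>T\<close> enter \<open>S\<close> and no arrow leaves \<open>S\<close>,
  so a cycle could not use \<open>T\<close> and would lie in \<open>R\<close>.\<close>

lemma acyclic_Un_into_sinks:
  assumes "acyclic R" "\<And>x y. (x, y) \<in> R \<Longrightarrow> x \<notin> S \<and> y \<notin> S" "\<And>x y. (x, y) \<in> T \<Longrightarrow> x \<notin> S \<and> y \<in> S"
  shows "acyclic (R \<union> T)"
proof -
  have "x \<notin> S \<and> (y \<in> S \<or> (x, y) \<in> R\<^sup>+)" if "(x, y) \<in> (R \<union> T)\<^sup>+" for x y
    using that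
  proof induction
    case (step y z)
    then show ?case using assms(2,3) by (blast intro: trancl_into_trancl)
  qed (use assms(2,3) in blast)
  then show ?thesis using assms(1) unfolding acyclic_def by blast
qed

text \<open>If all of \<open>S\<close> consists of sinks, every edge meeting \<open>S\<close> is
  forced to point into \<open>S\<close>, and independence excludes edges inside \<open>S\<close>. An
  orientation is therefore determined by its restriction to the complement, and any acyclic one
  extends.\<close>

lemma card_acyclic_orientations_sinks:
  assumes G: "simple_graph G" and S: "S \<in> independent_sets G"
  shows "card (acyclic_orientations (induced G (verts G - S))) =
    card {R \<in> acyclic_orientations G. S \<subseteq> sinks G R}"
proof -
  let ?V = "verts G" and ?U = "verts G - S"
  let ?T = "{(w, v). v \<in> S \<and> {w, v} \<in> edges G}"
  have E: "u \<in> ?V \<and> v \<in> ?V \<and> u \<noteq> v \<and> \<not> (u \<in> S \<and> v \<in> S)" if "{u, v} \<in> edges G" for u v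
  proof -
    have "{u, v} \<subseteq> ?V \<and> card {u, v} = 2" using G that unfolding simple_graph_def by blast
    moreover have "\<not> {u, v} \<subseteq> S" using that S unfolding independent_sets_def by blast
    ultimately show ?thesis by auto
  qed
  have SV: "S \<subseteq> ?V" using S by (simp add: independent_sets_def)
  have "bij_betw (\<lambda>R. R \<union> ?T) (acyclic_orientations (induced G ?U))
      {R \<in> acyclic_orientations G. S \<subseteq> sinks G R}"
  proof (rule bij_betw_byWitness[where f' = "\<lambda>R. R \<inter> ?U \<times> ?U"])
    have sub: "R \<subseteq> ?U \<times> ?U" if "R \<in> acyclic_orientations (induced G ?U)" for R
      using that by (auto simp: acyclic_orientations_def induced_def)
    show "\<forall>R\<in>acyclic_orientations (induced G ?U). (R \<union> ?T) \<inter> ?U \<times> ?U = R"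
      using sub by fast
    show "\<forall>R\<in>{R \<in> acyclic_orientations G. S \<subseteq> sinks G R}. R \<inter> ?U \<times> ?U \<union> ?T = R"
    proof clarify
      fix R assume R: "R \<in> acyclic_orientations G" "S \<subseteq> sinks G R"
      have 1: "(w, v) \<in> R" if "v \<in> S" "{w, v} \<in> edges G" for v w
      proof -
        have "(v, w) \<notin> R" using R(2) that(1) by (auto simp: sinks_def)
        then show ?thesis using R(1) that(2) unfolding acyclic_orientations_def by blast
      qed
      have 2: "(w, v) \<in> ?U \<times> ?U \<or> v \<in> S" "{w, v} \<in> edges G" if "(w, v) \<in> R" for v w
      proof -
        show *: "{w, v} \<in> edges G" using R(1) that by (auto simp: acyclic_orientations_def)
        have "w \<notin> S" using R(2) that by (auto simp: sinks_def)
        then show "(w, v) \<in> ?U \<times> ?U \<or> v \<in> S" using E[OF *] by auto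
      qed
      show "R \<inter> ?U \<times> ?U \<union> ?T = R" using 1 2 by blast
    qed
    show "(\<lambda>R. R \<union> ?T) ` acyclic_orientations (induced G ?U)
        \<subseteq> {R \<in> acyclic_orientations G. S \<subseteq> sinks G R}"
    proof clarify
      fix R assume R: "R \<in> acyclic_orientations (induced G ?U)"
      have RU: "x \<in> ?U" "y \<in> ?U" if "(x, y) \<in> R" for x y using sub[OF R] that by auto
      have T: "x \<notin> S \<and> y \<in> S" if "(x, y) \<in> ?T" for x y using that E by auto
      have "acyclic R" using R by (simp add: acyclic_orientations_def)
      then have "acyclic (R \<union> ?T)"
        by (rule acyclic_Un_into_sinks[where S = S]) (use RU T in blast)+
      moreover have "(u, v) \<in> R \<union> ?T \<longleftrightarrow> (v, u) \<notin> R \<union> ?T" if e: "{u, v} \<in> edges G" for u v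
      proof -
        have e': "{v, u} \<in> edges G" using e by (simp add: insert_commute)
        consider "u \<in> S" "v \<notin> S" | "v \<in> S" "u \<notin> S" | "u \<in> ?U" "v \<in> ?U" using E[OF e] by blast
        then show ?thesis
        proof cases
          case 3
          then have "(u, v) \<in> R \<longleftrightarrow> (v, u) \<notin> R"
            using R e by (auto simp: acyclic_orientations_def induced_def)
          then show ?thesis using 3 by auto
        qed (use RU e e' in blast)+
      qed
      moreover have "{u, v} \<in> edges G" if "(u, v) \<in> R \<union> ?T" for u v
        using that R by (auto simp: acyclic_orientations_def induced_def)
      ultimately have "R \<union> ?T \<in> acyclic_orientations G"
        unfolding acyclic_orientations_def by blast
      moreover have "S \<subseteq> sinks G (R \<union> ?T)"
        using SV RU T unfolding sinks_def by blast
      ultimately show "R \<union> ?T \<in> acyclic_orientations G \<and> S \<subseteq> sinks G (R \<union> ?T)" ..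
    qed
    show "(\<lambda>R. R \<inter> ?U \<times> ?U) ` {R \<in> acyclic_orientations G. S \<subseteq> sinks G R}
        \<subseteq> acyclic_orientations (induced G ?U)"
      by (auto simp: acyclic_orientations_def induced_def elim: acyclic_subset)
  qed
  then show ?thesis by (rule bij_betw_same_card)
qed

lemma sum_Pow_minus_one:
  assumes "finite A" "A \<noteq> {}"
  shows "(\<Sum>S\<in>Pow A. (-1) ^ card S) = (0 :: real)"
  using prod_diff_conv_sum[OF assms(1), of "\<lambda>_. 1 :: real" "\<lambda>_. 1"] assms
  by (simp add: power_0_left card_eq_0_iff)

text \<open>After exchanging the sums, a fixed orientation contributes the alternating sum over all
  subsets of its sinks; every such subset is independent. This sum is 0 because a nonempty acyclic
  orientation has a sink.\<close>

lemma sum_acyclic_orientations_independent_sets: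
  assumes G: "simple_graph G" and ne: "verts G \<noteq> {}"
  shows "(\<Sum>S\<in>independent_sets G.
    (-1) ^ card S * real (card (acyclic_orientations (induced G (verts G - S))))) = 0"
proof -
  let ?I = "independent_sets G" and ?A = "acyclic_orientations G"
  have fV: "finite (verts G)" using G by (simp add: simple_graph_def)
  have fA: "finite ?A" using G by (rule finite_acyclic_orientations)
  have "(\<Sum>S\<in>?I. (-1) ^ card S * real (card (acyclic_orientations (induced G (verts G - S))))) =
      (\<Sum>S\<in>?I. \<Sum>R\<in>?A. (-1) ^ card S * of_bool (S \<subseteq> sinks G R))"
    using fA by (intro sum.cong refl)
      (simp add: card_acyclic_orientations_sinks[OF G] Int_def flip: sum_distrib_left)
  also have "\<dots> = (\<Sum>R\<in>?A. \<Sum>S\<in>?I. (-1) ^ card S * of_bool (S \<subseteq> sinks G R))"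
    by (rule sum.swap)
  also have "\<dots> = (\<Sum>R\<in>?A. 0)"
  proof (intro sum.cong refl)
    fix R assume R: "R \<in> ?A"
    have sub: "sinks G R \<subseteq> verts G" by (auto simp: sinks_def)
    have RV: "R \<subseteq> verts G \<times> verts G"
      using R G by (fastforce simp: acyclic_orientations_def simple_graph_def)
    have "acyclic R" using R by (simp add: acyclic_orientations_def)
    moreover have "finite R" using RV fV by (auto intro: finite_subset)
    ultimately have "wf (R\<inverse>)" by (rule finite_acyclic_wf_converse[rotated])
    \<comment> \<open>A minimal vertex for the converse relation has no outgoing arrow, that is, it
      is a sink.\<close>
    then obtain z where "z \<in> verts G" "\<And>y. (y, z) \<in> R\<inverse> \<Longrightarrow> y \<notin> verts G"
      using ne by (metis wfE_min ex_in_conv)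
    then have "z \<in> sinks G R" using RV by (auto simp: sinks_def)
    moreover have "{S \<in> ?I. S \<subseteq> sinks G R} = Pow (sinks G R)"
    proof -
      have "\<not> e \<subseteq> sinks G R" if e: "e \<in> edges G" for e
      proof -
        have "card e = 2" using e G by (simp add: simple_graph_def)
        then obtain a b where ab: "e = {a, b}" by (auto simp: card_2_iff)
        then have "(a, b) \<in> R \<or> (b, a) \<in> R" using R e by (auto simp: acyclic_orientations_def)
        then show ?thesis using ab by (auto simp: sinks_def)
      qed
      then show ?thesis using sub by (auto simp: independent_sets_def)
    qed
    ultimately show "(\<Sum>S\<in>?I. (-1) ^ card S * of_bool (S \<subseteq> sinks G R)) = (0 :: real)"
      using sum_Pow_minus_one[of "sinks G R"] finite_subset[OF sub fV] finite_independent_sets[OF G]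
      by (auto simp: sum.inter_filter[symmetric] if_distrib of_bool_def cong: if_cong)
  qed
  finally show ?thesis by simp
qed

text \<open>In the vanishing alternating sum the empty set contributes \<open>G\<close> itself,
  while every other term has fewer vertices; so the recursion determines the value at
  \<open>G\<close> by strong induction on the number of vertices.\<close>

theorem card_acyclic_orientations_eq_H:
  assumes "simple_graph G"
  shows "real (card (acyclic_orientations G)) = H 1 G"
  using assms
proof (induction "card (verts G)" arbitrary: G rule: less_induct)
  case less
  note G = less.prems
  let ?V = "verts G" and ?I = "independent_sets G"
  let ?G = "\<lambda>S. induced G (verts G - S)"
  have fV: "finite ?V" and E: "\<And>e. e \<in> edges G \<Longrightarrow> e \<subseteq> ?V \<and> card e = 2"
    using G by (auto simp: simple_graph_def)
  show ?case
  proof (cases "?V = {}")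
    case True
    then have "edges G = {}" using E by fastforce
    then have "acyclic_orientations G = {{}}"
      by (auto simp: acyclic_orientations_def acyclic_def)
    moreover have "proper_colorings G {..<q} = {\<lambda>_. undefined}" for q :: nat
      using True \<open>edges G = {}\<close> by (auto simp: proper_colorings_def)
    then have "chromatic_poly G = 1"
      using poly_chromatic_poly[OF G] by (intro chromatic_poly_unique) simp
    ultimately show ?thesis using True by (simp add: H_def)
  next
    case False
    have E0: "{} \<in> ?I" using E[of "{}"] by (auto simp: independent_sets_def)
    have G0: "?G {} = G" using E by (auto simp: induced_def prod_eq_iff)
    have fI: "finite ?I" using G by (rule finite_independent_sets)
    have sgn: "(-1) ^ card S * H 1 (?G S) = (-1) ^ card ?V * poly (chromatic_poly (?G S)) (-1)"
      if "S \<in> ?I" for S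
    proof -
      have S: "S \<subseteq> ?V" using that by (simp add: independent_sets_def)
      then have "card ?V = card S + card (?V - S)" using fV
        by (metis card_Diff_subset card_mono finite_subset le_add_diff_inverse)
      then show ?thesis by (simp add: H_def induced_def power_add)
    qed
    have "proper_colorings G {..<0::nat} = {}" using False by (auto simp: proper_colorings_def)
    then have "poly (chromatic_poly G) 0 = 0" using poly_chromatic_poly[OF G, of 0] by simp
    then have "(\<Sum>S\<in>?I. poly (chromatic_poly (?G S)) (-1)) = 0"
      using chromatic_poly_plus_one[OF G, of "-1"] by simp
    then have 1: "(\<Sum>S\<in>?I. (-1) ^ card S * H 1 (?G S)) = 0"
      using sgn by (simp flip: sum_distrib_left)
    have 2: "(\<Sum>S\<in>?I. (-1) ^ card S * real (card (acyclic_orientations (?G S)))) = 0"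
      by (rule sum_acyclic_orientations_independent_sets[OF G False])
    have "(\<Sum>S\<in>?I - {{}}. (-1) ^ card S * H 1 (?G S)) =
        (\<Sum>S\<in>?I - {{}}. (-1) ^ card S * real (card (acyclic_orientations (?G S))))"
    proof (intro sum.cong refl arg_cong2[where f = "(*)"] less.hyps[symmetric])
      fix S assume S: "S \<in> ?I - {{}}"
      then have "?V - S \<subset> ?V" by (auto simp: independent_sets_def)
      then show "card (verts (?G S)) < card ?V" using fV by (simp add: induced_def psubset_card_mono)
      show "simple_graph (?G S)" using G by (rule simple_graph_induced) auto
    qed
    then show ?thesis
      using 1 2 sum.remove[OF fI E0, of "\<lambda>S. (-1) ^ card S * H 1 (?G S)"]
        sum.remove[OF fI E0, of "\<lambda>S. (-1) ^ card S * real (card (acyclic_orientations (?G S)))"] G0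
      by simp
  qed
qed

section \<open>Integral representation\<close>

lemma card_proper_colorings_mono:
  assumes G: "simple_graph G" and h: "inj_on h A" "h ` A \<subseteq> B" and "finite B"
  shows "card (proper_colorings G A) \<le> card (proper_colorings G B)"
proof (rule card_inj_on_le)
  let ?\<phi> = "\<lambda>f. restrict (h \<circ> f) (verts G)"
  show "inj_on ?\<phi> (proper_colorings G A)"
  proof (rule inj_onI)
    fix f g assume fg: "f \<in> proper_colorings G A" "g \<in> proper_colorings G A" and eq: "?\<phi> f = ?\<phi> g"
    show "f = g"
    proof (rule extensionalityI[of f "verts G"])
      show "f \<in> extensional (verts G)" "g \<in> extensional (verts G)"
        using fg by (auto simp: proper_colorings_def PiE_def)
      fix x assume x: "x \<in> verts G"
      then have "f x \<in> A" "g x \<in> A" "h (f x) = h (g x)"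
        using fg fun_cong[OF eq, of x] by (auto simp: proper_colorings_def)
      then show "f x = g x" using h(1) by (auto dest: inj_onD)
    qed
  qed
  show "?\<phi> ` proper_colorings G A \<subseteq> proper_colorings G B"
  proof (rule image_subsetI)
    fix f assume f: "f \<in> proper_colorings G A"
    have "?\<phi> f u \<noteq> ?\<phi> f v" if e: "{u, v} \<in> edges G" for u v
    proof -
      have uv: "u \<in> verts G" "v \<in> verts G" using G e by (auto simp: simple_graph_def)
      then have "f u \<in> A" "f v \<in> A" "f u \<noteq> f v" using f e by (auto simp: proper_colorings_def)
      then show ?thesis using h(1) uv by (auto dest: inj_onD)
    qed
    moreover have "?\<phi> f \<in> verts G \<rightarrow>\<^sub>E B" using f h(2) by (fastforce simp: proper_colorings_def)
    ultimately show "?\<phi> f \<in> proper_colorings G B" by (simp add: proper_colorings_def)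
  qed
  show "finite (proper_colorings G B)"
    using finite_proper_colorings[of G B] G \<open>finite B\<close> by (auto simp: simple_graph_def)
qed

lemma card_proper_colorings_eq_poly:
  assumes G: "simple_graph G" and "finite A"
  shows "real (card (proper_colorings G A)) = poly (chromatic_poly G) (real (card A))"
proof -
  obtain h where h: "bij_betw h A {..<card A}"
    using ex_bij_betw_finite_nat[OF \<open>finite A\<close>] by (auto simp: atLeast0LessThan)
  note h' = bij_betw_inv_into[OF h]
  have "card (proper_colorings G A) = card (proper_colorings G {..<card A})"
    using h h' \<open>finite A\<close>
    by (intro antisym card_proper_colorings_mono[OF G, of h] 
        card_proper_colorings_mono[OF G, of "inv_into A h"]) (auto simp: bij_betw_def)
  then show ?thesis by (simp add: poly_chromatic_poly[OF G])
qed

text \<open>Equivalently, exp(-x) times this polynomial is the n-th iterate of the operator -x d/dx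
  applied to exp(-x). That form is the source of the Rolle argument for the roots.\<close>

fun touchard :: "nat \<Rightarrow> real poly" where
  "touchard 0 = 1"
| "touchard (Suc n) = pCons 0 (touchard n - pderiv (touchard n))"

lemma degree_touchard: "degree (touchard n) = n"
  and lead_coeff_touchard: "coeff (touchard n) n = 1"
proof (induction n)
  case (Suc n)
  {
    case 1
    have c: "coeff (touchard n - pderiv (touchard n)) n = 1"
      using Suc by (simp add: coeff_pderiv coeff_eq_0)
    have "degree (touchard n - pderiv (touchard n)) \<le> n"
      using Suc degree_diff_le[of "touchard n" n "pderiv (touchard n)"] by (simp add: degree_pderiv)
    then have "degree (touchard n - pderiv (touchard n)) = n"
      using c by (intro antisym le_degree) auto
    moreover have "touchard n - pderiv (touchard n) \<noteq> 0"
      using c by auto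
    ultimately show ?case by simp
  next
    case 2
    show ?case using Suc by (simp add: coeff_pderiv coeff_eq_0)
  }
qed simp_all

lemma poly_touchard: "poly (touchard n) x = (\<Sum>b\<le>n. coeff (touchard n) b * x ^ b)"
  using poly_altdef[of "touchard n" x] by (simp add: degree_touchard)

text \<open>Up to signs the coefficients of \<^term>\<open>touchard n\<close> are Stirling numbers of the second kind,
  which count the maps with an image of given size.\<close>

lemma sum_card_image_touchard:
  fixes h :: "nat \<Rightarrow> real"
  assumes "finite P" "finite S"
  shows "(\<Sum>f\<in>P \<rightarrow>\<^sub>E S. h (card (f ` P))) =
    (-1) ^ card P * (\<Sum>b\<le>card P. (-1) ^ b * coeff (touchard (card P)) b *
      (\<Prod>i<b. real (card S) - real i) * h b)"
  using assms(1)
proof (induction P arbitrary: h rule: finite_induct)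
  case empty
  then show ?case by simp
next
  case (insert x P)
  let ?q = "card S" and ?n = "card P"
  let ?t = "coeff (touchard ?n)"
  let ?G = "\<lambda>b. (-1) ^ b * (\<Prod>i<b. real ?q - real i) * h b"
  \<comment> \<open>A new point of the domain has \<open>c\<close> values that keep an image of size
    \<open>c\<close>, and \<open>q - c\<close> values that enlarge it to
    \<open>c + 1\<close>.\<close>
  define h' where "h' c = real c * h c + (real ?q - real c) * h (Suc c)" for c
  have inner: "(\<Sum>y\<in>S. h (card (insert y (f ` P)))) = h' (card (f ` P))" if f: "f \<in> P \<rightarrow>\<^sub>E S" for f
  proof -
    have sub: "f ` P \<subseteq> S" using f by auto
    have fin: "finite (f ` P)" using insert.hyps by simp
    have "(\<Sum>y\<in>S. h (card (insert y (f ` P)))) =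
        (\<Sum>y\<in>f ` P. h (card (insert y (f ` P)))) + (\<Sum>y\<in>S - f ` P. h (card (insert y (f ` P))))"
      by (rule sum.subset_diff[OF sub \<open>finite S\<close>, unfolded add.commute[of "sum _ (S - _)"]])
    also have "(\<Sum>y\<in>f ` P. h (card (insert y (f ` P)))) = (\<Sum>y\<in>f ` P. h (card (f ` P)))"
      by (intro sum.cong refl) (simp add: insert_absorb)
    also have "(\<Sum>y\<in>S - f ` P. h (card (insert y (f ` P)))) = (\<Sum>y\<in>S - f ` P. h (Suc (card (f ` P))))"
      by (intro sum.cong refl) (simp add: fin)
    also have "real (card (S - f ` P)) = real ?q - real (card (f ` P))"
      using card_Diff_subset[OF fin sub] card_mono[OF \<open>finite S\<close> sub] by (simp add: of_nat_diff)
    ultimately show ?thesis by (simp add: h'_def)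
  qed
  have "(\<Sum>f\<in>insert x P \<rightarrow>\<^sub>E S. h (card (f ` insert x P))) =
      (\<Sum>(y, f)\<in>S \<times> (P \<rightarrow>\<^sub>E S). h (card ((f(x := y)) ` insert x P)))"
    unfolding PiE_insert_eq
    by (subst sum.reindex[OF inj_combinator[OF insert.hyps(2), of "\<lambda>_. S"]])
      (simp only: o_def case_prod_unfold)
  also have "\<dots> = (\<Sum>(y, f)\<in>S \<times> (P \<rightarrow>\<^sub>E S). h (card (insert y (f ` P))))"
  proof (intro sum.cong refl, clarify)
    fix y f
    have "(f(x := y)) ` insert x P = insert y (f ` P)" using insert.hyps(2) by auto
    then show "h (card ((f(x := y)) ` insert x P)) = h (card (insert y (f ` P)))" by simp
  qed
  also have "\<dots> = (\<Sum>f\<in>P \<rightarrow>\<^sub>E S. \<Sum>y\<in>S. h (card (insert y (f ` P))))"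
    by (simp add: sum.cartesian_product[symmetric] sum.swap[of _ S])
  also have "\<dots> = (\<Sum>f\<in>P \<rightarrow>\<^sub>E S. h' (card (f ` P)))" by (intro sum.cong refl inner)
  also have "\<dots> = (-1) ^ ?n * (\<Sum>b\<le>?n. (-1) ^ b * ?t b * (\<Prod>i<b. real ?q - real i) * h' b)"
    by (rule insert.IH)
  also have "(\<Sum>b\<le>?n. (-1) ^ b * ?t b * (\<Prod>i<b. real ?q - real i) * h' b) =
      (\<Sum>b\<le>?n. real b * ?t b * ?G b) - (\<Sum>b\<le>?n. ?t b * ?G (Suc b))"
    by (simp add: h'_def algebra_simps sum.distrib sum_subtractf)
  \<comment> \<open>Index shift: the term at \<open>b = 0\<close> carries the factor 0, and the
    added top coefficient lies above the degree.\<close>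
  also have "(\<Sum>b\<le>?n. real b * ?t b * ?G b) = (\<Sum>b\<le>?n. real (Suc b) * ?t (Suc b) * ?G (Suc b))"
    using sum.atMost_Suc[of "\<lambda>b. real b * ?t b * ?G b" ?n]
      sum.atMost_Suc_shift[of "\<lambda>b. real b * ?t b * ?G b" ?n]
    by (simp add: coeff_eq_0 degree_touchard)
  also have "(-1) ^ ?n * ((\<Sum>b\<le>?n. real (Suc b) * ?t (Suc b) * ?G (Suc b)) - (\<Sum>b\<le>?n. ?t b * ?G (Suc b))) =
      (-1) ^ Suc ?n * (\<Sum>b\<le>?n. coeff (touchard (Suc ?n)) (Suc b) * ?G (Suc b))"
    by (simp add: coeff_pderiv algebra_simps sum.distrib sum_subtractf)
  also have "(\<Sum>b\<le>?n. coeff (touchard (Suc ?n)) (Suc b) * ?G (Suc b)) =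
      (\<Sum>b\<le>Suc ?n. coeff (touchard (Suc ?n)) b * ?G b)"
    by (subst sum.atMost_Suc_shift) simp
  finally show ?case using insert.hyps by (simp only: card_insert_disjoint mult_ac simp_thms)
qed

section \<open>Adding one part to a complete multipartite graph\<close>

lemma verts_complete_multipartite: "verts (complete_multipartite I p) = (SIGMA i:I. {..<p i})"
  by (simp add: complete_multipartite_def)

lemma edges_complete_multipartite:
  "{u, v} \<in> edges (complete_multipartite I p) \<longleftrightarrow>
    u \<in> (SIGMA i:I. {..<p i}) \<and> v \<in> (SIGMA i:I. {..<p i}) \<and> fst u \<noteq> fst v"
  (is "?L \<longleftrightarrow> ?R")
proof
  assume ?L
  then obtain a b where "{u, v} = {a, b}" "a \<in> (SIGMA i:I. {..<p i})" "b \<in> (SIGMA i:I. {..<p i})"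
      "fst a \<noteq> fst b"
    unfolding complete_multipartite_def snd_conv by blast
  then show ?R by (auto simp: doubleton_eq_iff)
next
  assume ?R
  then show ?L unfolding complete_multipartite_def snd_conv by blast
qed

text \<open>Inside the new part there is no constraint, and every vertex outside is adjacent to all
  of it; so the colours used on the part are exactly those forbidden elsewhere.\<close>

lemma card_proper_colorings_insert_part:
  assumes I: "finite I" "i \<notin> I" and "finite S"
  shows "card (proper_colorings (complete_multipartite (insert i I) p) S) =
    (\<Sum>f\<in>({i} \<times> {..<p i}) \<rightarrow>\<^sub>E S.
      card (proper_colorings (complete_multipartite I p) (S - f ` ({i} \<times> {..<p i}))))"
proof -
  let ?P = "{i} \<times> {..<p i}" and ?W = "SIGMA i:I. {..<p i}"
  let ?G = "complete_multipartite I p" and ?G' = "complete_multipartite (insert i I) p"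
  have V': "verts ?G' = ?P \<union> ?W" by (auto simp: verts_complete_multipartite)
  have disj: "?P \<inter> ?W = {}" using I by auto
  have fW: "finite ?W" using I by auto
  let ?T = "SIGMA f:?P \<rightarrow>\<^sub>E S. proper_colorings ?G (S - f ` ?P)"
  have "bij_betw (\<lambda>g. (restrict g ?P, restrict g ?W)) (proper_colorings ?G' S) ?T"
  proof (rule bij_betw_byWitness[where f' = "\<lambda>(f, h). \<lambda>v. if v \<in> ?P then f v else h v"])
    show "\<forall>g\<in>proper_colorings ?G' S. (case (restrict g ?P, restrict g ?W) of
        (f, h) \<Rightarrow> \<lambda>v. if v \<in> ?P then f v else h v) = g"
      by (auto simp: proper_colorings_def V' PiE_def extensional_def fun_eq_iff)
    show "\<forall>fh\<in>?T. (restrict (case fh of (f, h) \<Rightarrow> \<lambda>v. if v \<in> ?P then f v else h v) ?P,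
        restrict (case fh of (f, h) \<Rightarrow> \<lambda>v. if v \<in> ?P then f v else h v) ?W) = fh"
      using I(2)
      by (auto simp: proper_colorings_def verts_complete_multipartite PiE_def extensional_def fun_eq_iff)
    show "(\<lambda>g. (restrict g ?P, restrict g ?W)) ` proper_colorings ?G' S \<subseteq> ?T"
    proof clarify
      fix g assume g: "g \<in> proper_colorings ?G' S"
      have gne: "g u \<noteq> g v" if "u \<in> ?P \<union> ?W" "v \<in> ?P \<union> ?W" "fst u \<noteq> fst v" for u v
      proof -
        have "{u, v} \<in> edges ?G'" using that by (auto simp: edges_complete_multipartite)
        then show ?thesis using g unfolding proper_colorings_def by blast
      qed
      have gS: "g v \<in> S" if "v \<in> ?P \<union> ?W" for v
        using g that unfolding proper_colorings_def V' by (blast dest: PiE_mem)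
      have "restrict g ?P \<in> ?P \<rightarrow>\<^sub>E S" using gS by auto
      moreover have "restrict g ?W \<in> ?W \<rightarrow>\<^sub>E S - restrict g ?P ` ?P"
      proof (rule restrict_PiE_iff[THEN iffD2], rule ballI)
        fix v assume v: "v \<in> ?W"
        have "g v \<noteq> restrict g ?P u" if "u \<in> ?P" for u
        proof -
          have "g v \<noteq> g u" by (rule gne) (use that v I(2) in auto)
          then show ?thesis using that by simp
        qed
        then show "g v \<in> S - restrict g ?P ` ?P" using gS[of v] v by auto
      qed
      moreover have "\<forall>u v. {u, v} \<in> edges ?G \<longrightarrow> restrict g ?W u \<noteq> restrict g ?W v"
        using gne by (auto simp: edges_complete_multipartite)
      ultimately show "restrict g ?P \<in> ?P \<rightarrow>\<^sub>E S \<and>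
          restrict g ?W \<in> proper_colorings ?G (S - restrict g ?P ` ?P)"
        by (simp only: proper_colorings_def verts_complete_multipartite mem_Collect_eq simp_thms)
    qed
    show "(\<lambda>(f, h). \<lambda>v. if v \<in> ?P then f v else h v) ` ?T \<subseteq> proper_colorings ?G' S"
    proof (intro image_subsetI, clarsimp simp del: mem_Sigma_iff)
      fix f h assume f: "f \<in> ?P \<rightarrow>\<^sub>E S" and h: "h \<in> proper_colorings ?G (S - f ` ?P)"
      let ?g = "\<lambda>v. if v \<in> ?P then f v else h v"
      have hW: "h \<in> ?W \<rightarrow>\<^sub>E S - f ` ?P"
        using h by (simp add: proper_colorings_def verts_complete_multipartite)
      have hv: "h v \<in> S" "h v \<notin> f ` ?P" if "v \<in> ?W" for v
        using PiE_mem[OF hW that] by auto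
      have ne: "a \<noteq> b" if "a \<in> f ` ?P" "b \<notin> f ` ?P" for a b
        using that by blast
      have "?g \<in> (?P \<union> ?W) \<rightarrow>\<^sub>E S"
        using f hW by (auto simp: PiE_def extensional_def Pi_def simp del: mem_Sigma_iff)
      moreover have "?g u \<noteq> ?g v" if e: "{u, v} \<in> edges ?G'" for u v
      proof -
        have uv: "u \<in> ?P \<union> ?W" "v \<in> ?P \<union> ?W" "fst u \<noteq> fst v"
          using e V' by (auto simp: edges_complete_multipartite)
        have nPP: "\<not> (u \<in> ?P \<and> v \<in> ?P)" using uv(3) by auto
        consider "u \<in> ?P" "v \<in> ?W" "v \<notin> ?P" | "v \<in> ?P" "u \<in> ?W" "u \<notin> ?P" 
          | "u \<in> ?W" "v \<in> ?W" "u \<notin> ?P" "v \<notin> ?P"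
          using uv(1,2) disj nPP by blast
        then show ?thesis
        proof cases
          case 1
          have "f u \<in> f ` ?P" using 1(1) by (rule imageI)
          then have "f u \<noteq> h v" using hv(2)[OF 1(2)] by (rule ne)
          then show ?thesis using 1(1,3) by (simp only: if_True if_False simp_thms)
        next
          case 2
          have "f v \<in> f ` ?P" using 2(1) by (rule imageI)
          then have "f v \<noteq> h u" using hv(2)[OF 2(2)] by (rule ne)
          then show ?thesis using 2(1,3) by (simp only: if_True if_False simp_thms) metis
        next
          case 3
          then have "{u, v} \<in> edges ?G" using uv by (simp add: edges_complete_multipartite)
          then have "h u \<noteq> h v" using h unfolding proper_colorings_def by blast
          then show ?thesis using 3 by simp
        qed
      qed
      ultimately show "?g \<in> proper_colorings ?G' S"
        unfolding proper_colorings_def V' by blast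
    qed
  qed
  then have "card (proper_colorings ?G' S) = card ?T" by (rule bij_betw_same_card)
  also have "\<dots> = (\<Sum>f\<in>?P \<rightarrow>\<^sub>E S. card (proper_colorings ?G (S - f ` ?P)))"
    using fW \<open>finite S\<close>
    by (intro card_SigmaI finite_PiE ballI finite_proper_colorings)
      (auto simp: verts_complete_multipartite)
  finally show ?thesis .
qed

text \<open>At \<open>q = -s\<close> the falling factorial of length \<open>b\<close> becomes (-1)^b
  times \<open>pochhammer s b\<close>, and the remaining graph, having lost \<open>b\<close>
  colours, is evaluated at -(s + b). The signs (-1)^b cancel, and (-1)^(p i) is absorbed by the
  number of new vertices.\<close>

lemma H_insert_part:
  assumes I: "finite I" "i \<notin> I"
  shows "H s (complete_multipartite (insert i I) p) =
    (\<Sum>b\<le>p i. coeff (touchard (p i)) b * pochhammer s b * H (s + real b) (complete_multipartite I p))"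
proof -
  let ?P = "{i} \<times> {..<p i}" and ?t = "coeff (touchard (p i))"
  let ?G = "complete_multipartite I p" and ?G' = "complete_multipartite (insert i I) p"
  have G: "simple_graph ?G" "simple_graph ?G'"
    using I by (auto intro: simple_graph_complete_multipartite)
  have P: "finite ?P" "card ?P = p i" by (auto simp: card_cartesian_product)
  define Q where "Q = (\<Sum>b\<le>p i. smult ((-1) ^ p i * (-1) ^ b * ?t b)
    ((\<Prod>k<b. [:- real k, 1:]) * pcompose (chromatic_poly ?G) [:- real b, 1:]))"
  have "chromatic_poly ?G' = Q"
  proof (rule chromatic_poly_unique)
    fix q :: nat
    have "poly (chromatic_poly ?G') (real q) = real (card (proper_colorings ?G' {..<q}))"
      by (rule poly_chromatic_poly[OF G(2)])
    also have "\<dots> = (\<Sum>f\<in>?P \<rightarrow>\<^sub>E {..<q}. poly (chromatic_poly ?G) (real q - real (card (f ` ?P))))"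
      unfolding card_proper_colorings_insert_part[OF I finite_lessThan] of_nat_sum
    proof (intro sum.cong refl)
      fix f assume "f \<in> ?P \<rightarrow>\<^sub>E {..<q}"
      then have sub: "f ` ?P \<subseteq> {..<q}" by auto
      have fin: "finite (f ` ?P)" by simp
      have "real (card ({..<q} - f ` ?P)) = real q - real (card (f ` ?P))"
        using card_Diff_subset[OF fin sub] card_mono[OF _ sub] by (simp add: of_nat_diff)
      then show "real (card (proper_colorings ?G ({..<q} - f ` ?P))) =
          poly (chromatic_poly ?G) (real q - real (card (f ` ?P)))"
        using card_proper_colorings_eq_poly[OF G(1), of "{..<q} - f ` ?P"] by simp
    qed
    also have "\<dots> = (-1) ^ p i * (\<Sum>b\<le>p i. (-1) ^ b * ?t b * (\<Prod>k<b. real q - real k) *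
        poly (chromatic_poly ?G) (real q - real b))"
      using sum_card_image_touchard[OF P(1) finite_lessThan,
          where h = "\<lambda>c. poly (chromatic_poly ?G) (real q - real c)"] P(2)
      by simp
    also have "\<dots> = poly Q (real q)"
      by (simp add: Q_def poly_sum poly_prod poly_pcompose sum_distrib_left mult_ac)
    finally show "poly (chromatic_poly ?G') (real q) = poly Q (real q)" .
  qed
  moreover have "(\<Prod>k<b. - s - real k) = (-1) ^ b * pochhammer s b" for b
    by (induction b) (auto simp: pochhammer_Suc algebra_simps)
  moreover have "poly Q (- s) = (\<Sum>b\<le>p i. (-1) ^ p i * (-1) ^ b * ?t b *
      ((\<Prod>k<b. - s - real k) * poly (chromatic_poly ?G) (- (s + real b))))"
    by (simp add: Q_def poly_sum poly_prod poly_pcompose algebra_simps)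
  ultimately have "poly (chromatic_poly ?G') (- s) = (\<Sum>b\<le>p i. (-1) ^ p i * ((-1) ^ b * ((-1) ^ b *
      (?t b * pochhammer s b * poly (chromatic_poly ?G) (- (s + real b))))))"
    by (simp only: mult_ac)
  also have "\<dots> = (-1) ^ p i * (\<Sum>b\<le>p i.
      ?t b * pochhammer s b * poly (chromatic_poly ?G) (- (s + real b)))"
    by (simp add: sum_distrib_left mult.assoc[symmetric] flip: power_mult_distrib)
  finally have *: "poly (chromatic_poly ?G') (- s) = (-1) ^ p i * (\<Sum>b\<le>p i.
      ?t b * pochhammer s b * poly (chromatic_poly ?G) (- (s + real b)))" .
  have "card (verts ?G') = p i + card (verts ?G)"
    using I by (simp add: verts_complete_multipartite card_SigmaI)
  then show ?thesis
    by (simp add: H_def * power_add sum_distrib_left mult_ac flip: power_mult_distrib)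
qed

text \<open>The weights of \<open>H_insert_part\<close> are ratios of Gamma values, so a term with
  shift \<open>b\<close> multiplies the integrand by x^b, and the sum over \<open>b\<close> is the
  Touchard polynomial of the new part. The shift is why \<open>s\<close> stays arbitrary in the
  induction.\<close>

theorem has_integral_H:
  assumes "finite I" "s > 0"
  shows "((\<lambda>x. x powr (s - 1) * exp (- x) * (\<Prod>i\<in>I. poly (touchard (p i)) x)) has_integral
    Gamma s * H s (complete_multipartite I p)) {0..}"
  using assms
proof (induction I arbitrary: s rule: finite_induct)
  case empty
  have "proper_colorings (complete_multipartite ({} :: 'a set) p) {..<q} = {\<lambda>_. undefined}" for q :: nat
    by (auto simp: proper_colorings_def complete_multipartite_def)
  then have "chromatic_poly (complete_multipartite ({} :: 'a set) p) = 1"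
    using poly_chromatic_poly[OF simple_graph_complete_multipartite[of "{} :: 'a set" p]]
    by (intro chromatic_poly_unique) simp
  then have "H s (complete_multipartite ({} :: 'a set) p) = 1"
    by (simp add: H_def verts_complete_multipartite)
  then show ?case using Gamma_integral_real[OF \<open>s > 0\<close>] by (simp add: exp_minus field_simps)
next
  case (insert i I)
  let ?t = "coeff (touchard (p i))"
  let ?f = "\<lambda>s x. x powr (s - 1) * exp (- x) * (\<Prod>i\<in>I. poly (touchard (p i)) x)"
  have "((\<lambda>x. \<Sum>b\<le>p i. ?t b * ?f (s + real b) x) has_integral
      (\<Sum>b\<le>p i. ?t b * (Gamma (s + real b) * H (s + real b) (complete_multipartite I p)))) {0..}"
    by (intro has_integral_sum has_integral_mult_right insert.IH) (use insert.prems in auto)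
  also have "(\<Sum>b\<le>p i. ?t b * (Gamma (s + real b) * H (s + real b) (complete_multipartite I p))) =
      Gamma s * H s (complete_multipartite (insert i I) p)"
    unfolding H_insert_part[OF insert.hyps(1,2)] sum_distrib_left
  proof (intro sum.cong refl)
    fix b
    have "Gamma (s + real b) = pochhammer s b * Gamma s"
    proof -
      have "s \<notin> \<int>\<^sub>\<le>\<^sub>0" using insert.prems by (auto elim!: nonpos_Ints_cases)
      then show ?thesis using pochhammer_Gamma[of s b] Gamma_real_pos[OF insert.prems] by simp
    qed
    then show "?t b * (Gamma (s + real b) * H (s + real b) (complete_multipartite I p)) =
        Gamma s * (?t b * pochhammer s b * H (s + real b) (complete_multipartite I p))"
      by simp
  qed
  finally show ?case
  proof (rule has_integral_eq[rotated])
    fix x :: real assume "x \<in> {0..}"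
    \<comment> \<open>At \<open>x = 0\<close> both sides vanish, since \<open>0 powr y = 0\<close>
      for every exponent.\<close>
    then have "x powr (s + real b - 1) = x powr (s - 1) * x ^ b" for b
      using powr_add[of x "s - 1" "real b"] by (cases "x = 0") (auto simp: powr_realpow algebra_simps)
    then show "(\<Sum>b\<le>p i. ?t b * ?f (s + real b) x) =
        x powr (s - 1) * exp (- x) * (\<Prod>i\<in>insert i I. poly (touchard (p i)) x)"
      using insert.hyps by (simp add: poly_touchard sum_distrib_left sum_distrib_right mult_ac)
  qed
qed

section \<open>Roots of the Touchard polynomials\<close>

definition troots :: "nat \<Rightarrow> real set" where
  "troots n = {x. poly (touchard n) x = 0}"

lemma touchard_nonzero: "touchard n \<noteq> 0"
  using lead_coeff_touchard[of n] by auto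

lemma finite_troots [simp]: "finite (troots n)"
  unfolding troots_def by (rule poly_roots_finite[OF touchard_nonzero])

lemma poly_touchard_Suc:
  "poly (touchard (Suc n)) x = x * (poly (touchard n) x - poly (pderiv (touchard n)) x)"
  by simp

text \<open>Conditional on the root count, because the induction establishing that count already
  needs the factorisation for the previous index.\<close>

lemma poly_touchard_prod_aux:
  assumes "card (troots n) = n"
  shows "poly (touchard n) x = (\<Prod>z\<in>troots n. x - z)"
proof -
  let ?p = "\<Prod>z\<in>troots n. [:- z, 1:]"
  have deg: "degree ?p = n" using assms by (subst degree_prod_sum_eq) auto
  have "touchard n = ?p"
  proof (rule poly_eqI_degree_lead_coeff[where A = "troots n" and n = n])
    show "coeff (touchard n) n = coeff ?p n"
      using deg lead_coeff_prod[of "\<lambda>z. [:- z, 1:]" "troots n"] by (simp add: lead_coeff_touchard)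
    show "poly (touchard n) z = poly ?p z" if "z \<in> troots n" for z
    proof -
      have "(\<Prod>y\<in>troots n. z - y) = 0" using that by (intro prod_zero) auto
      then show ?thesis using that by (simp add: poly_prod troots_def)
    qed
  qed (use assms deg in \<open>simp_all add: degree_touchard\<close>)
  then show ?thesis by (simp add: poly_prod)
qed

lemma tendsto_poly_times_exp_minus: "((\<lambda>x. exp (- x) * poly p x) \<longlongrightarrow> (0 :: real)) at_top"
proof -
  have "((\<lambda>x. \<Sum>i\<le>degree p. coeff p i * (x ^ i / exp x)) \<longlongrightarrow> (\<Sum>i\<le>degree p. coeff p i * 0)) at_top"
    by (intro tendsto_intros tendsto_power_div_exp_0)
  then show ?thesis
    by (simp add: poly_altdef exp_minus sum_distrib_left field_simps sum_divide_distrib)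
qed

text \<open>The derivative of exp(-x) p is -exp(-x) (p - p'). Equal values, not only zeros, are
  allowed at the endpoints: beyond the largest root there is no second zero to use.\<close>

lemma exp_times_poly_Rolle:
  fixes a b :: real
  assumes "a < b" "exp (- a) * poly p a = exp (- b) * poly p b"
  shows "\<exists>w. a < w \<and> w < b \<and> poly (p - pderiv p) w = 0"
proof -
  let ?g = "\<lambda>x. exp (- x) * poly p x"
  have D: "(?g has_real_derivative exp (- x) * (poly (pderiv p) x - poly p x)) (at x)" for x
    by (auto intro!: derivative_eq_intros poly_DERIV simp: algebra_simps)
  have "\<exists>w. a < w \<and> w < b \<and> (?g has_real_derivative 0) (at w)"
    using assms D by (intro Rolle) (auto intro!: continuous_intros simp: real_differentiable_def)
  then obtain w where "a < w" "w < b" "(?g has_real_derivative 0) (at w)" by blast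
  with DERIV_unique[OF D this(3)] show ?thesis by auto
qed

text \<open>Each root of the previous polynomial is followed, before the next root, by a zero of p -
  p'; this also holds after the largest root because exp(-x) p tends to 0. These \<open>n\<close>
  zeros are positive, and the factor x adds the root 0.\<close>

lemma card_troots: "card (troots n) = n"
  and troots_nonneg: "z \<in> troots n \<Longrightarrow> 0 \<le> z"
proof (induction n arbitrary: z)
  case 0
  {
    case 1 then show ?case by (simp add: troots_def)
  next
    case 2 then show ?case by (simp add: troots_def)
  }
next
  case (Suc n)
  let ?T = "poly (touchard n)" and ?q = "touchard n - pderiv (touchard n)"
  note prod = poly_touchard_prod_aux[OF Suc(1)]
  have ex: "\<exists>w>z. poly ?q w = 0 \<and> (\<forall>y\<in>troots n. z < y \<longrightarrow> w < y)" if z: "z \<in> troots n" for z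
  proof (cases "\<exists>y\<in>troots n. z < y")
    case True
    let ?Y = "{y \<in> troots n. z < y}"
    define y where "y = Min ?Y"
    have Y: "finite ?Y" "?Y \<noteq> {}" using True by auto
    then have y: "y \<in> ?Y" unfolding y_def by (rule Min_in)
    have "\<exists>w. z < w \<and> w < y \<and> poly ?q w = 0"
      by (rule exp_times_poly_Rolle) (use y z in \<open>auto simp: troots_def\<close>)
    moreover have "y \<le> y'" if "y' \<in> troots n" "z < y'" for y'
      unfolding y_def using Y that by (intro Min_le) auto
    ultimately show ?thesis by fastforce
  next
    case False
    have pos: "?T x > 0" if "x > z" for x
      unfolding prod using False that by (intro prod_pos) force
    let ?g = "\<lambda>x. exp (- x) * ?T x"
    \<comment> \<open>Beyond the largest root, exp(-x) p starts at 0, is positive and decays to 0;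
      so it takes the value \<open>v / 2\<close> on both sides of \<open>z + 1\<close>, and Rolle
      applies between these two points.\<close>
    define v where "v = ?g (z + 1)"
    have v: "v > 0" using pos[of "z + 1"] by (simp add: v_def)
    have "\<forall>\<^sub>F x in at_top. ?g x < v / 2"
      using tendsto_poly_times_exp_minus[of "touchard n"] v by (intro order_tendstoD(2)) auto
    moreover have "\<forall>\<^sub>F x in at_top. x > z + 1" by (rule eventually_gt_at_top)
    ultimately have "\<forall>\<^sub>F x in at_top. ?g x < v / 2 \<and> x > z + 1" by (rule eventually_conj)
    then obtain b where b: "?g b < v / 2" "b > z + 1"
      using eventually_happens'[OF trivial_limit_at_top_linorder] by blast
    have cont: "continuous_on A ?g" for A by (intro continuous_intros)
    have gz: "?g z = 0" using z by (simp add: troots_def)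
    have gv: "?g (z + 1) = v" by (simp only: v_def)
    have "\<exists>x\<ge>z. x \<le> z + 1 \<and> ?g x = v / 2"
      by (rule IVT') (use gz v gv cont in simp_all)
    then obtain x0 where x0: "z \<le> x0" "x0 \<le> z + 1" "?g x0 = v / 2" by blast
    have "\<exists>x\<ge>z + 1. x \<le> b \<and> ?g x = v / 2"
      by (rule IVT2') (use b v gv cont in simp_all)
    then obtain x1 where x1: "z + 1 \<le> x1" "x1 \<le> b" "?g x1 = v / 2" by blast
    have "x0 \<noteq> z + 1" using x0(3) v by (auto simp: v_def)
    then have "\<exists>w. x0 < w \<and> w < x1 \<and> poly ?q w = 0"
      by (intro exp_times_poly_Rolle) (use x0 x1 in auto)
    then show ?thesis using False x0 by (meson le_less_trans)
  qed
  then obtain w where w: "\<And>z. z \<in> troots n \<Longrightarrow> z < w z"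
    "\<And>z. z \<in> troots n \<Longrightarrow> poly ?q (w z) = 0"
    "\<And>z y. z \<in> troots n \<Longrightarrow> y \<in> troots n \<Longrightarrow> z < y \<Longrightarrow> w z < y"
    by metis
  have "inj_on w (troots n)"
  proof (rule inj_onI)
    fix x y assume *: "x \<in> troots n" "y \<in> troots n" "w x = w y"
    then show "x = y" using w(1)[of x] w(1)[of y] w(3)[of x y] w(3)[of y x] by linarith
  qed
  then have card: "card (w ` troots n) = n" using Suc(1) by (simp add: card_image)
  have wpos: "0 < x" if "x \<in> w ` troots n" for x using that w(1) Suc(2) by force
  have sub: "insert 0 (w ` troots n) \<subseteq> troots (Suc n)"
    using w(2) by (auto simp: troots_def)
  have "card (insert 0 (w ` troots n)) = Suc n" using card wpos by (subst card_insert_disjoint) auto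
  moreover have "card (troots (Suc n)) \<le> Suc n"
    unfolding troots_def using card_poly_roots_bound[OF touchard_nonzero, of "Suc n"]
    by (simp only: degree_touchard)
  ultimately have eq: "insert 0 (w ` troots n) = troots (Suc n)"
    using sub card_mono[OF finite_troots sub] by (intro card_subset_eq finite_troots) auto
  {
    case 1
    show ?case using \<open>card (insert _ _) = Suc n\<close> eq by simp
  next
    case 2
    then have "z = 0 \<or> z \<in> w ` troots n" using eq by blast
    then show ?case by (elim disjE) (simp, rule less_imp_le, rule wpos)
  }
qed

lemma poly_touchard_prod: "poly (touchard n) x = (\<Prod>z\<in>troots n. x - z)"
  by (rule poly_touchard_prod_aux[OF card_troots])

definition tlog_deriv :: "nat \<Rightarrow> real \<Rightarrow> real" where
  "tlog_deriv n x = (\<Sum>z\<in>troots n. 1 / (x - z))"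

lemma poly_pderiv_touchard:
  assumes "\<And>z. z \<in> troots n \<Longrightarrow> z < x"
  shows "poly (pderiv (touchard n)) x = poly (touchard n) x * tlog_deriv n x"
proof -
  have "((\<lambda>x. \<Prod>z\<in>troots n. x - z) has_real_derivative
      (\<Prod>z\<in>troots n. x - z) * (\<Sum>z\<in>troots n. 1 / (x - z))) (at x)"
    using assms by (intro has_field_derivative_prod') (force intro!: derivative_eq_intros)+
  then have "(poly (touchard n) has_real_derivative poly (touchard n) x * tlog_deriv n x) (at x)"
    by (simp add: poly_touchard_prod[abs_def] tlog_deriv_def)
  then show ?thesis using DERIV_unique poly_DERIV by blast
qed

lemma touchard_pos:
  assumes "\<And>z. z \<in> troots n \<Longrightarrow> z < x"
  shows "poly (touchard n) x > 0"
  unfolding poly_touchard_prod using assms by (intro prod_pos) simp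

lemma sum_inverse_shift_le:
  assumes "x > 2 * real n"
  shows "(\<Sum>k<n. 1 / (x - 2 * real k)) \<le> real n / (x - 2 * real n)"
proof -
  have "(\<Sum>k<n. 1 / (x - 2 * real k)) \<le> (\<Sum>k<n. 1 / (x - 2 * real n))"
    using assms by (intro sum_mono divide_left_mono) (auto intro!: mult_pos_pos)
  then show ?thesis by simp
qed

text \<open>The barrier argument of Marcus, Spielman and Srivastava: replacing a real-rooted polynomial
  \<open>p\<close> by \<open>p - p'\<close> is compensated by shifting the argument of \<open>p' / p\<close> by \<open>2\<close>, as long as
  \<open>p' / p \<le> 1/2\<close>.\<close>

lemma touchard_barrier:
  "(\<forall>z\<in>troots n. z < 4 * real n \<or> n = 0) \<and>
   (\<forall>x\<ge>4 * real n. x > 0 \<longrightarrow> tlog_deriv n x \<le> (\<Sum>k<n. 1 / (x - 2 * real k)))"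
proof (induction n)
  case 0
  then show ?case by (simp add: troots_def tlog_deriv_def)
next
  case (Suc n)
  let ?T = "poly (touchard n)" and ?T1 = "poly (touchard (Suc n))" and ?L = "tlog_deriv n"
  have lt: "z < x" if "x > 4 * real n" "z \<in> troots n" for x z
    using Suc.IH that by (auto simp: troots_def)
  have L: "?L x \<le> (\<Sum>k<n. 1 / (x - 2 * real k))" if "x > 4 * real n" for x
    using Suc.IH that by (cases "n = 0") auto
  \<comment> \<open>The threshold 4n comes from here: n/(x - 2n) is at most 1/2 once x >=
    4n.\<close>
  have half: "?L x \<le> 1 / 2" if "x > 4 * real n" for x
  proof -
    have "?L x \<le> real n / (x - 2 * real n)"
      using L[OF that] sum_inverse_shift_le[of n x] that by linarith
    also have "\<dots> \<le> 1 / 2" using that by (simp add: divide_simps)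
    finally show ?thesis .
  qed
  have T1: "?T1 x = x * ?T x * (1 - ?L x)" if "x > 4 * real n" for x
    using poly_pderiv_touchard[OF lt[OF that]]
    by (simp add: poly_touchard_Suc algebra_simps del: touchard.simps)
  have pos1: "?T1 x > 0" if "x > 4 * real n" for x
  proof -
    have "?T x > 0" using lt[OF that] by (intro touchard_pos)
    then show ?thesis using T1[OF that] half[OF that] that
      by (simp del: touchard.simps)
  qed
  have lt1: "z < x" if "x > 4 * real n" "z \<in> troots (Suc n)" for x z
    using pos1[of z] that by (force simp: troots_def simp del: touchard.simps)
  have "tlog_deriv (Suc n) x \<le> (\<Sum>k<Suc n. 1 / (x - 2 * real k))" if x: "x \<ge> 4 * real (Suc n)" for x
  proof -
    have x1: "x > 4 * real n" "x - 2 > 4 * real n" "x > 0" using x by auto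
    define D where "D = (\<Sum>z\<in>troots n. 1 / (x - z)\<^sup>2)"
    have DL: "(?L has_real_derivative - D) (at x)"
      unfolding tlog_deriv_def[abs_def] D_def sum_negf[symmetric]
      using lt[OF x1(1)]
      by (intro DERIV_sum) (force intro!: derivative_eq_intros simp: power2_eq_square divide_simps)
    have DT: "(?T has_real_derivative ?T x * ?L x) (at x)"
      using poly_DERIV[of "touchard n" x] poly_pderiv_touchard[OF lt[OF x1(1)]] by simp
    have "((\<lambda>y. y * ?T y * (1 - ?L y)) has_real_derivative
        (?T x * (1 - ?L x) + x * ?T x * ?L x * (1 - ?L x) + x * ?T x * D)) (at x)"
      by (rule DERIV_cong[OF DERIV_mult[OF DERIV_mult[OF DERIV_ident DT]
            DERIV_diff[OF DERIV_const[of 1] DL]]]) (simp add: algebra_simps)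
    then have "(?T1 has_real_derivative
        (?T x * (1 - ?L x) + x * ?T x * ?L x * (1 - ?L x) + x * ?T x * D)) (at x)"
      by (rule has_field_derivative_transform_within_open[of _ _ _ "{4 * real n<..}"])
        (use x1 T1 in auto)
    then have "poly (pderiv (touchard (Suc n))) x =
        ?T x * (1 - ?L x) + x * ?T x * ?L x * (1 - ?L x) + x * ?T x * D"
      using DERIV_unique poly_DERIV by blast
    moreover have "poly (pderiv (touchard (Suc n))) x = ?T1 x * tlog_deriv (Suc n) x"
      using lt1[OF x1(1)] by (rule poly_pderiv_touchard)
    ultimately have eq: "x * ?T x * (1 - ?L x) * tlog_deriv (Suc n) x =
        ?T x * (1 - ?L x) + x * ?T x * ?L x * (1 - ?L x) + x * ?T x * D"
      using T1[OF x1(1)] by metis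
    have Tpos: "?T x > 0" using lt[OF x1(1)] by (intro touchard_pos)
    have Lpos: "1 - ?L x \<ge> 1 / 2" using half[OF x1(1)] by simp
    \<comment> \<open>Logarithmic derivative of the product x T (1 - L), where \<open>- D\<close> is
      the derivative of L; the positive factor x T (1 - L) is cancelled from
      \<open>eq\<close>.\<close>
    have "tlog_deriv (Suc n) x = 1 / x + ?L x + D / (1 - ?L x)"
    proof -
      have "x * ?T x * (1 - ?L x) * (1 / x + ?L x + D / (1 - ?L x)) =
        ?T x * (1 - ?L x) + x * ?T x * ?L x * (1 - ?L x) + x * ?T x * D"
        using x1 Lpos by (simp add: field_simps)
      then have "x * ?T x * (1 - ?L x) * tlog_deriv (Suc n) x =
        x * ?T x * (1 - ?L x) * (1 / x + ?L x + D / (1 - ?L x))" using eq by simp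
      then show ?thesis using x1 Tpos Lpos by simp
    qed
    also have "D / (1 - ?L x) \<le> 2 * D"
    proof -
      have "D \<ge> 0" unfolding D_def by (intro sum_nonneg) auto
      then have "D * 1 \<le> D * (2 * (1 - ?L x))" using Lpos by (intro mult_left_mono) auto
      then show ?thesis using Lpos by (simp add: divide_simps mult_ac)
    qed
    \<comment> \<open>The factor 2, which came from L <= 1/2, is paid for by moving the argument by
      2: root by root, 2/(x - z)^2 is at most the increase of 1/(x - z).\<close>
    also have "2 * D \<le> ?L (x - 2) - ?L x"
    proof -
      have "2 * (1 / (x - z)\<^sup>2) \<le> 1 / (x - 2 - z) - 1 / (x - z)" if "z \<in> troots n" for z
      proof -
        have z: "x - 2 - z > 0" using lt[OF x1(2) that] by simp
        have "2 * (1 / (x - z)\<^sup>2) = 2 / ((x - z) * (x - z))" by (simp add: power2_eq_square)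
        also have "\<dots> \<le> 2 / ((x - 2 - z) * (x - z))"
          using z by (intro divide_left_mono mult_right_mono) auto
        also have "\<dots> = 1 / (x - 2 - z) - 1 / (x - z)" using z by (simp add: divide_simps)
        finally show ?thesis .
      qed
      then show ?thesis
        unfolding D_def tlog_deriv_def sum_distrib_left sum_subtractf[symmetric] by (rule sum_mono)
    qed
    finally have "tlog_deriv (Suc n) x \<le> 1 / x + ?L (x - 2)" by simp
    also have "?L (x - 2) \<le> (\<Sum>k<n. 1 / (x - 2 - 2 * real k))" using L[OF x1(2)] .
    \<comment> \<open>The shifted bound supplies the terms k = 1, ..., n of the new sum, and 1/x is
      its term k = 0.\<close>
    also have "1 / x + (\<Sum>k<n. 1 / (x - 2 - 2 * real k)) = (\<Sum>k<Suc n. 1 / (x - 2 * real k))"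
      by (subst sum.lessThan_Suc_shift) (simp add: algebra_simps)
    finally show ?thesis by simp
  qed
  then show ?case using lt1[of "4 * real (Suc n)"] by (auto simp del: sum.lessThan_Suc)
qed

section \<open>Bounds that follow from the location of the roots\<close>

lemma troots_less: "z \<in> troots n \<Longrightarrow> z < 4 * real n"
  using touchard_barrier[of n] by (cases "n = 0") (auto simp: troots_def)

lemma poly_touchard_pos: "x \<ge> 4 * real n \<Longrightarrow> poly (touchard n) x > 0"
  by (intro touchard_pos) (force dest: troots_less)

lemma poly_touchard_le: "x \<ge> 4 * real n \<Longrightarrow> poly (touchard n) x \<le> x ^ n"
proof -
  assume x: "x \<ge> 4 * real n"
  have "(\<Prod>z\<in>troots n. x - z) \<le> (\<Prod>z\<in>troots n. x)"
    using x by (intro prod_mono) (force dest: troots_less troots_nonneg)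
  then show ?thesis by (simp add: poly_touchard_prod card_troots)
qed

lemma poly_touchard_ge: "x \<ge> 4 * real n \<Longrightarrow> (x - 4 * real n) ^ n \<le> poly (touchard n) x"
proof -
  assume x: "x \<ge> 4 * real n"
  have "(\<Prod>z\<in>troots n. x - 4 * real n) \<le> (\<Prod>z\<in>troots n. x - z)"
    using x by (intro prod_mono) (force dest: troots_less)
  then show ?thesis by (simp add: poly_touchard_prod card_troots)
qed

lemma abs_poly_touchard_le:
  assumes "0 \<le> x" "x \<le> c" "4 * real n \<le> c"
  shows "\<bar>poly (touchard n) x\<bar> \<le> c ^ n"
proof -
  have "\<bar>x - z\<bar> \<le> c" if "z \<in> troots n" for z
    using troots_less[OF that] troots_nonneg[OF that] assms by linarith
  then have "(\<Prod>z\<in>troots n. \<bar>x - z\<bar>) \<le> (\<Prod>z\<in>troots n. c)"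
    by (intro prod_mono) auto
  then show ?thesis by (simp add: poly_touchard_prod card_troots abs_prod)
qed

text \<open>Each of the \<open>n\<close> nonnegative roots contributes x/(x - z) >= 1 to x
  p'/p.\<close>

lemma pderiv_touchard_ge:
  assumes x: "x \<ge> 4 * real n"
  shows "real n * poly (touchard n) x \<le> x * poly (pderiv (touchard n)) x"
proof (cases "n = 0")
  case False
  have lt: "\<And>z. z \<in> troots n \<Longrightarrow> z < x" using x by (force dest: troots_less)
  have "(\<Sum>z\<in>troots n. 1) \<le> (\<Sum>z\<in>troots n. x * (1 / (x - z)))"
    by (intro sum_mono) (use lt troots_nonneg in \<open>auto simp: divide_simps\<close>)
  then have "real n \<le> x * tlog_deriv n x" by (simp add: tlog_deriv_def card_troots sum_distrib_left)
  then have "real n * poly (touchard n) x \<le> x * tlog_deriv n x * poly (touchard n) x"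
    using poly_touchard_pos[OF x] by (intro mult_right_mono) auto
  then show ?thesis using poly_pderiv_touchard[OF lt] by (simp add: mult_ac)
qed simp

text \<open>The barrier bound n/(x - 2n) exceeds n/x only at second order: (n x + 4 n^2)(x - 2n) - n
  x^2 equals 2 n^2 (x - 4n). Bounding each root by 4n alone would give a worse denominator, x - 4n,
  which degenerates at the left endpoint.\<close>

lemma pderiv_touchard_le:
  assumes x: "x \<ge> 4 * real n"
  shows "x\<^sup>2 * poly (pderiv (touchard n)) x \<le> (real n * x + 4 * (real n)\<^sup>2) * poly (touchard n) x"
proof (cases "n = 0")
  case False
  then have n: "real n > 0" by simp
  then have x0: "x > 0" using x by linarith
  have lt: "\<And>z. z \<in> troots n \<Longrightarrow> z < x" using x by (force dest: troots_less)
  have "tlog_deriv n x \<le> real n / (x - 2 * real n)"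
    using touchard_barrier[of n, THEN conjunct2, rule_format, OF x x0] sum_inverse_shift_le[of n x] x n
    by linarith
  then have "x\<^sup>2 * tlog_deriv n x \<le> x\<^sup>2 * (real n / (x - 2 * real n))"
    by (intro mult_left_mono) auto
  also have "\<dots> \<le> real n * x + 4 * (real n)\<^sup>2"
  proof -
    have "0 \<le> 2 * (real n)\<^sup>2 * (x - 4 * real n)" using x n by (intro mult_nonneg_nonneg) auto
    then have "x\<^sup>2 * real n \<le> (real n * x + 4 * (real n)\<^sup>2) * (x - 2 * real n)"
      by (simp add: algebra_simps power2_eq_square power3_eq_cube)
    then show ?thesis using x n by (simp add: pos_divide_le_eq)
  qed
  finally have "x\<^sup>2 * tlog_deriv n x * poly (touchard n) x \<le>
      (real n * x + 4 * (real n)\<^sup>2) * poly (touchard n) x"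
    using poly_touchard_pos[OF x] by (intro mult_right_mono) auto
  then show ?thesis using poly_pderiv_touchard[OF lt] by (simp add: mult_ac)
qed simp

section \<open>Parts of equal size\<close>

text \<open>The fundamental theorem is applied on the intervals \<open>{c..c + real k}\<close>, and
  the majorant \<open>h\<close> permits dominated convergence as \<open>k\<close> grows.\<close>

lemma has_integral_FTC_at_top:
  fixes F g h :: "real \<Rightarrow> real"
  assumes F: "\<And>x. x \<ge> c \<Longrightarrow> (F has_real_derivative g x) (at x)"
    and h: "h integrable_on {c..}" and le: "\<And>x. x \<ge> c \<Longrightarrow> \<bar>g x\<bar> \<le> h x"
    and lim: "(F \<longlongrightarrow> 0) at_top"
  shows "(g has_integral - F c) {c..}"
proof -
  let ?f = "\<lambda>k x. if x \<in> {c..c + real k} then g x else 0"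
  have f: "(?f k has_integral F (c + real k) - F c) {c..}" for k
  proof -
    have "(g has_integral F (c + real k) - F c) {c..c + real k}"
    proof (rule fundamental_theorem_of_calculus)
      show "(F has_vector_derivative g x) (at x within {c..c + real k})" if "x \<in> {c..c + real k}" for x
        using F[of x] that by (auto simp: has_real_derivative_iff_has_vector_derivative
            intro: has_vector_derivative_at_within)
    qed simp
    moreover have "{c..c + real k} \<subseteq> {c..}" by auto
    ultimately show ?thesis by (simp only: has_integral_restrict)
  qed
  have int: "?f k integrable_on {c..}" for k using f by blast
  have bound: "norm (?f k x) \<le> h x" if "x \<in> {c..}" for k x
    using le[of x] that order_trans[OF abs_ge_zero le[of x]] by auto
  have conv: "(\<lambda>k. ?f k x) \<longlonglongrightarrow> g x" if "x \<in> {c..}" for x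
  proof (rule tendsto_eventually, rule eventually_sequentiallyI[of "nat \<lceil>x - c\<rceil>"])
    fix k assume "nat \<lceil>x - c\<rceil> \<le> k"
    then have "x - c \<le> real k" by linarith
    then show "?f k x = g x" using that by simp
  qed
  note g = dominated_convergence[OF int h bound conv]
  have "(\<lambda>k. F (c + real k)) \<longlonglongrightarrow> 0"
    by (rule filterlim_compose[OF lim]) real_asymp
  then have "(\<lambda>k. F (c + real k) - F c) \<longlonglongrightarrow> 0 - F c" by (intro tendsto_intros)
  moreover have "integral {c..} (?f k) = F (c + real k) - F c" for k
    using f by (rule integral_unique)
  ultimately have "integral {c..} g = - F c" using g(2) LIMSEQ_unique by fastforce
  then show ?thesis using g(1) by (metis integrable_integral)
qed

section \<open>Truncated moments and their recurrence\<close>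

definition tkernel :: "nat \<Rightarrow> nat \<Rightarrow> real \<Rightarrow> real \<Rightarrow> real" where
  "tkernel m n a x = (x / real (m * n)) powr a * exp (- x) * poly (touchard m) x ^ n"

definition tmoment :: "nat \<Rightarrow> nat \<Rightarrow> real \<Rightarrow> real" where
  "tmoment m n a = integral {4 * real m..} (tkernel m n a)"

lemma tkernel_nonneg: "x \<ge> 4 * real m \<Longrightarrow> tkernel m n a x \<ge> 0"
  using poly_touchard_pos[of m x] by (simp add: tkernel_def)

lemma tkernel_le:
  assumes "m \<ge> 1" "n \<ge> 1" "x \<ge> 4 * real m"
  shows "tkernel m n a x \<le> (1 / real (m * n)) powr a * (x powr (real (m * n) + a) / exp x)"
proof -
  have x: "x > 0" using assms by linarith
  have "poly (touchard m) x ^ n \<le> (x ^ m) ^ n"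
    using poly_touchard_le[of m x] poly_touchard_pos[of m x] assms by (intro power_mono) auto
  also have "\<dots> = x powr real (m * n)" using x by (simp add: powr_realpow flip: power_mult of_nat_mult)
  finally have "tkernel m n a x \<le> (x / real (m * n)) powr a * exp (- x) * x powr real (m * n)"
    unfolding tkernel_def by (intro mult_left_mono) auto
  also have "(x / real (m * n)) powr a = (1 / real (m * n)) powr a * x powr a"
    using x by (simp add: powr_divide)
  finally show ?thesis by (simp add: powr_add exp_minus field_simps)
qed

lemma tkernel_integrable:
  assumes "m \<ge> 1" "n \<ge> 1" "real (m * n) + a > - 1"
  shows "tkernel m n a integrable_on {4 * real m..}"
proof (rule measurable_bounded_by_integrable_imp_integrable)
  let ?g = "\<lambda>x. (1 / real (m * n)) powr a * (x powr (real (m * n) + a) / exp x)"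
  have "((\<lambda>x. (1 / real (m * n)) powr a * (x powr ((real (m * n) + a + 1) - 1) / exp x)) has_integral
      (1 / real (m * n)) powr a * Gamma (real (m * n) + a + 1)) {0..}"
    using assms(3) by (intro has_integral_mult_right Gamma_integral_real) simp
  then have "?g integrable_on {0..}" by (auto simp: integrable_on_def)
  then have "?g absolutely_integrable_on {0..}"
    by (rule nonnegative_absolutely_integrable_1) simp
  then have "?g absolutely_integrable_on {4 * real m..}"
    by (rule set_integrable_subset) auto
  then show "?g integrable_on {4 * real m..}" by (simp add: absolutely_integrable_on_def)
  show "norm (tkernel m n a x) \<le> ?g x" if "x \<in> {4 * real m..}" for x
    using tkernel_le[of m n x a] tkernel_nonneg[of m x n a] assms that by simp
  have "continuous_on {4 * real m..} (tkernel m n a)"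
    unfolding tkernel_def using assms by (auto intro!: continuous_intros)
  then show "tkernel m n a \<in> borel_measurable (lebesgue_on {4 * real m..})"
    by (rule continuous_imp_measurable_on_sets_lebesgue) auto
qed auto

lemma tkernel_tendsto_0:
  assumes "m \<ge> 1" "n \<ge> 1"
  shows "(tkernel m n a \<longlongrightarrow> 0) at_top"
proof (rule real_tendsto_sandwich)
  define c where "c = real (m * n) + a"
  show "\<forall>\<^sub>F x in at_top. 0 \<le> tkernel m n a x"
    using eventually_ge_at_top[of "4 * real m"] by eventually_elim (rule tkernel_nonneg)
  show "\<forall>\<^sub>F x in at_top. tkernel m n a x \<le> (1 / real (m * n)) powr a * (x powr c / exp x)"
    using eventually_ge_at_top[of "4 * real m"] unfolding c_def
    by eventually_elim (use assms in \<open>rule tkernel_le\<close>)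
  have "((\<lambda>x::real. x powr c / exp x) \<longlongrightarrow> 0) at_top" by real_asymp
  from tendsto_mult_left[OF this, of "(1 / real (m * n)) powr a"]
  show "((\<lambda>x. (1 / real (m * n)) powr a * (x powr c / exp x)) \<longlongrightarrow> 0) at_top" by simp
qed simp

definition tkernel_deriv :: "nat \<Rightarrow> nat \<Rightarrow> real \<Rightarrow> real \<Rightarrow> real" where
  "tkernel_deriv m n a x = a / real (m * n) * tkernel m n (a - 1) x - tkernel m n a x
    + (x / real (m * n)) powr a * exp (- x) *
      (real n * poly (touchard m) x ^ (n - 1) * poly (pderiv (touchard m)) x)"

lemma DERIV_tkernel:
  assumes "m \<ge> 1" "n \<ge> 1" "x > 0"
  shows "(tkernel m n a has_real_derivative tkernel_deriv m n a x) (at x)"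
proof -
  let ?N = "real (m * n)"
  have N: "?N > 0" using assms by (simp del: of_nat_mult)
  have "((\<lambda>x. (x / ?N) powr a) has_real_derivative a * (x / ?N) powr (a - 1) * (1 / ?N)) (at x)"
    using assms N by (auto intro!: derivative_eq_intros simp: powr_diff field_simps)
  moreover have "((\<lambda>x. exp (- x)) has_real_derivative - exp (- x)) (at x)"
    by (auto intro!: derivative_eq_intros)
  moreover have "((\<lambda>x. poly (touchard m) x ^ n) has_real_derivative
      real n * poly (touchard m) x ^ (n - 1) * poly (pderiv (touchard m)) x) (at x)"
    using DERIV_power[OF poly_DERIV[of "touchard m" x], of n] by (simp add: mult_ac)
  ultimately have "((\<lambda>x. (x / ?N) powr a * exp (- x) * poly (touchard m) x ^ n) has_real_derivative
      ((a * (x / ?N) powr (a - 1) * (1 / ?N)) * exp (- x) + - exp (- x) * (x / ?N) powr a) * poly (touchard m) x ^ n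
      + (real n * poly (touchard m) x ^ (n - 1) * poly (pderiv (touchard m)) x) * ((x / ?N) powr a * exp (- x))) (at x)"
    by (intro DERIV_mult)
  then show ?thesis
    unfolding tkernel_def[abs_def] tkernel_deriv_def by (rule DERIV_cong) (simp add: tkernel_def algebra_simps)
qed

text \<open>With t = x/(mn), the two estimates for the derivative of the Touchard polynomial T say
  that n T' lies between T/t and T/t + (4/n) T/t^2. Dividing by t lowers the exponent by one, so the
  bounds are again kernels, with constants free of m.\<close>

lemma tkernel_deriv_bounds:
  assumes "m \<ge> 1" "n \<ge> 1" and x: "x \<ge> 4 * real m"
  shows "(1 + a / real (m * n)) * tkernel m n (a - 1) x - tkernel m n a x \<le> tkernel_deriv m n a x"
    "tkernel_deriv m n a x \<le> (1 + a / real (m * n)) * tkernel m n (a - 1) x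
      + 4 / real n * tkernel m n (a - 2) x - tkernel m n a x"
proof -
  let ?T = "poly (touchard m) x" and ?T' = "poly (pderiv (touchard m)) x" and ?N = "real (m * n)"
  define t where "t = x / ?N"
  have x0: "x > 0" using assms by linarith
  have N: "?N > 0" using assms by (simp del: of_nat_mult)
  have nm: "real n > 0" "real m > 0" using assms by auto
  have t: "t > 0" using x0 N by (simp add: t_def)
  have T: "?T > 0" using x by (rule poly_touchard_pos)
  have Tn: "?T ^ n = ?T * ?T ^ (n - 1)" using assms(2) by (cases n) auto
  have p1: "t powr (a - 1) = t powr a / t" "t powr (a - 2) = t powr a / t\<^sup>2"
    using t by (simp_all add: powr_diff)
  let ?c = "t powr a * exp (- x) * ?T ^ (n - 1)"
  have c: "?c \<ge> 0" using T by simp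
  have k: "tkernel m n (a - 1) x = ?c * (?T / t)" "tkernel m n (a - 2) x = ?c * (?T / t\<^sup>2)"
    unfolding tkernel_def t_def[symmetric] p1 Tn by simp_all
  have d: "tkernel_deriv m n a x = a / ?N * tkernel m n (a - 1) x - tkernel m n a x + ?c * (real n * ?T')"
    unfolding tkernel_deriv_def t_def[symmetric] by (simp add: mult_ac)
  have "real m * ?T \<le> x * ?T'" using x by (rule pderiv_touchard_ge)
  then have "?T / t \<le> real n * ?T'"
    using x0 nm by (simp add: t_def field_simps)
  from mult_left_mono[OF this c]
  have "tkernel m n (a - 1) x \<le> ?c * (real n * ?T')" unfolding k .
  then show "(1 + a / ?N) * tkernel m n (a - 1) x - tkernel m n a x \<le> tkernel_deriv m n a x"
    unfolding d distrib_right by linarith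
  have "x\<^sup>2 * ?T' \<le> (real m * x + 4 * (real m)\<^sup>2) * ?T" using x by (rule pderiv_touchard_le)
  then have "real n * ?T' \<le> real n * ((real m * x + 4 * (real m)\<^sup>2) * ?T / x\<^sup>2)"
    using x0 by (intro mult_left_mono) (auto simp: pos_le_divide_eq mult.commute)
  also have "\<dots> = ?T / t + 4 / real n * (?T / t\<^sup>2)"
    using x0 nm by (simp add: t_def field_simps power2_eq_square)
  finally have "real n * ?T' \<le> ?T / t + 4 / real n * (?T / t\<^sup>2)" .
  from mult_left_mono[OF this c]
  have "?c * (real n * ?T') \<le> tkernel m n (a - 1) x + 4 / real n * tkernel m n (a - 2) x"
    unfolding k by (simp only: distrib_left mult_ac)
  then show "tkernel_deriv m n a x \<le> (1 + a / ?N) * tkernel m n (a - 1) x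
      + 4 / real n * tkernel m n (a - 2) x - tkernel m n a x"
    unfolding d distrib_right by linarith
qed

text \<open>The derivative of the kernel integrates to minus its value at 4m, as the kernel vanishes
  at infinity; the first inequality drops this nonnegative boundary value. The hypothesis on
  \<open>a\<close> makes the kernels of orders a, a - 1 and a - 2 integrable.\<close>

lemma tmoment_recurrence:
  assumes mn: "m \<ge> 1" "n \<ge> 1" and a: "real (m * n) > \<bar>a\<bar> + 1"
  shows "(1 + a / real (m * n)) * tmoment m n (a - 1) \<le> tmoment m n a"
    "tmoment m n a \<le> (1 + a / real (m * n)) * tmoment m n (a - 1) + 4 / real n * tmoment m n (a - 2)
      + tkernel m n a (4 * real m)"
proof -
  let ?S = "{4 * real m..}" and ?N = "real (m * n)"
  let ?k = "tkernel m n"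
  have int: "?k a integrable_on ?S" "?k (a - 1) integrable_on ?S" "?k (a - 2) integrable_on ?S"
    using mn a by (auto intro!: tkernel_integrable simp del: of_nat_mult)
  note hi = int[THEN integrable_integral, folded tmoment_def]
  let ?h = "\<lambda>x. \<bar>1 + a / ?N\<bar> * ?k (a - 1) x + 4 / real n * ?k (a - 2) x + ?k a x"
  have D: "(tkernel_deriv m n a has_integral - ?k a (4 * real m)) ?S"
  proof (rule has_integral_FTC_at_top[where h = ?h])
    show "?h integrable_on ?S" by (intro integrable_add integrable_on_mult_right int)
    show "(?k a \<longlongrightarrow> 0) at_top" using mn by (rule tkernel_tendsto_0)
    fix x assume x: "x \<ge> 4 * real m"
    show "(?k a has_real_derivative tkernel_deriv m n a x) (at x)"
      using mn x by (intro DERIV_tkernel) auto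
    have k0: "?k (a - 1) x \<ge> 0" "?k (a - 2) x \<ge> 0" "?k a x \<ge> 0" using x by (auto intro: tkernel_nonneg)
    have "(1 + a / ?N) * ?k (a - 1) x \<le> \<bar>1 + a / ?N\<bar> * ?k (a - 1) x"
      "- (\<bar>1 + a / ?N\<bar> * ?k (a - 1) x) \<le> (1 + a / ?N) * ?k (a - 1) x"
      using abs_ge_self[of "(1 + a / ?N) * ?k (a - 1) x"] abs_ge_minus_self[of "(1 + a / ?N) * ?k (a - 1) x"] k0
      by (simp_all only: abs_mult abs_of_nonneg)
    moreover have "0 \<le> 4 / real n * ?k (a - 2) x" using k0 by simp
    ultimately show "\<bar>tkernel_deriv m n a x\<bar> \<le> ?h x"
      using tkernel_deriv_bounds[OF mn x, of a] k0 by (intro abs_leI) linarith+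
  qed
  have "(1 + a / ?N) * tmoment m n (a - 1) - tmoment m n a \<le> - ?k a (4 * real m)"
    by (rule has_integral_le[OF has_integral_diff[OF has_integral_mult_right[OF hi(2)] hi(1)] D])
      (use tkernel_deriv_bounds(1)[OF mn] in simp)
  moreover have "?k a (4 * real m) \<ge> 0" by (intro tkernel_nonneg) simp
  ultimately show "(1 + a / ?N) * tmoment m n (a - 1) \<le> tmoment m n a" by linarith
  have "- ?k a (4 * real m) \<le> (1 + a / ?N) * tmoment m n (a - 1) + 4 / real n * tmoment m n (a - 2) - tmoment m n a"
    by (rule has_integral_le[OF D has_integral_diff[OF has_integral_add[OF
          has_integral_mult_right[OF hi(2)] has_integral_mult_right[OF hi(3)]] hi(1)]])
      (use tkernel_deriv_bounds(2)[OF mn] in simp)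
  then show "tmoment m n a \<le> (1 + a / ?N) * tmoment m n (a - 1) + 4 / real n * tmoment m n (a - 2)
      + ?k a (4 * real m)" by linarith
qed

text \<open>A lower bound for the integrand on \<open>[mn, mn + 1]\<close>, hence for the moments; it dominates the
  contribution of the range below \<open>4m\<close>.\<close>

definition tscale :: "nat \<Rightarrow> nat \<Rightarrow> real" where
  "tscale m n = exp (- (real (m * n) + 1)) * (real m * (real n - 4)) ^ (m * n)"

lemma tmoment_lower:
  assumes mn: "m \<ge> 1" "n \<ge> 4" and a: "real (m * n) + a > - 1"
  shows "2 powr (- \<bar>a\<bar>) * tscale m n \<le> tmoment m n a"
proof -
  let ?N = "real (m * n)" and ?S = "{4 * real m..}"
  have "4 * m \<le> m * n" "1 \<le> m * n" using mn mult_le_mono2[of 4 n m] by (auto simp: mult.commute)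
  then have "real (4 * m) \<le> ?N" "real 1 \<le> ?N" by (simp_all only: of_nat_le_iff)
  then have N: "?N \<ge> 4 * real m" "?N \<ge> 1" by simp_all
  have sub: "{?N..?N + 1} \<subseteq> ?S" using N by auto
  have int: "tkernel m n a integrable_on ?S" using mn a by (intro tkernel_integrable) auto
  have low: "2 powr (- \<bar>a\<bar>) * tscale m n \<le> tkernel m n a x" if x: "x \<in> {?N..?N + 1}" for x
  proof -
    define t where "t = x / ?N"
    \<comment> \<open>Hence t^a is at least 2^(-|a|) for either sign of \<open>a\<close>, which is
      the constant in the statement.\<close>
    have t: "1 \<le> t" "t \<le> 2" using x N by (auto simp: t_def field_simps)
    have 1: "2 powr (- \<bar>a\<bar>) \<le> t powr a"
    proof (cases "a \<ge> 0")
      case True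
      then have "2 powr (- \<bar>a\<bar>) \<le> 2 powr (0::real)" by (intro powr_mono) auto
      also have "\<dots> \<le> t powr a" using t True by (simp add: ge_one_powr_ge_zero)
      finally show ?thesis .
    next
      case False
      then show ?thesis using t powr_mono2'[of a t 2] by auto
    qed
    have "real m * (real n - 4) = ?N - 4 * real m" by (simp add: algebra_simps)
    also have "\<dots> \<le> x - 4 * real m" using x by simp
    finally have "(real m * (real n - 4)) ^ m \<le> (x - 4 * real m) ^ m" using mn by (intro power_mono) auto
    also have "\<dots> \<le> poly (touchard m) x" using x N by (intro poly_touchard_ge) auto
    finally have "((real m * (real n - 4)) ^ m) ^ n \<le> poly (touchard m) x ^ n"
      using mn by (intro power_mono) auto
    then have 2: "(real m * (real n - 4)) ^ (m * n) \<le> poly (touchard m) x ^ n" by (simp add: power_mult)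
    have 3: "exp (- (?N + 1)) \<le> exp (- x)" using x by simp
    have "2 powr (- \<bar>a\<bar>) * (exp (- (?N + 1)) * (real m * (real n - 4)) ^ (m * n)) \<le>
        t powr a * (exp (- x) * poly (touchard m) x ^ n)"
      using mn by (intro mult_mono 1 2 3) auto
    then show ?thesis by (simp add: tscale_def tkernel_def t_def mult.assoc del: of_nat_mult)
  qed
  have "2 powr (- \<bar>a\<bar>) * tscale m n = integral {?N..?N + 1} (\<lambda>x. 2 powr (- \<bar>a\<bar>) * tscale m n)" by simp
  also have "\<dots> \<le> integral {?N..?N + 1} (tkernel m n a)"
    using low integrable_on_subinterval[OF int sub] by (intro integral_le) auto
  also have "\<dots> \<le> tmoment m n a" unfolding tmoment_def
    using integrable_on_subinterval[OF int sub] int sub tkernel_nonneg by (intro integral_subset_le) auto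
  finally show ?thesis .
qed

text \<open>For n >= 40 the base in \<open>tscale\<close> is at least 36m, and e <= 3 leaves 12m per
  factor. Against it stand 4m and a factor 2 spent on m <= 2^(mn); the quotient (2/3)^(mn) beats
  every power of n, uniformly in m.\<close>

lemma small_le_tscale:
  "\<exists>K\<ge>0. \<forall>n\<ge>40. \<forall>m\<ge>1. real n powr c * real m * (4 * real m) ^ (m * n) \<le> K / real n * tscale m n"
proof -
  have "(\<lambda>n. real n powr (c + 1) * (2 / 3) ^ n) \<longlonglongrightarrow> 0" by real_asymp
  then have "Bseq (\<lambda>n. real n powr (c + 1) * (2 / 3) ^ n)" by (intro convergent_imp_Bseq convergentI)
  then obtain B where B: "B > 0" "\<And>n. \<bar>real n powr (c + 1) * (2 / 3) ^ n\<bar> \<le> B"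
    unfolding Bseq_def by auto
  have "real n powr c * real m * (4 * real m) ^ (m * n) \<le> 3 * B / real n * tscale m n"
    if mn: "n \<ge> 40" "m \<ge> 1" for m n
  proof -
    let ?N = "m * n"
    have n: "real n > 0" "n \<le> ?N" "m \<le> ?N" using mn by auto
    have e3: "exp (1::real) \<le> 3" by (rule exp_le)
    have "(1 / 3) ^ Suc ?N \<le> exp (-1 :: real) ^ Suc ?N"
      using e3 by (intro power_mono) (auto simp: exp_minus field_simps)
    also have "\<dots> = exp (- (real ?N + 1))" by (simp only: exp_of_nat_mult[symmetric]) simp
    finally have e: "(1 / 3) ^ Suc ?N \<le> exp (- (real ?N + 1))" .
    have "(36 * real m) ^ ?N \<le> (real m * (real n - 4)) ^ ?N"
      using mn by (intro power_mono) (auto simp: mult.commute[of 36] intro!: mult_left_mono)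
    then have s: "(1 / 3) ^ Suc ?N * (36 * real m) ^ ?N \<le> tscale m n"
      unfolding tscale_def using e by (intro mult_mono) auto
    have "real m \<le> 2 ^ m" using less_exp[of m] by (metis less_imp_le of_nat_le_iff of_nat_numeral of_nat_power)
    also have "\<dots> \<le> 2 ^ ?N" using n by (intro power_increasing) auto
    finally have "real n powr c * real m * (4 * real m) ^ ?N \<le> real n powr c * 2 ^ ?N * (4 * real m) ^ ?N"
      by (intro mult_right_mono mult_left_mono) auto
    also have "\<dots> = 3 * (real n powr c * (2 / 3) ^ ?N) * ((1 / 3) ^ Suc ?N * (36 * real m) ^ ?N)"
    proof -
      have "(2::real) ^ ?N * 4 ^ ?N = (2 / 3) ^ ?N * ((1 / 3) ^ ?N * 36 ^ ?N)"
        by (simp flip: power_mult_distrib)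
      then show ?thesis by (simp add: power_mult_distrib mult_ac)
    qed
    also have "\<dots> \<le> 3 * (real n powr c * (2 / 3) ^ n) * tscale m n"
    proof (intro mult_mono s mult_left_mono)
      show "(2 / 3 :: real) ^ ?N \<le> (2 / 3) ^ n" using n by (intro power_decreasing) auto
    qed auto
    also have "\<dots> \<le> 3 * (B / real n) * tscale m n"
    proof (intro mult_right_mono mult_left_mono)
      show "real n powr c * (2 / 3) ^ n \<le> B / real n"
        using B(2)[of n] n by (simp add: powr_add field_simps)
      show "0 \<le> tscale m n" using mn by (simp add: tscale_def)
    qed simp
    finally show ?thesis by simp
  qed
  then show ?thesis using B(1) by (intro exI[of _ "3 * B"]) auto
qed

lemma tmoment_nonneg: "tmoment m n a \<ge> 0"
proof (cases "tkernel m n a integrable_on {4 * real m..}")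
  case True
  then show ?thesis
    unfolding tmoment_def by (rule integral_nonneg) (auto intro: tkernel_nonneg)
\<comment> \<open>Without integrability the integral is 0 by convention.\<close>
qed (simp add: tmoment_def not_integrable_integral)

text \<open>The constant has three sources in \<open>tmoment_recurrence\<close>: |a| bounds the term
  a/(mn), 8 is 4/n times the moment of order a - 2 (at most twice that of order a - 1), and
  \<open>b\<close> covers the boundary value, which is compared with \<open>tscale\<close>.\<close>

lemma tmoment_ratio:
  "\<exists>K\<ge>0. \<exists>n0\<ge>40. \<forall>n\<ge>n0. \<forall>m\<ge>1.
    \<bar>tmoment m n a - tmoment m n (a - 1)\<bar> \<le> K / real n * tmoment m n (a - 1)"
proof -
  obtain B where B: "B \<ge> 0" "\<And>n m. n \<ge> 40 \<Longrightarrow> m \<ge> 1 \<Longrightarrow>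
      real n powr (- a) * real m * (4 * real m) ^ (m * n) \<le> B / real n * tscale m n"
    using small_le_tscale[of "- a"] by blast
  define b where "b = 4 powr a * B * 2 powr \<bar>a - 1\<bar>"
  have b0: "b \<ge> 0" using B by (simp add: b_def)
  \<comment> \<open>Such n make 1 + (a - 1)/(mn) at least 1/2 and meet the size conditions of the
    recurrence and of \<open>small_le_tscale\<close>.\<close>
  define n0 where "n0 = max 40 (nat \<lceil>2 * \<bar>a\<bar> + 8\<rceil>)"
  have "\<bar>tmoment m n a - tmoment m n (a - 1)\<bar> \<le> (\<bar>a\<bar> + 8 + b) / real n * tmoment m n (a - 1)"
    if mn: "n \<ge> n0" "m \<ge> 1" for m n
  proof -
    let ?N = "real (m * n)" and ?E = "tmoment m n"
    have n40: "n \<ge> 40" using mn by (simp add: n0_def)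
    have "nat \<lceil>2 * \<bar>a\<bar> + 8\<rceil> \<le> n" using mn by (simp only: n0_def max.bounded_iff)
    then have na: "real n \<ge> 2 * \<bar>a\<bar> + 8" by linarith
    have "n \<le> m * n" using mn by simp
    then have N: "?N \<ge> real n" by (simp only: of_nat_le_iff)
    have N0: "?N > 0" "real n > 0" using N n40 by linarith+
    have E0: "?E (a - 1) \<ge> 0" "?E (a - 2) \<ge> 0" by (rule tmoment_nonneg)+
    have rec: "(1 + a / ?N) * ?E (a - 1) \<le> ?E a"
      "?E a \<le> (1 + a / ?N) * ?E (a - 1) + 4 / real n * ?E (a - 2) + tkernel m n a (4 * real m)"
      by (rule tmoment_recurrence; use mn n40 na N in linarith)+
    have aN: "\<bar>a / ?N\<bar> \<le> \<bar>a\<bar> / real n"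
      using N N0 by (simp add: abs_divide divide_left_mono del: of_nat_mult)
    have aE: "\<bar>a / ?N * ?E (a - 1)\<bar> \<le> \<bar>a\<bar> / real n * ?E (a - 1)"
      using mult_right_mono[OF aN E0(1)] by (simp only: abs_mult abs_of_nonneg[OF E0(1)])
    \<comment> \<open>The recurrence one order lower, whose leading factor is at least 1/2.\<close>
    have E2: "?E (a - 2) \<le> 2 * ?E (a - 1)"
    proof -
      have r: "(1 + (a - 1) / ?N) * ?E (a - 1 - 1) \<le> ?E (a - 1)"
        by (rule tmoment_recurrence; use mn n40 na N in linarith)
      have "- (1 / 2) \<le> (a - 1) / ?N"
      proof -
        have "- (1 / 2) * ?N \<le> a - 1" using na N by linarith
        then show ?thesis using N0 by (simp only: pos_le_divide_eq)
      qed
      then have "1 / 2 * ?E (a - 2) \<le> (1 + (a - 1) / ?N) * ?E (a - 2)"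
        using E0 by (intro mult_right_mono) linarith+
      moreover have "(1 + (a - 1) / ?N) * ?E (a - 2) \<le> ?E (a - 1)" using r by (simp del: of_nat_mult)
      ultimately show ?thesis by linarith
    qed
    have bd: "tkernel m n a (4 * real m) \<le> b / real n * ?E (a - 1)"
    proof -
      have m0: "real m > 0" using mn by simp
      have "poly (touchard m) (4 * real m) ^ n \<le> ((4 * real m) ^ m) ^ n"
        using poly_touchard_le[of m "4 * real m"] poly_touchard_pos[of m "4 * real m"]
        by (intro power_mono) auto
      then have T: "poly (touchard m) (4 * real m) ^ n \<le> (4 * real m) ^ (m * n)" by (simp add: power_mult)
      have q: "(4 * real m / ?N) powr a = 4 powr a * real n powr (- a)"
        using m0 N0 by (simp add: powr_divide powr_minus field_simps)
      have "tkernel m n a (4 * real m) \<le> (4 * real m / ?N) powr a * 1 * (4 * real m) ^ (m * n)"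
        unfolding tkernel_def using T poly_touchard_pos[of m "4 * real m"]
        by (intro mult_mono) auto
      also have "\<dots> = 4 powr a * (real n powr (- a) * 1 * (4 * real m) ^ (m * n))" unfolding q by simp
      also have "\<dots> \<le> 4 powr a * (real n powr (- a) * real m * (4 * real m) ^ (m * n))"
        using mn by (intro mult_left_mono mult_right_mono) auto
      also have "\<dots> \<le> 4 powr a * (B / real n * tscale m n)"
        using B(2)[OF n40 mn(2)] by (intro mult_left_mono) auto
      also have "\<dots> \<le> 4 powr a * (B / real n * (2 powr \<bar>a - 1\<bar> * ?E (a - 1)))"
      proof (intro mult_left_mono)
        have "2 powr (- \<bar>a - 1\<bar>) * tscale m n \<le> ?E (a - 1)"
          by (rule tmoment_lower; use mn n40 na N in linarith)
        then show "tscale m n \<le> 2 powr \<bar>a - 1\<bar> * ?E (a - 1)" by (simp add: powr_minus field_simps)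
      qed (use B(1) in auto)
      finally show ?thesis by (simp add: b_def mult_ac)
    qed
    have "4 / real n * ?E (a - 2) \<le> 4 / real n * (2 * ?E (a - 1))" using E2 by (intro mult_left_mono) auto
    moreover have "(\<bar>a\<bar> + 8 + b) / real n * ?E (a - 1) =
        \<bar>a\<bar> / real n * ?E (a - 1) + 4 / real n * (2 * ?E (a - 1)) + b / real n * ?E (a - 1)"
      by (simp add: distrib_right add_divide_distrib)
    moreover have dist: "(1 + a / ?N) * ?E (a - 1) = ?E (a - 1) + a / ?N * ?E (a - 1)"
      by (simp only: distrib_right mult_1_left)
    moreover have aE': "a / ?N * ?E (a - 1) \<le> \<bar>a\<bar> / real n * ?E (a - 1)"
      "- (a / ?N * ?E (a - 1)) \<le> \<bar>a\<bar> / real n * ?E (a - 1)"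
      using aE by (simp_all only: abs_le_iff)
    ultimately have "?E a - ?E (a - 1) \<le> (\<bar>a\<bar> + 8 + b) / real n * ?E (a - 1)"
      using rec(2) bd by linarith
    moreover have "- (?E a - ?E (a - 1)) \<le> (\<bar>a\<bar> + 8 + b) / real n * ?E (a - 1)"
    proof -
      have "- (?E a - ?E (a - 1)) \<le> \<bar>a\<bar> / real n * ?E (a - 1)"
        using rec(1) aE' dist by linarith
      also have "\<dots> \<le> (\<bar>a\<bar> + 8 + b) / real n * ?E (a - 1)"
        using E0 b0 by (intro mult_right_mono divide_right_mono) auto
      finally show ?thesis .
    qed
    ultimately show ?thesis by (rule abs_leI)
  qed
  then show ?thesis using b0 by (intro exI[of _ "\<bar>a\<bar> + 8 + b"] conjI exI[of _ n0]) (auto simp: n0_def)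
qed

lemma tmoment_nat:
  "\<exists>K\<ge>0. \<exists>n0\<ge>40. \<forall>n\<ge>n0. \<forall>m\<ge>1.
    \<bar>tmoment m n (real j) - tmoment m n 0\<bar> \<le> K / real n * tmoment m n 0"
proof (induction j)
  case 0
  show ?case by (intro exI[of _ 0] conjI exI[of _ 40]) auto
next
  case (Suc j)
  obtain K n0 where K: "K \<ge> 0" "n0 \<ge> 40" "\<And>n m. n \<ge> n0 \<Longrightarrow> m \<ge> 1 \<Longrightarrow>
      \<bar>tmoment m n (real j) - tmoment m n 0\<bar> \<le> K / real n * tmoment m n 0"
    using Suc by blast
  obtain L n1 where L: "L \<ge> 0" "n1 \<ge> 40" "\<And>n m. n \<ge> n1 \<Longrightarrow> m \<ge> 1 \<Longrightarrow>
      \<bar>tmoment m n (real (Suc j)) - tmoment m n (real j)\<bar> \<le> L / real n * tmoment m n (real j)"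
    using tmoment_ratio[of "real (Suc j)"] by auto
  have "\<bar>tmoment m n (real (Suc j)) - tmoment m n 0\<bar> \<le> (K + L * (1 + K)) / real n * tmoment m n 0"
    if mn: "n \<ge> max n0 n1" "m \<ge> 1" for m n
  proof -
    let ?E = "tmoment m n"
    have n: "real n \<ge> 1" using mn K by auto
    have E0: "?E 0 \<ge> 0" by (rule tmoment_nonneg)
    have 1: "\<bar>?E (real j) - ?E 0\<bar> \<le> K / real n * ?E 0" using K(3) mn by simp
    also have "\<dots> \<le> K * ?E 0"
      using K(1) n E0 mult_left_mono[of 1 "real n" K] by (intro mult_right_mono) (auto simp: divide_le_eq)
    finally have "?E (real j) \<le> (1 + K) * ?E 0" by (simp add: abs_le_iff distrib_right)
    then have "L / real n * ?E (real j) \<le> L / real n * ((1 + K) * ?E 0)"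
      using L(1) by (intro mult_left_mono) auto
    then have 2: "\<bar>?E (real (Suc j)) - ?E (real j)\<bar> \<le> L / real n * ((1 + K) * ?E 0)"
      using L(3)[of n m] mn by linarith
    have "\<bar>?E (real (Suc j)) - ?E 0\<bar> \<le> L / real n * ((1 + K) * ?E 0) + K / real n * ?E 0"
      using 1 2 by linarith
    also have "\<dots> = (K + L * (1 + K)) / real n * ?E 0" using n by (simp add: field_simps)
    finally show ?thesis .
  qed
  then show ?case using K L by (intro exI[of _ "K + L * (1 + K)"] conjI exI[of _ "max n0 n1"]) auto
qed

lemma powr_interpolation:
  fixes t :: real
  assumes "t > 0" "0 \<le> l" "l \<le> 1"
  shows "t powr ((1 - l) * a + l * b) \<le> (1 - l) * t powr a + l * t powr b"
  using Youngs_inequality_0[of "1 - l" l "t powr a" "t powr b"] assms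
  by (simp add: powr_powr powr_add mult.commute)

lemma tmoment_interpolation:
  assumes mn: "m \<ge> 1" "n \<ge> 1" and l: "0 \<le> l" "l \<le> 1"
    and ab: "real (m * n) + a > - 1" "real (m * n) + b > - 1"
  shows "tmoment m n ((1 - l) * a + l * b) \<le> (1 - l) * tmoment m n a + l * tmoment m n b"
proof -
  let ?S = "{4 * real m..}" and ?c = "(1 - l) * a + l * b"
  have "min a b \<le> ?c"
    using l mult_left_mono[of "min a b" a "1 - l"] mult_left_mono[of "min a b" b l] by (simp add: algebra_simps)
  then have c: "real (m * n) + ?c > - 1" using ab by linarith
  have le: "tkernel m n ?c x \<le> (1 - l) * tkernel m n a x + l * tkernel m n b x" if x: "x \<in> ?S" for x
  proof -
    have x0: "x / real (m * n) > 0" using x mn by (auto intro!: divide_pos_pos)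
    have w: "exp (- x) * poly (touchard m) x ^ n \<ge> 0"
      using poly_touchard_pos[of m x] x by simp
    show ?thesis
      using mult_right_mono[OF powr_interpolation[OF x0 l, of a b] w]
      unfolding tkernel_def by (simp add: algebra_simps)
  qed
  note i = tkernel_integrable[OF mn]
  have "tmoment m n ?c \<le> integral ?S (\<lambda>x. (1 - l) * tkernel m n a x + l * tkernel m n b x)"
    unfolding tmoment_def
    by (intro integral_le integrable_add integrable_on_mult_right i c ab le)
  also have "\<dots> = (1 - l) * tmoment m n a + l * tmoment m n b"
    unfolding tmoment_def using i[OF ab(1)] i[OF ab(2)]
    by (subst integral_add) (auto intro!: integrable_on_mult_right)
  finally show ?thesis .
qed

text \<open>Upper bound: theta lies between -1 and the integer \<open>j\<close>, and the moment of
  order -1 is at most that of order 0. Lower bound: 0 lies between theta and -1, or between theta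
  and 1 if theta is negative, and the interpolation is solved for the moment of order theta.\<close>

lemma tmoment_real:
  assumes th: "\<theta> > - 1"
  shows "\<exists>K\<ge>0. \<exists>n0\<ge>40. \<forall>n\<ge>n0. \<forall>m\<ge>1.
    \<bar>tmoment m n \<theta> - tmoment m n 0\<bar> \<le> K / real n * tmoment m n 0"
proof -
  define j where "j = nat \<lceil>\<bar>\<theta>\<bar>\<rceil> + 1"
  have j: "real j \<ge> \<theta>" "real j \<ge> 1" by (auto simp: j_def) linarith
  obtain K n0 where K: "K \<ge> 0" "n0 \<ge> 40" "\<And>n m. n \<ge> n0 \<Longrightarrow> m \<ge> 1 \<Longrightarrow>
      \<bar>tmoment m n (real j) - tmoment m n 0\<bar> \<le> K / real n * tmoment m n 0"
    using tmoment_nat by blast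
  obtain L n1 where L: "L \<ge> 0" "n1 \<ge> 40" "\<And>n m. n \<ge> n1 \<Longrightarrow> m \<ge> 1 \<Longrightarrow>
      \<bar>tmoment m n 1 - tmoment m n 0\<bar> \<le> L / real n * tmoment m n 0"
    using tmoment_nat[of 1] by auto
  \<comment> \<open>For negative theta, 0 = (1 - l) theta + l gives l = (1 - l) |theta|; dividing by
    1 - l turns the error constant \<open>L\<close> at order 1 into |theta| times
    \<open>L\<close>.\<close>
  define M where "M = \<bar>\<theta>\<bar> * L"
  have M0: "M \<ge> 0" using L by (simp add: M_def)
  have "\<bar>tmoment m n \<theta> - tmoment m n 0\<bar> \<le> (K + M) / real n * tmoment m n 0"
    if mn: "n \<ge> max n0 n1" "m \<ge> 1" for m n
  proof -
    let ?E = "tmoment m n" and ?N = "real (m * n)"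
    have n: "n \<ge> 40" "n \<ge> 1" "real n > 0" using mn K by auto
    have "n \<le> m * n" using mn by simp
    then have N: "?N \<ge> real n" by (simp only: of_nat_le_iff)
    have N40: "?N \<ge> 40" using N n by linarith
    have E0: "?E 0 \<ge> 0" by (rule tmoment_nonneg)
    have Em: "?E (- 1) \<le> ?E 0"
      using tmoment_recurrence(1)[of m n 0] mn n N40 by simp
    have Ej: "?E (real j) \<le> (1 + K / real n) * ?E 0"
      using K(3)[of n m] mn by (simp add: abs_le_iff distrib_right)
    have up: "?E \<theta> \<le> (1 + K / real n) * ?E 0"
    proof -
      define l where "l = (\<theta> + 1) / (real j + 1)"
      have l: "0 \<le> l" "l \<le> 1" using th j by (auto simp: l_def)
      have "l * (real j + 1) = \<theta> + 1" using j by (simp add: l_def)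
      then have "(1 - l) * (- 1) + l * real j = \<theta>" by (simp add: algebra_simps)
      then have "?E \<theta> \<le> (1 - l) * ?E (- 1) + l * ?E (real j)"
        using tmoment_interpolation[of m n l "- 1" "real j"] mn n l N40 by simp
      also have "\<dots> \<le> (1 - l) * ((1 + K / real n) * ?E 0) + l * ((1 + K / real n) * ?E 0)"
      proof (intro add_mono mult_left_mono Ej)
        have "0 \<le> K / real n * ?E 0" using K E0 by simp
        then show "?E (- 1) \<le> (1 + K / real n) * ?E 0" using Em by (simp add: distrib_right)
      qed (use l in auto)
      also have "\<dots> = (1 + K / real n) * ?E 0"
      proof -
        have "(1 - l) * x + l * x = x" for x by (simp add: left_diff_distrib)
        then show ?thesis .
      qed
      finally show ?thesis .
    qed
    have low: "(1 - M / real n) * ?E 0 \<le> ?E \<theta>"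
    proof (cases "\<theta> \<ge> 0")
      case True
      define l where "l = \<theta> / (1 + \<theta>)"
      have l: "0 \<le> l" "l < 1" using True by (auto simp: l_def)
      have "(1 - l) * \<theta> + l * (- 1) = 0" using True by (simp add: l_def field_simps)
      then have "?E 0 \<le> (1 - l) * ?E \<theta> + l * ?E (- 1)"
        using tmoment_interpolation[of m n l \<theta> "- 1"] mn n l N40 True by simp
      also have "l * ?E (- 1) \<le> l * ?E 0" using Em l by (intro mult_left_mono) auto
      finally have "(1 - l) * ?E 0 \<le> (1 - l) * ?E \<theta>" by (simp add: algebra_simps)
      then have "?E 0 \<le> ?E \<theta>" using l by simp
      moreover have "0 \<le> M / real n * ?E 0" using M0 E0 by simp
      ultimately show ?thesis by (simp add: left_diff_distrib)
    next
      case False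
      define l where "l = - \<theta> / (1 - \<theta>)"
      have l: "0 \<le> l" "l < 1" using False th by (auto simp: l_def field_simps)
      have l1: "l = (1 - l) * \<bar>\<theta>\<bar>" using False by (simp add: l_def field_simps)
      have "(1 - l) * \<theta> + l * 1 = 0" using False by (simp add: l_def field_simps)
      then have "?E 0 \<le> (1 - l) * ?E \<theta> + l * ?E 1"
        using tmoment_interpolation[of m n l \<theta> 1] mn n l N40 th by simp
      also have "l * ?E 1 \<le> l * ((1 + L / real n) * ?E 0)"
        using L(3)[of n m] mn l by (intro mult_left_mono) (auto simp: abs_le_iff distrib_right)
      finally have "?E 0 - l * ((1 + L / real n) * ?E 0) \<le> (1 - l) * ?E \<theta>" by simp
      also have "?E 0 - l * ((1 + L / real n) * ?E 0) = (1 - l) * ?E 0 - l * (L / real n * ?E 0)"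
        by (simp add: algebra_simps)
      also have "l * (L / real n * ?E 0) = (1 - l) * (M / real n * ?E 0)"
        by (subst l1) (simp add: M_def)
      also have "(1 - l) * ?E 0 - (1 - l) * (M / real n * ?E 0) = (1 - l) * ((1 - M / real n) * ?E 0)"
        by (simp add: algebra_simps)
      finally show ?thesis using l by simp
    qed
    have "0 \<le> M / real n * ?E 0" "0 \<le> K / real n * ?E 0" using M0 K E0 by auto
    then show ?thesis
      using up low by (intro abs_leI) (simp_all add: distrib_right left_diff_distrib add_divide_distrib)
  qed
  then show ?thesis using K L M0 by (intro exI[of _ "K + M"] conjI exI[of _ "max n0 n1"]) auto
qed


text \<open>Beyond 4m the integrand is the kernel up to the power of mn. Below 4m the argument and
  all roots lie in [0, 4m], so every linear factor is at most 4m in absolute value and x^(s-1)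
  remains to be integrated.\<close>

lemma H_equal_tmoment:
  assumes mn: "m \<ge> 1" "n \<ge> 1" and s: "s > 0"
  shows "\<bar>Gamma s * H s (equal_multipartite m n) - real (m * n) powr (s - 1) * tmoment m n (s - 1)\<bar>
    \<le> (4 * real m) ^ (m * n) * ((4 * real m) powr s / s)"
proof -
  let ?X = "4 * real m" and ?N = "real (m * n)"
  let ?T = "poly (touchard m)"
  let ?f = "\<lambda>x. x powr (s - 1) * exp (- x) * ?T x ^ n"
  let ?k = "\<lambda>x. if x \<in> {?X..} then ?N powr (s - 1) * tkernel m n (s - 1) x else 0"
  let ?g = "\<lambda>x. if x \<in> {0..?X} then ?X ^ (m * n) * x powr (s - 1) else 0"
  have N: "?N > 0" using mn by simp
  have f: "(?f has_integral Gamma s * H s (equal_multipartite m n)) {0..}"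
    using has_integral_H[of "{..<n}" s "\<lambda>_. m"] s by (simp add: equal_multipartite_def)
  have "?N \<ge> 1" using mn by (metis One_nat_def Suc_leI nat_0_less_mult_iff of_nat_1 of_nat_le_iff zero_less_one less_le_trans)
  then have "tkernel m n (s - 1) integrable_on {?X..}" using mn s by (intro tkernel_integrable) linarith+
  then have "((\<lambda>x. ?N powr (s - 1) * tkernel m n (s - 1) x) has_integral ?N powr (s - 1) * tmoment m n (s - 1)) {?X..}"
    unfolding tmoment_def by (intro has_integral_mult_right integrable_integral)
  moreover have "{?X..} \<subseteq> {0..}" by auto
  ultimately have k: "(?k has_integral ?N powr (s - 1) * tmoment m n (s - 1)) {0..}"
    by (simp only: has_integral_restrict)
  have "((\<lambda>x. ?X ^ (m * n) * x powr (s - 1)) has_integral ?X ^ (m * n) * (?X powr (s - 1 + 1) / (s - 1 + 1))) {0..?X}"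
    using s by (intro has_integral_mult_right has_integral_powr_from_0) auto
  moreover have "{0..?X} \<subseteq> {0..}" by auto
  ultimately have g: "(?g has_integral ?X ^ (m * n) * (?X powr (s - 1 + 1) / (s - 1 + 1))) {0..}"
    by (simp only: has_integral_restrict)
  have bound: "norm (?f x - ?k x) \<le> ?g x" if x: "x \<in> {0..}" for x
  proof (cases "x \<ge> ?X")
    case True
    then have "x > 0" using mn by (intro less_le_trans[of 0 ?X x]) auto
    then have "?N powr (s - 1) * (x / ?N) powr (s - 1) = x powr (s - 1)"
      using mn by (simp add: powr_divide)
    then have "?f x - ?k x = 0" using True by (simp add: tkernel_def mult.assoc[symmetric] del: of_nat_mult)
    then show ?thesis using x by simp
  next
    case False
    have "\<bar>?T x\<bar> \<le> ?X ^ m" using x False by (intro abs_poly_touchard_le) auto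
    then have "\<bar>?T x\<bar> ^ n \<le> (?X ^ m) ^ n" by (intro power_mono) auto
    then have "exp (- x) * \<bar>?T x\<bar> ^ n \<le> 1 * ?X ^ (m * n)"
      using x by (intro mult_mono) (auto simp: power_mult)
    then have "x powr (s - 1) * (exp (- x) * \<bar>?T x\<bar> ^ n) \<le> x powr (s - 1) * ?X ^ (m * n)"
      by (intro mult_left_mono) auto
    then show ?thesis using x False by (simp add: abs_mult power_abs mult_ac)
  qed
  have "norm (integral {0..} (\<lambda>x. ?f x - ?k x)) \<le> integral {0..} ?g"
    by (rule integral_norm_bound_integral[OF has_integral_integrable[OF has_integral_diff[OF f k]]
          has_integral_integrable[OF g] bound])
  then show ?thesis
    unfolding integral_unique[OF has_integral_diff[OF f k]] integral_unique[OF g] by simp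
qed

lemma tscale_pos: "n \<ge> 5 \<Longrightarrow> m \<ge> 1 \<Longrightarrow> tscale m n > 0"
  unfolding tscale_def by (intro mult_pos_pos zero_less_power) auto

lemma tmoment_0_ge: "m \<ge> 1 \<Longrightarrow> n \<ge> 4 \<Longrightarrow> tscale m n \<le> tmoment m n 0"
  using tmoment_lower[of m n 0] of_nat_0_le_iff[of "m * n"] by (simp del: of_nat_mult)

text \<open>The reference moment of order 0 does not involve \<open>s\<close>, so it cancels when
  the values at \<open>s\<close> and at 1 are compared.\<close>

lemma H_equal_ratio_tmoment:
  assumes s: "s > 0"
  shows "\<exists>K\<ge>0. \<exists>n0\<ge>40. \<forall>n\<ge>n0. \<forall>m\<ge>1.
    \<bar>Gamma s * H s (equal_multipartite m n) / (real (m * n) powr (s - 1) * tmoment m n 0) - 1\<bar> \<le> K / real n"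
proof -
  obtain K n0 where K: "K \<ge> 0" "n0 \<ge> 40" "\<And>n m. n \<ge> n0 \<Longrightarrow> m \<ge> 1 \<Longrightarrow>
      \<bar>tmoment m n (s - 1) - tmoment m n 0\<bar> \<le> K / real n * tmoment m n 0"
    using tmoment_real[of "s - 1"] s by auto
  obtain B where B: "B \<ge> 0" "\<And>n m. n \<ge> 40 \<Longrightarrow> m \<ge> 1 \<Longrightarrow>
      real n powr (1 - s) * real m * (4 * real m) ^ (m * n) \<le> B / real n * tscale m n"
    using small_le_tscale[of "1 - s"] by blast
  define L where "L = 4 powr s / s * B"
  have L0: "L \<ge> 0" using B s by (simp add: L_def)
  have "\<bar>Gamma s * H s (equal_multipartite m n) / (real (m * n) powr (s - 1) * tmoment m n 0) - 1\<bar> \<le> (K + L) / real n"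
    if mn: "n \<ge> n0" "m \<ge> 1" for m n
  proof -
    let ?P = "real (m * n) powr (s - 1)" and ?E = "tmoment m n"
    let ?h = "Gamma s * H s (equal_multipartite m n)"
    have n: "n \<ge> 40" "real n > 0" using mn K by auto
    have m0: "real m > 0" using mn by simp
    have P0: "?P > 0" using n m0 by simp
    have E0: "?E 0 > 0" using tmoment_0_ge[of m n] tscale_pos[of n m] n mn by auto
    \<comment> \<open>Splits off the normalising power of mn; what is left, n^(1-s) m, has the shape
      of \<open>small_le_tscale\<close> with exponent \<open>1 - s\<close>.\<close>
    have q: "(4 * real m) powr s = ?P * (4 powr s * (real n powr (1 - s) * real m))"
    proof -
      have "real m powr s = real m powr (s - 1) * real m"
        using m0 powr_add[of "real m" "s - 1" 1] by simp
      moreover have "real n powr (s - 1) * real n powr (1 - s) = 1"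
        using n by (simp flip: powr_add)
      ultimately show ?thesis by (simp add: powr_mult mult_ac)
    qed
    have "\<bar>?h - ?P * ?E (s - 1)\<bar> \<le> (4 * real m) ^ (m * n) * ((4 * real m) powr s / s)"
      using mn n s by (intro H_equal_tmoment) auto
    also have "\<dots> = ?P * (4 powr s / s) * (real n powr (1 - s) * real m * (4 * real m) ^ (m * n))"
      unfolding q by simp
    also have "\<dots> \<le> ?P * (4 powr s / s) * (B / real n * tscale m n)"
      using B(2)[OF n(1) mn(2)] s by (intro mult_left_mono) auto
    also have "\<dots> \<le> ?P * (4 powr s / s) * (B / real n * ?E 0)"
      using tmoment_0_ge[of m n] n mn B s by (intro mult_left_mono) auto
    also have "\<dots> = ?P * (L / real n * ?E 0)" by (simp add: L_def)
    finally have 1: "\<bar>?h - ?P * ?E (s - 1)\<bar> \<le> ?P * (L / real n * ?E 0)" .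
    have "?P * ?E (s - 1) - ?P * ?E 0 = ?P * (?E (s - 1) - ?E 0)" by (rule right_diff_distrib[symmetric])
    then have "\<bar>?P * ?E (s - 1) - ?P * ?E 0\<bar> = ?P * \<bar>?E (s - 1) - ?E 0\<bar>" by (simp add: abs_mult)
    also have "\<dots> \<le> ?P * (K / real n * ?E 0)" using K(3)[OF mn] by (intro mult_left_mono) auto
    finally have 2: "\<bar>?P * ?E (s - 1) - ?P * ?E 0\<bar> \<le> ?P * (K / real n * ?E 0)" .
    have "\<bar>p - q\<bar> \<le> \<bar>p - v\<bar> + \<bar>v - q\<bar>" for p q v :: real by linarith
    then have "\<bar>?h - ?P * ?E 0\<bar> \<le> \<bar>?h - ?P * ?E (s - 1)\<bar> + \<bar>?P * ?E (s - 1) - ?P * ?E 0\<bar>" .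
    also have "\<dots> \<le> ?P * (L / real n * ?E 0) + ?P * (K / real n * ?E 0)" using 1 2 by (rule add_mono)
    also have "\<dots> = (K + L) / real n * (?P * ?E 0)" by (simp add: add_divide_distrib algebra_simps)
    finally have 3: "\<bar>?h - ?P * ?E 0\<bar> \<le> (K + L) / real n * (?P * ?E 0)" .
    have PE: "?P * ?E 0 > 0" using P0 E0 by simp
    have "?h / (?P * ?E 0) - 1 = (?h - ?P * ?E 0) / (?P * ?E 0)" using P0 E0 by (simp add: diff_divide_distrib)
    then have "\<bar>?h / (?P * ?E 0) - 1\<bar> = \<bar>?h - ?P * ?E 0\<bar> / (?P * ?E 0)" using PE by (simp add: abs_divide)
    also have "\<dots> \<le> (K + L) / real n" using 3 PE by (simp only: pos_divide_le_eq)
    finally show ?thesis .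
  qed
  then show ?thesis using K L0 by (intro exI[of _ "K + L"] conjI exI[of _ n0]) auto
qed

section \<open>Comparison of general s with s = 1\<close>

lemma abs_ln_le:
  fixes y :: real
  assumes "\<bar>y - 1\<bar> \<le> 1 / 2"
  shows "\<bar>ln y\<bar> \<le> 2 * \<bar>y - 1\<bar>"
proof -
  have "\<bar>ln y - (y - 1)\<bar> \<le> 2 * (y - 1)\<^sup>2"
    using abs_ln_one_plus_x_minus_x_bound[OF assms] by simp
  moreover have "2 * (y - 1)\<^sup>2 \<le> \<bar>y - 1\<bar>"
    using mult_right_mono[OF assms, of "\<bar>y - 1\<bar>"] by (simp add: power2_eq_square abs_mult_self_eq)
  moreover have "\<bar>p\<bar> \<le> 2 * \<bar>q\<bar>" if "\<bar>p - q\<bar> \<le> r" "r \<le> \<bar>q\<bar>" for p q r :: real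
    using that by linarith
  ultimately show ?thesis by blast
qed

text \<open>The exponent error caused by replacing 1 by \<open>s\<close>. Both values of
  \<open>H\<close> are positive, so the exponential of this logarithm recovers the ratio for all
  \<open>m\<close>, \<open>n\<close> from 1 on.\<close>

definition log_ratio :: "real \<Rightarrow> nat \<Rightarrow> nat \<Rightarrow> real" where
  "log_ratio s m n = ln (Gamma s * H s (equal_multipartite m n) /
    (real (m * n) powr (s - 1) * H 1 (equal_multipartite m n)))"

lemma simple_graph_equal_multipartite: "simple_graph (equal_multipartite m n)"
  unfolding equal_multipartite_def by (rule simple_graph_complete_multipartite) simp

lemma H_equal_log_ratio:
  assumes s: "s > 0" and mn: "m \<ge> 1" "n \<ge> 1"
  shows "H s (equal_multipartite m n) =
    real (m * n) powr (s - 1) / Gamma s * H 1 (equal_multipartite m n) * exp (log_ratio s m n)"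
proof -
  have H: "H s (equal_multipartite m n) > 0" "H 1 (equal_multipartite m n) > 0"
    using s by (auto intro: H_pos simple_graph_equal_multipartite)
  have P: "real (m * n) powr (s - 1) > 0" using mn by simp
  show ?thesis
    unfolding log_ratio_def using H P Gamma_real_pos[OF s] by (simp del: of_nat_mult)
qed

lemma log_ratio_bound_large:
  assumes s: "s > 0"
  shows "\<exists>K\<ge>0. \<exists>n0. \<forall>n\<ge>n0. \<forall>m\<ge>1. \<bar>log_ratio s m n\<bar> \<le> K / real n"
proof -
  obtain K n0 where K: "K \<ge> 0" "n0 \<ge> 40" "\<And>n m. n \<ge> n0 \<Longrightarrow> m \<ge> 1 \<Longrightarrow>
    \<bar>Gamma s * H s (equal_multipartite m n) / (real (m * n) powr (s - 1) * tmoment m n 0) - 1\<bar> \<le> K / real n"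
    using H_equal_ratio_tmoment[OF s] by blast
  obtain L n1 where L: "L \<ge> 0" "n1 \<ge> 40" "\<And>n m. n \<ge> n1 \<Longrightarrow> m \<ge> 1 \<Longrightarrow>
    \<bar>Gamma 1 * H 1 (equal_multipartite m n) / (real (m * n) powr (1 - 1) * tmoment m n 0) - 1\<bar> \<le> L / real n"
    using H_equal_ratio_tmoment[of 1] by auto
  \<comment> \<open>Beyond \<open>n2\<close> both normalised values are within 1/2 of 1, where
    \<open>abs_ln_le\<close> applies.\<close>
  define n2 where "n2 = max (max n0 n1) (nat \<lceil>2 * (K + L)\<rceil>)"
  have "\<bar>log_ratio s m n\<bar> \<le> 2 * (K + L) / real n" if mn: "n \<ge> n2" "m \<ge> 1" for m n
  proof -
    let ?P = "real (m * n) powr (s - 1)" and ?E = "tmoment m n 0"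
    define y where "y = Gamma s * H s (equal_multipartite m n) / (?P * ?E)"
    define z where "z = H 1 (equal_multipartite m n) / ?E"
    have n: "n \<ge> n0" "n \<ge> n1" "n \<ge> 40" "real n > 0" using mn K by (auto simp: n2_def)
    have "nat \<lceil>2 * (K + L)\<rceil> \<le> n" using mn by (simp only: n2_def max.bounded_iff)
    then have "2 * (K + L) \<le> real n" by linarith
    then have half: "K / real n \<le> 1 / 2" "L / real n \<le> 1 / 2" using K L n by (auto simp: field_simps)
    have y: "\<bar>y - 1\<bar> \<le> K / real n" using K(3)[OF n(1) mn(2)] by (simp add: y_def)
    have z: "\<bar>z - 1\<bar> \<le> L / real n" using L(3)[OF n(2) mn(2)] n mn by (simp add: z_def)
    have E0: "?E > 0" using tmoment_0_ge[of m n] tscale_pos[of n m] n mn by auto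
    have y0: "y > 0" "z > 0" using y z half by linarith+
    have "log_ratio s m n = ln (y / z)"
      unfolding log_ratio_def y_def z_def using E0 by (simp del: of_nat_mult)
    also have "\<dots> = ln y - ln z" using y0 by (simp add: ln_div)
    also have "\<bar>\<dots>\<bar> \<le> 2 * \<bar>y - 1\<bar> + 2 * \<bar>z - 1\<bar>"
      using abs_ln_le[of y] abs_ln_le[of z] y z half by linarith
    also have "\<dots> \<le> 2 * (K + L) / real n" using y z by (simp add: add_divide_distrib)
    finally show ?thesis .
  qed
  then show ?thesis using K L by (intro exI[of _ "2 * (K + L)"] conjI exI[of _ n2]) auto
qed

text \<open>Under m <= C n^J only finitely many pairs have n below the threshold; the sum of their
  values is absorbed into the constant.\<close>

lemma log_ratio_bound:
  assumes s: "s > 0"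
  shows "\<exists>K. \<forall>n\<ge>1. \<forall>m\<ge>1. real m \<le> C * real n ^ J \<longrightarrow> \<bar>log_ratio s m n\<bar> \<le> K / real n"
proof -
  obtain K n0 where K: "K \<ge> 0" "\<And>n m. n \<ge> n0 \<Longrightarrow> m \<ge> 1 \<Longrightarrow> \<bar>log_ratio s m n\<bar> \<le> K / real n"
    using log_ratio_bound_large[OF s] by blast
  define M where "M = nat \<lceil>\<bar>C\<bar> * real n0 ^ J\<rceil>"
  define B where "B = (\<Sum>(m, n)\<in>{..M} \<times> {..<n0}. \<bar>log_ratio s m n\<bar>)"
  have B0: "B \<ge> 0" by (auto simp: B_def intro: sum_nonneg)
  have "\<bar>log_ratio s m n\<bar> \<le> (K + B * real n0) / real n"
    if mn: "n \<ge> 1" "m \<ge> 1" and m: "real m \<le> C * real n ^ J" for m n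
  proof (cases "n \<ge> n0")
    case True
    have "K / real n \<le> (K + B * real n0) / real n" using B0 by (intro divide_right_mono) auto
    then show ?thesis using K(2)[OF True mn(2)] by linarith
  next
    case False
    have "C * real n ^ J \<le> \<bar>C\<bar> * real n0 ^ J" using False by (intro mult_mono power_mono) auto
    then have "m \<le> M" using m unfolding M_def by linarith
    then have "\<bar>log_ratio s m n\<bar> \<le> B"
      unfolding B_def using False member_le_sum[of "(m, n)" "{..M} \<times> {..<n0}" "\<lambda>(m, n). \<bar>log_ratio s m n\<bar>"]
      by auto
    then have "\<bar>log_ratio s m n\<bar> * real n \<le> B * real n0" using False B0 by (intro mult_mono) auto
    then have "\<bar>log_ratio s m n\<bar> * real n \<le> K + B * real n0" using K(1) by linarith
    then show ?thesis using mn by (simp add: pos_le_divide_eq)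
  qed
  then show ?thesis by blast
qed

text \<open>\<open>H 1\<close> is the number of acyclic orientations, so the hypothesis on gamma
  supplies the exponent at s = 1, and \<open>log_ratio\<close> is added to its error term.\<close>

theorem H_equal_uniform_asymptotics:
  assumes s: "s > 0" and ex: "acyclic_orientation_expansion \<gamma>" and J: "J \<ge> 1"
  shows "\<exists>K::real. \<forall>n\<ge>1. \<forall>m\<ge>1. real m \<le> C * real n ^ J \<longrightarrow>
    (\<exists>\<epsilon>. \<bar>\<epsilon>\<bar> \<le> K / real n \<and>
      H s (equal_multipartite m n) =
        fact (m * n) * real (m * n) powr (s - 1) / Gamma s *
        exp (- real m / 2 + 1 / 2
             + (\<Sum>j=1..J. of_rat (\<gamma> j) * real m / real n ^ j) + \<epsilon>))"
proof -
  obtain K where K: "\<And>n m. n \<ge> 1 \<Longrightarrow> m \<ge> 1 \<Longrightarrow> real m \<le> C * real n ^ J \<Longrightarrow>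
    \<exists>\<epsilon>. \<bar>\<epsilon>\<bar> \<le> K / real n \<and> real (card (acyclic_orientations (equal_multipartite m n))) =
      fact (m * n) * exp (- real m / 2 + 1 / 2
        + (\<Sum>j=1..J. of_rat (\<gamma> j) * real m / real n ^ j) + \<epsilon>)"
    using ex J unfolding acyclic_orientation_expansion_def by meson
  obtain L where L: "\<And>n m. n \<ge> 1 \<Longrightarrow> m \<ge> 1 \<Longrightarrow> real m \<le> C * real n ^ J \<Longrightarrow>
      \<bar>log_ratio s m n\<bar> \<le> L / real n"
    using log_ratio_bound[OF s] by meson
  show ?thesis
  proof (rule exI[of _ "K + L"], intro allI impI)
    fix n m :: nat assume mn: "n \<ge> 1" "m \<ge> 1" "real m \<le> C * real n ^ J"
    let ?S = "- real m / 2 + 1 / 2 + (\<Sum>j=1..J. of_rat (\<gamma> j) * real m / real n ^ j)"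
    obtain e where e: "\<bar>e\<bar> \<le> K / real n"
      "real (card (acyclic_orientations (equal_multipartite m n))) = fact (m * n) * exp (?S + e)"
      using K[OF mn] by blast
    have "H 1 (equal_multipartite m n) = fact (m * n) * exp (?S + e)"
      using card_acyclic_orientations_eq_H[OF simple_graph_equal_multipartite, of m n] e(2) by simp
    then have "H s (equal_multipartite m n) = fact (m * n) * real (m * n) powr (s - 1) / Gamma s *
        (exp (?S + e) * exp (log_ratio s m n))"
      using H_equal_log_ratio[OF s mn(2,1)] by (simp del: of_nat_mult)
    also have "exp (?S + e) * exp (log_ratio s m n) = exp (?S + (e + log_ratio s m n))"
      by (simp add: add.assoc flip: exp_add)
    finally have "H s (equal_multipartite m n) = fact (m * n) * real (m * n) powr (s - 1) / Gamma s *
        exp (?S + (e + log_ratio s m n))" .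
    moreover have "\<bar>e + log_ratio s m n\<bar> \<le> (K + L) / real n"
      using e(1) L[OF mn] by (simp add: add_divide_distrib)
    ultimately show "\<exists>\<epsilon>. \<bar>\<epsilon>\<bar> \<le> (K + L) / real n \<and> H s (equal_multipartite m n) =
        fact (m * n) * real (m * n) powr (s - 1) / Gamma s * exp (?S + \<epsilon>)" by blast
  qed
qed

section \<open>Asymptotic expansions\<close>

text \<open>In terms of Stirling numbers of the second kind this is -S(n+1, n), minus the number of
  pairs.\<close>

lemma coeff_touchard_pred: "coeff (touchard (Suc n)) n = A_coeff (Suc n)"
proof (induction n)
  case (Suc n)
  have "coeff (touchard (Suc (Suc n))) (Suc n) = coeff (touchard (Suc n)) n - real (Suc n)"
    using lead_coeff_touchard[of "Suc n"] by (simp add: coeff_pderiv del: touchard.simps(2)[of n])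
  then show ?case unfolding Suc.IH by (simp add: A_coeff_def field_simps)
qed (simp add: A_coeff_def)

text \<open>The Stirling number S(n+2, n): either one block of size three or two blocks of size
  two.\<close>

lemma coeff_touchard_pred2: "coeff (touchard (Suc (Suc n))) n = B_coeff (Suc (Suc n))"
proof (induction n)
  case (Suc n)
  let ?T = "touchard (Suc (Suc n))"
  have "coeff (touchard (Suc (Suc (Suc n)))) (Suc n) = coeff ?T n - real (Suc n) * coeff ?T (Suc n)"
    by (subst touchard.simps(2)) (simp add: coeff_pderiv del: touchard.simps(2))
  then show ?case unfolding Suc.IH coeff_touchard_pred[of "Suc n"]
    by (simp add: A_coeff_def B_coeff_def field_simps del: touchard.simps)
qed (simp add: B_coeff_def)

lemma touchard_expansion:
  "\<exists>K. \<forall>x\<ge>1. \<bar>poly (touchard j) x / x ^ j - (1 + A_coeff j / x + B_coeff j / x\<^sup>2)\<bar> \<le> K / x ^ 3"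
proof -
  \<comment> \<open>For j <= 2 the expansion is exact; from j = 3 on the three leading coefficients
    are separated from a remainder of degree at most j - 3.\<close>
  consider "j = 0" | "j = 1" | "j = 2" | k where "j = Suc (Suc (Suc k))"
    by (cases j rule: nat.exhaust) (auto, metis One_nat_def Suc_1 not0_implies_Suc)
  then show ?thesis
  proof cases
    case 4
    let ?T = "touchard j"
    define K where "K = (\<Sum>b\<le>k. \<bar>coeff ?T b\<bar>)"
    show ?thesis
    proof (intro exI[of _ K] allI impI)
      fix x :: real assume x: "x \<ge> 1"
      have c: "coeff ?T (Suc k) = B_coeff j" "coeff ?T (Suc (Suc k)) = A_coeff j"
        "coeff ?T (Suc (Suc (Suc k))) = 1"
        using coeff_touchard_pred2[of "Suc k"] coeff_touchard_pred[of "Suc (Suc k)"]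
          lead_coeff_touchard[of j] unfolding 4 by simp_all
      have "poly ?T x = (\<Sum>b\<le>k. coeff ?T b * x ^ b) + B_coeff j * x ^ Suc k
          + A_coeff j * x ^ Suc (Suc k) + x ^ Suc (Suc (Suc k))"
        unfolding poly_touchard c[symmetric] by (simp add: 4 c[unfolded 4] del: touchard.simps)
      then have "poly ?T x / x ^ j - (1 + A_coeff j / x + B_coeff j / x\<^sup>2) =
          (\<Sum>b\<le>k. coeff ?T b * x ^ b) / x ^ j"
        using x by (simp add: 4 field_simps power2_eq_square del: touchard.simps)
      also have "\<bar>\<dots>\<bar> \<le> (K * x ^ k) / x ^ j"
      proof -
        have "\<bar>\<Sum>b\<le>k. coeff ?T b * x ^ b\<bar> \<le> (\<Sum>b\<le>k. \<bar>coeff ?T b\<bar> * x ^ k)"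
          using x by (intro order_trans[OF sum_abs] sum_mono)
            (auto simp: abs_mult intro!: mult_left_mono power_increasing)
        then show ?thesis using x
          by (simp add: K_def abs_div sum_distrib_right divide_right_mono del: touchard.simps)
      qed
      also have "\<dots> = K / x ^ 3" using x by (simp add: 4 field_simps eval_nat_numeral)
      finally show "\<bar>poly ?T x / x ^ j - (1 + A_coeff j / x + B_coeff j / x\<^sup>2)\<bar> \<le> K / x ^ 3" .
    qed
  qed (auto intro!: exI[of _ 0] simp: A_coeff_def B_coeff_def eval_nat_numeral pderiv_pCons field_simps)
qed

lemma ln_one_plus_expansion:
  "\<exists>c d. c > 0 \<and> d > 0 \<and> (\<forall>w::real. \<bar>w\<bar> < d \<longrightarrow> \<bar>ln (1 + w) - w + w\<^sup>2 / 2\<bar> \<le> c * \<bar>w\<bar> ^ 3)"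
proof -
  have "(\<lambda>w::real. ln (1 + w) - w + w\<^sup>2 / 2) \<in> O[at 0](\<lambda>w. w ^ 3)" by real_asymp
  then obtain c where c: "c > 0"
    and ev: "\<forall>\<^sub>F w::real in at 0. norm (ln (1 + w) - w + w\<^sup>2 / 2) \<le> c * norm (w ^ 3)"
    by (elim landau_o.bigE)
  from ev obtain d where d: "d > 0"
    "\<And>w. w \<noteq> 0 \<Longrightarrow> \<bar>w\<bar> < d \<Longrightarrow> \<bar>ln (1 + w) - w + w\<^sup>2 / 2\<bar> \<le> c * \<bar>w\<bar> ^ 3"
    unfolding eventually_at by (auto simp: power_abs dist_real_def)
  have "\<bar>ln (1 + w) - w + w\<^sup>2 / 2\<bar> \<le> c * \<bar>w\<bar> ^ 3" if "\<bar>w\<bar> < d" for w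
    using d(2)[of w] that by (cases "w = 0") auto
  then show ?thesis using c d(1) by blast
qed

lemma ln_one_plus_inverse_bigo:
  "(\<lambda>n. ln (1 + c / real n) - c / real n + (c / real n)\<^sup>2 / 2) \<in> O(\<lambda>n. 1 / real n ^ 3)"
proof -
  obtain b d where b: "b > 0" and d: "d > 0"
    and ln: "\<And>w::real. \<bar>w\<bar> < d \<Longrightarrow> \<bar>ln (1 + w) - w + w\<^sup>2 / 2\<bar> \<le> b * \<bar>w\<bar> ^ 3"
    using ln_one_plus_expansion by blast
  have "(\<lambda>n. \<bar>c / real n\<bar>) \<longlonglongrightarrow> 0" by (intro tendsto_rabs_zero lim_const_over_n)
  then have "\<forall>\<^sub>F n in sequentially. \<bar>c / real n\<bar> < d" using d by (rule order_tendstoD(2))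
  then have "\<forall>\<^sub>F n in sequentially. norm (ln (1 + c / real n) - c / real n + (c / real n)\<^sup>2 / 2)
      \<le> (b * \<bar>c\<bar> ^ 3) * norm (1 / real n ^ 3)"
  proof eventually_elim
    case (elim n)
    then show ?case using ln[OF elim] by (simp add: abs_divide power_divide)
  qed
  then show ?thesis by (rule bigoI)
qed

text \<open>\<open>E_coeff\<close> is the second-order coefficient of ln(1 + A/x + B/x^2), namely B
  - A^2/2.\<close>

lemma ln_touchard_expansion:
  "\<exists>K X. \<forall>x\<ge>X. \<bar>ln (poly (touchard j) x / x ^ j) - (A_coeff j / x + E_coeff j / x\<^sup>2)\<bar> \<le> K / x ^ 3"
proof -
  let ?A = "A_coeff j" and ?B = "B_coeff j"
  obtain K where K: "\<And>x. x \<ge> 1 \<Longrightarrow>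
      \<bar>poly (touchard j) x / x ^ j - (1 + ?A / x + ?B / x\<^sup>2)\<bar> \<le> K / x ^ 3"
    using touchard_expansion[of j] by blast
  obtain c d where c: "c > 0" and d: "d > 0"
    and ln: "\<And>w::real. \<bar>w\<bar> < d \<Longrightarrow> \<bar>ln (1 + w) - w + w\<^sup>2 / 2\<bar> \<le> c * \<bar>w\<bar> ^ 3"
    using ln_one_plus_expansion by blast
  have K0: "K \<ge> 0" using K[of 1] by simp
  define K1 where "K1 = \<bar>?A\<bar> + \<bar>?B\<bar> + K"
  have K1: "K1 \<ge> 0" using K0 by (simp add: K1_def)
  show ?thesis
  proof (intro exI allI impI)
    \<comment> \<open>Since |w| <= K1/x, this range of x puts w inside the radius \<open>d\<close>
      of the logarithm expansion.\<close>
    fix x assume x: "x \<ge> max 1 (K1 / d + 1)"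
    then have x1: "x \<ge> 1" and xd: "x > K1 / d" by auto
    define w where "w = poly (touchard j) x / x ^ j - 1"
    define v where "v = w - ?A / x"
    have r: "\<bar>w - ?A / x - ?B / x\<^sup>2\<bar> \<le> K / x ^ 3" using K[OF x1] by (simp add: w_def algebra_simps)
    have x32: "1 / x ^ 3 \<le> 1 / x\<^sup>2" "1 / x\<^sup>2 \<le> 1 / x"
      using x1 by (auto simp: field_simps eval_nat_numeral intro: mult_left_mono)
    have v: "\<bar>v\<bar> \<le> (\<bar>?B\<bar> + K) / x\<^sup>2"
    proof -
      have "\<bar>v\<bar> \<le> \<bar>?B / x\<^sup>2\<bar> + K / x ^ 3" using r unfolding v_def by linarith
      then have "\<bar>v\<bar> \<le> \<bar>?B / x\<^sup>2\<bar> + K * (1 / x ^ 3)" by simp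
      also have "\<dots> \<le> \<bar>?B / x\<^sup>2\<bar> + K * (1 / x\<^sup>2)"
        using x32 K0 by (intro add_left_mono mult_left_mono)
      finally show ?thesis by (simp add: abs_divide add_divide_distrib)
    qed
    have w: "\<bar>w\<bar> \<le> K1 / x"
    proof -
      have "\<bar>w\<bar> \<le> \<bar>?A / x\<bar> + (\<bar>?B\<bar> + K) / x\<^sup>2" using v unfolding v_def by linarith
      then have "\<bar>w\<bar> \<le> \<bar>?A / x\<bar> + (\<bar>?B\<bar> + K) * (1 / x\<^sup>2)" by simp
      also have "\<dots> \<le> \<bar>?A / x\<bar> + (\<bar>?B\<bar> + K) * (1 / x)"
        using x32 K0 by (intro add_left_mono mult_left_mono) auto
      also have "\<dots> = K1 / x" using x1 by (simp add: K1_def abs_divide add_divide_distrib)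
      finally show ?thesis .
    qed
    have "K1 / x < d" using xd d x1 by (simp add: field_simps)
    then have "\<bar>w\<bar> < d" using w by simp
    then have "\<bar>ln (1 + w) - w + w\<^sup>2 / 2\<bar> \<le> c * \<bar>w\<bar> ^ 3" by (rule ln)
    also have "\<dots> \<le> c * (K1 / x) ^ 3" using w c by (intro mult_left_mono power_mono) auto
    finally have 1: "\<bar>ln (1 + w) - w + w\<^sup>2 / 2\<bar> \<le> c * K1 ^ 3 / x ^ 3"
      by (simp add: power_divide)
    have "w\<^sup>2 - (?A / x)\<^sup>2 = v * (w + ?A / x)" by (simp add: v_def power2_eq_square algebra_simps)
    also have "\<bar>\<dots>\<bar> \<le> (\<bar>?B\<bar> + K) / x\<^sup>2 * (2 * (K1 / x))"
    proof -
      have "\<bar>?A / x\<bar> \<le> K1 / x" using x1 K0 by (auto simp: K1_def abs_divide divide_right_mono)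
      then have "\<bar>w + ?A / x\<bar> \<le> 2 * (K1 / x)" using w by linarith
      then show ?thesis unfolding abs_mult using v by (intro mult_mono) auto
    qed
    finally have 2: "\<bar>w\<^sup>2 - (?A / x)\<^sup>2\<bar> \<le> 2 * (((\<bar>?B\<bar> + K) * K1) / x ^ 3)"
      by (simp add: eval_nat_numeral algebra_simps)
    have "ln (1 + w) - (?A / x + E_coeff j / x\<^sup>2) =
        (ln (1 + w) - w + w\<^sup>2 / 2) + (w - ?A / x - ?B / x\<^sup>2) - (w\<^sup>2 - (?A / x)\<^sup>2) / 2"
      by (simp add: E_coeff_def power_divide diff_divide_distrib)
    also have "\<bar>\<dots>\<bar> \<le> c * K1 ^ 3 / x ^ 3 + K / x ^ 3 + ((\<bar>?B\<bar> + K) * K1) / x ^ 3"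
    proof -
      have *: "\<bar>p + q - r / 2\<bar> \<le> a + b + c" if "\<bar>p\<bar> \<le> a" "\<bar>r\<bar> \<le> 2 * c" "\<bar>q\<bar> \<le> b"
        for p q r a b c :: real using that by linarith
      show ?thesis by (rule *[OF 1 2 r])
    qed
    also have "\<dots> = (c * K1 ^ 3 + K + (\<bar>?B\<bar> + K) * K1) / x ^ 3" by (simp add: add_divide_distrib)
    finally show "\<bar>ln (poly (touchard j) x / x ^ j) - (?A / x + E_coeff j / x\<^sup>2)\<bar>
        \<le> (c * K1 ^ 3 + K + (\<bar>?B\<bar> + K) * K1) / x ^ 3" by (simp add: w_def)
  qed
qed

section \<open>First correction in the ratio of Gamma(n + s) to n! n^(s-1)\<close>

lemma bigo_inverse_power_bound:
  fixes f :: "nat \<Rightarrow> real"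
  assumes "f \<in> O(\<lambda>n. 1 / real n ^ k)"
  shows "\<exists>K\<ge>0. \<forall>n\<ge>1. \<bar>f n\<bar> \<le> K / real n ^ k"
proof -
  obtain c where c: "c > 0" "\<forall>\<^sub>F n in sequentially. norm (f n) \<le> c * norm (1 / real n ^ k)"
    using assms by (elim landau_o.bigE)
  then obtain n0 where n0: "\<And>n. n \<ge> n0 \<Longrightarrow> \<bar>f n\<bar> \<le> c / real n ^ k"
    unfolding eventually_sequentially by auto
  define K where "K = c + (\<Sum>n<n0. \<bar>f n\<bar> * real n ^ k)"
  have "\<bar>f n\<bar> \<le> K / real n ^ k" if n: "n \<ge> 1" for n
  proof (cases "n \<ge> n0")
    case True
    have "c \<le> K" by (auto simp: K_def intro!: sum_nonneg)
    then have "c / real n ^ k \<le> K / real n ^ k" by (intro divide_right_mono) auto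
    then show ?thesis using n0[OF True] by simp
  next
    case False
    have "\<bar>f n\<bar> * real n ^ k \<le> (\<Sum>n<n0. \<bar>f n\<bar> * real n ^ k)"
      by (rule member_le_sum) (use False in auto)
    then show ?thesis using n c by (simp add: K_def field_simps)
  qed
  moreover have "K \<ge> 0" using c by (auto simp: K_def intro!: add_nonneg_nonneg sum_nonneg)
  ultimately show ?thesis by blast
qed

text \<open>Because 1/y^3 <= 2/y^2 - 2/(y+1)^2 for y >= 1, adding 2C/n^2 makes the sequence
  decreasing with limit 0, hence nonnegative. Applied to d and to -d.\<close>

lemma telescoping_cubic_bound:
  fixes d :: "nat \<Rightarrow> real"
  assumes d: "d \<longlonglongrightarrow> 0" and C: "\<And>n. n \<ge> 1 \<Longrightarrow> \<bar>d (Suc n) - d n\<bar> \<le> C / real n ^ 3"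
    and n: "n \<ge> 1"
  shows "\<bar>d n\<bar> \<le> 2 * C / (real n)\<^sup>2"
proof -
  have C0: "C \<ge> 0" using C[of 1] by simp
  have *: "e n \<ge> - (2 * C / (real n)\<^sup>2)"
    if e: "e \<longlonglongrightarrow> 0" "\<And>n. n \<ge> 1 \<Longrightarrow> e (Suc n) - e n \<le> C / real n ^ 3" for e :: "nat \<Rightarrow> real"
  proof -
    let ?g = "\<lambda>k. e (k + n) + 2 * C / (real (k + n))\<^sup>2"
    have "decseq ?g"
    proof (rule decseq_SucI)
      fix k
      define y where "y = real (k + n)"
      have y: "y \<ge> 1" using n by (simp add: y_def)
      have "(y + 1)\<^sup>2 \<le> 2 * y * (2 * y + 1)" 
        using mult_mono[of 1 y 1 y] y by (simp add: power2_eq_square algebra_simps)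
      then have "1 / y ^ 3 \<le> 2 / y\<^sup>2 - 2 / (y + 1)\<^sup>2"
        using y by (simp add: divide_simps) (simp add: eval_nat_numeral algebra_simps)
      then have "C * (1 / y ^ 3) \<le> C * (2 / y\<^sup>2 - 2 / (y + 1)\<^sup>2)" using C0 by (intro mult_left_mono)
      then show "?g (Suc k) \<le> ?g k"
        using e(2)[of "k + n"] n by (simp add: y_def algebra_simps)
    qed
    moreover have "?g \<longlonglongrightarrow> 0 + 0"
    proof (rule tendsto_add)
      show "(\<lambda>k. e (k + n)) \<longlonglongrightarrow> 0" using e(1) by (simp add: LIMSEQ_ignore_initial_segment)
      have "(\<lambda>k. 2 * C / (real k)\<^sup>2) \<longlonglongrightarrow> 0" by real_asymp
      then show "(\<lambda>k. 2 * C / (real (k + n))\<^sup>2) \<longlonglongrightarrow> 0" by (rule LIMSEQ_ignore_initial_segment)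
    qed
    ultimately have "?g 0 \<ge> 0" using decseq_ge[of ?g 0 0] by simp
    then show ?thesis by simp
  qed
  have "d n \<ge> - (2 * C / (real n)\<^sup>2)"
    using d C by (intro *) (auto simp: abs_le_iff)
  moreover have "- d n \<ge> - (2 * C / (real n)\<^sup>2)"
  proof (rule *)
    show "(\<lambda>n. - d n) \<longlonglongrightarrow> 0" using tendsto_minus[OF d] by simp
    show "- d (Suc n) - - d n \<le> C / real n ^ 3" if "n \<ge> 1" for n using C[OF that] by linarith
  qed
  ultimately show ?thesis by linarith
qed

text \<open>Euler's limit n! n^s / (s (s+1) ... (s+n)) for Gamma(s), with the product rewritten as a
  quotient of Gamma values.\<close>

lemma Gamma_fact_ratio_tendsto:
  assumes s: "s > 0"
  shows "(\<lambda>n. Gamma (real n + s) / (fact n * real n powr (s - 1))) \<longlonglongrightarrow> 1"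
proof -
  have nI: "s \<notin> \<int>\<^sub>\<le>\<^sub>0" using s by (auto elim!: nonpos_Ints_cases)
  have G: "Gamma s > 0" using s by (rule Gamma_real_pos)
  have "(\<lambda>n. Gamma s / Gamma_series s n * (real n / (real n + s))) \<longlonglongrightarrow> Gamma s / Gamma s * 1"
    by (intro tendsto_intros Gamma_series_LIMSEQ) (use G in simp, real_asymp)
  moreover have "\<forall>\<^sub>F n in sequentially. Gamma s / Gamma_series s n * (real n / (real n + s)) =
      Gamma (real n + s) / (fact n * real n powr (s - 1))"
    using eventually_gt_at_top[of 0]
  proof eventually_elim
    case (elim n)
    have p: "pochhammer s (Suc n) = (real n + s) * Gamma (real n + s) / Gamma s"
      using pochhammer_Gamma[OF nI, of "n"] by (simp add: pochhammer_Suc add.commute)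
    have e: "exp (s * ln (real n)) = real n powr (s - 1) * real n"
      using elim powr_add[of "real n" "s - 1" 1] by (simp add: powr_def)
    define x where "x = real n + s"
    define P where "P = real n powr (s - 1)"
    have "x \<noteq> 0" "P \<noteq> 0" using elim s by (auto simp: x_def P_def)
    then show ?case
      unfolding Gamma_series_def of_real_eq_id id_apply Suc_eq_plus1[symmetric] p e x_def[symmetric] P_def[symmetric]
      using elim G by (simp add: field_simps)
  qed
  ultimately show ?thesis using G by (simp add: tendsto_cong)
qed


text \<open>The logarithm minus s(s-1)/(2n) tends to 0 and, by the functional equation, has
  increments O(n^-3); the telescoping bound makes it O(n^-2), and exponentiating keeps that
  order.\<close>

lemma Gamma_fact_ratio:
  assumes s: "s > 0"
  shows "(\<lambda>n. Gamma (real n + s) / (fact n * real n powr (s - 1)) - (1 + s * (s - 1) / 2 / real n))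
    \<in> O(\<lambda>n. 1 / real n ^ 2)"
proof -
  define a where "a n = Gamma (real n + s) / (fact n * real n powr (s - 1))" for n
  define d where "d n = ln (a n) - s * (s - 1) / 2 / real n" for n
  have a_pos: "a n > 0" if "n \<ge> 1" for n
    using that s Gamma_real_pos[of "real n + s"] by (simp add: a_def)
  have step: "d (Suc n) - d n = ln (real n + s) - ln (real n + 1) - (s - 1) * (ln (real n + 1) - ln (real n))
      - s * (s - 1) / 2 * (1 / (real n + 1) - 1 / real n)" if "n \<ge> 1" for n
  proof -
    have n: "real n > 0" using that by simp
    have "real n + s \<notin> \<int>\<^sub>\<le>\<^sub>0" using s by (auto elim!: nonpos_Ints_cases)
    then have G: "Gamma (real (Suc n) + s) = (real n + s) * Gamma (real n + s)"
      using Gamma_plus1[of "real n + s"] by (simp add: algebra_simps)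
    have "a (Suc n) = a n * ((real n + s) / (real n + 1) * (real n / (real n + 1)) powr (s - 1))"
    proof -
      define x where "x = real n + s"
      define y where "y = real n + 1"
      define P where "P = real n powr (s - 1)"
      define Q where "Q = (real n + 1) powr (s - 1)"
      have nz: "x \<noteq> 0" "y \<noteq> 0" "P \<noteq> 0" "Q \<noteq> 0"
        using n s by (auto simp: x_def y_def P_def Q_def)
      have y: "fact (Suc n) = y * fact n" "real (Suc n) = y" by (simp_all add: y_def)
      have Q: "y powr (s - 1) = Q" "(real n / y) powr (s - 1) = P / Q"
        using n by (simp_all add: y_def P_def Q_def powr_divide)
      show ?thesis
        unfolding a_def x_def[symmetric] y y_def[symmetric] Q P_def[symmetric]
        using nz G[folded x_def, unfolded y] by (simp add: field_simps)
    qed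
    moreover have "(real n + s) / (real n + 1) > 0" "(real n / (real n + 1)) powr (s - 1) > 0"
      using n s by auto
    ultimately have "ln (a (Suc n)) = ln (a n) + (ln ((real n + s) / (real n + 1)) +
        ln ((real n / (real n + 1)) powr (s - 1)))"
      using a_pos[OF that] by (simp only: ln_mult_pos mult_pos_pos)
    then show ?thesis using n s by (simp add: d_def ln_div ln_powr algebra_simps diff_divide_distrib)
  qed
  have "(\<lambda>n. ln (real n + s) - ln (real n + 1) - (s - 1) * (ln (real n + 1) - ln (real n))
      - s * (s - 1) / 2 * (1 / (real n + 1) - 1 / real n)) \<in> O(\<lambda>n. 1 / real n ^ 3)"
  proof -
    have "(\<lambda>n. 1 / (real n * (real n + 1)) - 1 / (real n)\<^sup>2) \<in> O(\<lambda>n. 1 / real n ^ 3)" by real_asymp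
    then have "(\<lambda>n. s * (s - 1) / 2 * (1 / (real n * (real n + 1)) - 1 / (real n)\<^sup>2)) \<in> O(\<lambda>n. 1 / real n ^ 3)"
      by (cases "s * (s - 1) / 2 = 0") (simp_all only: landau_o.big.cmult_in_iff, auto)
    moreover have "(\<lambda>n. s * (ln (1 + 1 / real n) - 1 / real n + (1 / real n)\<^sup>2 / 2)) \<in> O(\<lambda>n. 1 / real n ^ 3)"
      using ln_one_plus_inverse_bigo[of 1] s by simp
    \<comment> \<open>The combination is arranged so that all terms of order 1/n and 1/n^2 cancel,
      -s^2/2 + s/2 + s(s-1)/2 = 0, and only the increment of d remains.\<close>
    ultimately have "(\<lambda>n. (ln (1 + s / real n) - s / real n + (s / real n)\<^sup>2 / 2)
        - s * (ln (1 + 1 / real n) - 1 / real n + (1 / real n)\<^sup>2 / 2)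
        + s * (s - 1) / 2 * (1 / (real n * (real n + 1)) - 1 / (real n)\<^sup>2)) \<in> O(\<lambda>n. 1 / real n ^ 3)"
      by (intro sum_in_bigo ln_one_plus_inverse_bigo)
    also have "?this \<longleftrightarrow> ?thesis"
    proof (rule landau_o.big.in_cong, use eventually_gt_at_top[of 0] in eventually_elim)
      case (elim n)
      have n: "real n > 0" using elim by simp
      have 1: "ln (1 + s / real n) = ln (real n + s) - ln (real n)"
        "ln (1 + 1 / real n) = ln (real n + 1) - ln (real n)"
      proof -
        have "1 + s / real n = (real n + s) / real n" "1 + 1 / real n = (real n + 1) / real n"
          using n by (simp_all add: field_simps)
        then show "ln (1 + s / real n) = ln (real n + s) - ln (real n)"
          "ln (1 + 1 / real n) = ln (real n + 1) - ln (real n)"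
          using n s by (simp_all only: ln_div) auto
      qed
      have 2: "1 / (real n + 1) - 1 / real n = - (1 / (real n * (real n + 1)))"
        using n by (simp add: divide_simps)
      have 3: "1 / (real n * (real n + 1)) = z \<Longrightarrow>
         (ln (real n + s) - ln (real n) - s / real n + (s / real n)\<^sup>2 / 2)
        - s * (ln (real n + 1) - ln (real n) - 1 / real n + (1 / real n)\<^sup>2 / 2)
        + s * (s - 1) / 2 * (z - 1 / (real n)\<^sup>2) =
        ln (real n + s) - ln (real n + 1) - (s - 1) * (ln (real n + 1) - ln (real n))
      - s * (s - 1) / 2 * (- z)" for z
        by (simp add: power_divide algebra_simps diff_divide_distrib add_divide_distrib power2_eq_square)
      show ?case unfolding 1 2 using 3 by simp
    qed
    finally show ?thesis .
  qed
  from bigo_inverse_power_bound[OF this] obtain C where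
    "\<And>n. n \<ge> 1 \<Longrightarrow> \<bar>d (Suc n) - d n\<bar> \<le> C / real n ^ 3" using step by metis
  moreover have "d \<longlonglongrightarrow> ln 1 - 0"
    unfolding d_def[abs_def] a_def[abs_def]
    by (intro tendsto_diff tendsto_ln Gamma_fact_ratio_tendsto[OF s]) (simp, real_asymp)
  ultimately have d: "\<bar>d n\<bar> \<le> 2 * C / (real n)\<^sup>2" if "n \<ge> 1" for n
    using that by (intro telescoping_cubic_bound) auto
  have C0: "C \<ge> 0" using d[of 1] by simp
  define b where "b = \<bar>s * (s - 1) / 2\<bar> + 2 * C"
  have b0: "b \<ge> 0" using C0 by (simp add: b_def)
  have main: "\<bar>a n - (1 + s * (s - 1) / 2 / real n)\<bar> \<le> (2 * b\<^sup>2 + 2 * C) / (real n)\<^sup>2"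
    if n: "real n \<ge> max 1 b" for n
  proof -
    define y where "y = s * (s - 1) / 2 / real n + d n"
    have n1: "real n \<ge> 1" "n \<ge> 1" using n by auto
    have "1 / (real n)\<^sup>2 \<le> 1 / real n" using n1 by (simp add: field_simps power2_eq_square)
    then have "2 * C * (1 / (real n)\<^sup>2) \<le> 2 * C * (1 / real n)" using C0 by (intro mult_left_mono) auto
    moreover have "\<bar>y\<bar> \<le> \<bar>s * (s - 1) / 2\<bar> / real n + \<bar>d n\<bar>"
      unfolding y_def by (rule order_trans[OF abs_triangle_ineq]) (simp add: abs_divide)
    ultimately have y: "\<bar>y\<bar> \<le> b / real n" using d[OF n1(2)] by (simp add: b_def add_divide_distrib)
    also have "\<dots> \<le> 1" using n n1 by (simp add: divide_le_eq)
    finally have y1: "\<bar>y\<bar> \<le> 1" .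
    obtain t where t: "\<bar>t\<bar> \<le> \<bar>y\<bar>" "exp y = (\<Sum>k<2. y ^ k / fact k) + exp t / fact 2 * y ^ 2"
      using Maclaurin_exp_le[of y 2] by blast
    have "exp t \<le> exp 1" using t(1) y1 by simp
    also have "exp 1 \<le> (3 :: real)" using exp_le by simp
    finally have "exp t \<le> 3" .
    then have "exp t / fact 2 * y ^ 2 \<le> 2 * y ^ 2" by (intro mult_right_mono) auto
    then have e: "\<bar>exp y - 1 - y\<bar> \<le> 2 * y\<^sup>2"
      unfolding t(2) by (simp add: numeral_2_eq_2)
    have "y\<^sup>2 \<le> (b / real n)\<^sup>2" using y by (rule abs_le_square_iff[THEN iffD1, OF order_trans]) (use b0 in simp)
    then have "\<bar>exp y - 1 - y\<bar> \<le> 2 * b\<^sup>2 / (real n)\<^sup>2" using e by (simp add: power_divide)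
    moreover have "a n = exp y" using a_pos[OF n1(2)] by (simp add: y_def d_def)
    ultimately show ?thesis using d[OF n1(2)] by (simp add: y_def add_divide_distrib)
  qed
  have "\<forall>\<^sub>F n in sequentially. real n \<ge> max 1 b"
    by real_asymp
  then have "\<forall>\<^sub>F n in sequentially. norm (a n - (1 + s * (s - 1) / 2 / real n))
      \<le> (2 * b\<^sup>2 + 2 * C) * norm (1 / real n ^ 2)"
    by eventually_elim (use main in simp)
  then show ?thesis unfolding a_def by (rule bigoI)
qed

text \<open>With both points nonpositive the intermediate exponential in the Lagrange remainder is
  at most 1, so the bound needs no constant depending on them.\<close>

lemma exp_Taylor_nonpos:
  fixes c y :: real
  assumes "c \<le> 0" "y \<le> 0"
  shows "\<bar>exp y - exp c * (\<Sum>k<n. (y - c) ^ k / fact k)\<bar> \<le> \<bar>y - c\<bar> ^ n / fact n"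
proof (cases "n = 0 \<or> y = c")
  case True
  then show ?thesis
  proof
    assume "y = c"
    then show ?thesis
      using assms by (cases n) (auto simp: sum.lessThan_Suc_shift simp del: sum.lessThan_Suc)
  qed (use assms in simp)
next
  case False
  have "\<exists>t. (if y < c then y < t \<and> t < c else c < t \<and> t < y) \<and>
      exp y = (\<Sum>m<n. exp c / fact m * (y - c) ^ m) + exp t / fact n * (y - c) ^ n"
    by (rule Taylor[where a = "min c y" and b = "max c y" and diff = "\<lambda>_. exp"])
      (use False in \<open>auto intro!: derivative_eq_intros\<close>)
  then obtain t where t: "t \<le> 0"
    "exp y = (\<Sum>m<n. exp c / fact m * (y - c) ^ m) + exp t / fact n * (y - c) ^ n"
    using assms by (auto split: if_splits)
  have "exp y - exp c * (\<Sum>k<n. (y - c) ^ k / fact k) = exp t / fact n * (y - c) ^ n"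
    unfolding t(2) by (simp add: sum_distrib_left field_simps)
  also have "\<bar>\<dots>\<bar> = exp t * (\<bar>y - c\<bar> ^ n / fact n)" by (simp add: abs_mult power_abs)
  also have "\<dots> \<le> 1 * (\<bar>y - c\<bar> ^ n / fact n)" using t(1) by (intro mult_right_mono) auto
  finally show ?thesis by simp
qed

text \<open>For a Gamma distributed variable \<open>x\<close> of shape \<open>n + s\<close>, this is the \<open>k\<close>-th moment of \<open>n / x\<close>.\<close>

definition inv_moment :: "real \<Rightarrow> nat \<Rightarrow> nat \<Rightarrow> real" where
  "inv_moment s k n = real n ^ k * Gamma (real n + s - real k) / Gamma (real n + s)"

lemma first_order_expansion_mult:
  fixes f g :: "nat \<Rightarrow> real"
  assumes f: "(\<lambda>n. f n - (1 + c / real n)) \<in> O(\<lambda>n. 1 / real n ^ 2)"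
    and g: "(\<lambda>n. g n - (1 + d / real n)) \<in> O(\<lambda>n. 1 / real n ^ 2)"
  shows "(\<lambda>n. f n * g n - (1 + (c + d) / real n)) \<in> O(\<lambda>n. 1 / real n ^ 2)"
proof -
  have g1: "g \<in> O(\<lambda>_. 1)"
  proof -
    have "(\<lambda>n. g n - (1 + d / real n)) \<in> O(\<lambda>_. 1)" by (rule landau_o.big.trans[OF g]) real_asymp
    moreover have "(\<lambda>n. 1 + d / real n) \<in> O(\<lambda>_. 1)" by real_asymp
    ultimately show ?thesis using sum_in_bigo(1) by fastforce
  qed
  have h1: "(\<lambda>n. 1 + c / real n) \<in> O(\<lambda>_. 1)" by real_asymp
  have "(\<lambda>n. c * d / real n ^ 2) \<in> O(\<lambda>n. 1 / real n ^ 2)" by real_asymp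
  moreover have "(\<lambda>n. (f n - (1 + c / real n)) * g n) \<in> O(\<lambda>n. 1 / real n ^ 2 * 1)"
    by (rule landau_o.big.mult[OF f g1])
  moreover have "(\<lambda>n. (g n - (1 + d / real n)) * (1 + c / real n)) \<in> O(\<lambda>n. 1 / real n ^ 2 * 1)"
    by (rule landau_o.big.mult[OF g h1])
  ultimately have "(\<lambda>n. (f n - (1 + c / real n)) * g n + (g n - (1 + d / real n)) * (1 + c / real n)
      + c * d / real n ^ 2) \<in> O(\<lambda>n. 1 / real n ^ 2)"
    by (intro sum_in_bigo) auto
  moreover have "(f n - (1 + c / real n)) * g n + (g n - (1 + d / real n)) * (1 + c / real n)
      + c * d / real n ^ 2 = f n * g n - (1 + (c + d) / real n)" for n
    by (simp add: field_simps power2_eq_square add_divide_distrib)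
  ultimately show ?thesis by simp
qed

text \<open>Passing from \<open>k\<close> to \<open>k + 1\<close> multiplies by n/(n + s - k - 1),
  which is 1 + (k + 1 - s)/n up to O(n^-2); the increments i - s for i = 1, ..., k add up to
  k(k+1)/2 - ks.\<close>

lemma inv_moment_expansion:
  assumes s: "s > 0"
  shows "(\<lambda>n. inv_moment s k n - (1 + (real k * (real k + 1) / 2 - real k * s) / real n))
    \<in> O(\<lambda>n. 1 / real n ^ 2)"
proof (induction k)
  case 0
  have "inv_moment s 0 n = 1" for n
  proof -
    have "Gamma (real n + s) > 0" using s by (intro Gamma_real_pos) simp
    then show ?thesis by (simp add: inv_moment_def)
  qed
  then show ?case by simp
next
  case (Suc k)
  have "(\<lambda>n. real n / (real n + s - real (Suc k)) - (1 + (real (Suc k) - s) / real n)) \<in> O(\<lambda>n. 1 / real n ^ 2)"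
    by real_asymp
  note first_order_expansion_mult[OF Suc.IH this]
  also have "(\<lambda>n. inv_moment s k n * (real n / (real n + s - real (Suc k))) -
      (1 + (real k * (real k + 1) / 2 - real k * s + (real (Suc k) - s)) / real n)) \<in> O(\<lambda>n. 1 / real n ^ 2)
    \<longleftrightarrow> (\<lambda>n. inv_moment s (Suc k) n - (1 + (real (Suc k) * (real (Suc k) + 1) / 2 - real (Suc k) * s) / real n))
      \<in> O(\<lambda>n. 1 / real n ^ 2)"
  proof (rule landau_o.big.in_cong)
    show "\<forall>\<^sub>F n in sequentially. inv_moment s k n * (real n / (real n + s - real (Suc k))) -
        (1 + (real k * (real k + 1) / 2 - real k * s + (real (Suc k) - s)) / real n) =
        inv_moment s (Suc k) n - (1 + (real (Suc k) * (real (Suc k) + 1) / 2 - real (Suc k) * s) / real n)"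
      using eventually_ge_at_top[of "Suc k"]
    proof eventually_elim
      case (elim n)
      define y where "y = real n + s - real (Suc k)"
      have y: "y > 0" using elim s by (simp add: y_def)
      then have "y \<notin> \<int>\<^sub>\<le>\<^sub>0" by (auto elim!: nonpos_Ints_cases)
      then have "Gamma (y + 1) = y * Gamma y" by (rule Gamma_plus1)
      moreover have "real n + s - real k = y + 1" by (simp add: y_def)
      ultimately have "inv_moment s k n * (real n / y) = inv_moment s (Suc k) n"
        using y unfolding inv_moment_def y_def[symmetric] by simp
      moreover have "real k * (real k + 1) / 2 - real k * s + (real (Suc k) - s) =
          real (Suc k) * (real (Suc k) + 1) / 2 - real (Suc k) * s" by (simp add: field_simps)
      ultimately show ?case by (simp add: y_def)
    qed
  qed
  finally show ?case .
qed

section \<open>Parts of bounded size\<close>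

definition tprod :: "nat \<Rightarrow> (nat \<Rightarrow> nat) \<Rightarrow> real \<Rightarrow> real" where
  "tprod m r x = (\<Prod>j=1..m. poly (touchard j) x ^ r j)"

lemma has_integral_H_mixed:
  assumes "s > 0"
  shows "((\<lambda>x. x powr (s - 1) * exp (- x) * tprod m r x) has_integral
    Gamma s * H s (mixed_multipartite m r)) {0..}"
proof -
  have "(\<Prod>i\<in>(SIGMA j:{1..m}. {..<r j}). poly (touchard (fst i)) x) = tprod m r x" for x
    unfolding tprod_def
    using prod.Sigma[of "{1..m}" "\<lambda>j. {..<r j}" "\<lambda>j _. poly (touchard j) x"]
    by (simp add: case_prod_unfold)
  then show ?thesis
    using has_integral_H[of "SIGMA j:{1..m}. {..<r j}" s fst] assms
    by (simp add: mixed_multipartite_def)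
qed

lemma ln_touchard_expansion_uniform:
  "\<exists>K X. K \<ge> 0 \<and> X \<ge> 1 \<and> X \<ge> 4 * real m \<and> (\<forall>j\<le>m. \<forall>x\<ge>X.
    \<bar>ln (poly (touchard j) x / x ^ j) - (A_coeff j / x + E_coeff j / x\<^sup>2)\<bar> \<le> K / x ^ 3)"
proof -
  obtain K X where KX: "\<And>j x. x \<ge> X j \<Longrightarrow>
      \<bar>ln (poly (touchard j) x / x ^ j) - (A_coeff j / x + E_coeff j / x\<^sup>2)\<bar> \<le> K j / x ^ 3"
    using ln_touchard_expansion by metis
  define K' where "K' = (\<Sum>j\<le>m. \<bar>K j\<bar>)"
  define X' where "X' = 1 + 4 * real m + (\<Sum>j\<le>m. \<bar>X j\<bar>)"
  have X'0: "X' \<ge> 1 + 4 * real m" by (simp add: X'_def sum_nonneg)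
  have "\<bar>ln (poly (touchard j) x / x ^ j) - (A_coeff j / x + E_coeff j / x\<^sup>2)\<bar> \<le> K' / x ^ 3"
    if "j \<le> m" "x \<ge> X'" for j x
  proof -
    have "\<bar>X j\<bar> \<le> (\<Sum>j\<le>m. \<bar>X j\<bar>)" "\<bar>K j\<bar> \<le> K'"
      unfolding K'_def by (rule member_le_sum; use that in auto)+
    then have "x \<ge> X j" "K j \<le> K'" using that by (auto simp: X'_def)
    then show ?thesis using KX[of j x] that X'0 divide_right_mono[of "K j" K' "x ^ 3"] by fastforce
  qed
  moreover have "K' \<ge> 0" by (simp add: K'_def sum_nonneg)
  ultimately show ?thesis using X'0 by (intro exI[of _ K'] exI[of _ X']) auto
qed

lemma sum_le_mixed_size: "(\<Sum>j=1..m. r j) \<le> mixed_size m r"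
  unfolding mixed_size_def by (intro sum_mono) auto

lemma power_mixed_size: "(\<Prod>j=1..m. (x ^ j) ^ r j) = x ^ mixed_size m r"
  by (simp add: mixed_size_def power_sum power_mult)

lemma abs_tprod_le:
  assumes "0 \<le> x" "x \<le> c" "4 * real m \<le> c"
  shows "\<bar>tprod m r x\<bar> \<le> c ^ mixed_size m r"
  unfolding tprod_def abs_prod power_mixed_size[symmetric] power_abs
  using assms by (intro prod_mono conjI power_mono abs_poly_touchard_le) auto

text \<open>The logarithms of the factors are summed with multiplicities, and \<open>mu1\<close>,
  \<open>mu2\<close> are defined so that the sums become mu1 u and mu2 u^2/N. The error is at most N
  K/x^3. The exponent is nonpositive as each factor is at most x^j.\<close>

lemma tprod_log_expansion:
  assumes K: "\<And>j x. j \<le> m \<Longrightarrow> x \<ge> X \<Longrightarrow>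
      \<bar>ln (poly (touchard j) x / x ^ j) - (A_coeff j / x + E_coeff j / x\<^sup>2)\<bar> \<le> K / x ^ 3"
    and X: "X \<ge> 1" "X \<ge> 4 * real m" and x: "x \<ge> X"
    and N: "N = mixed_size m r" "N \<ge> 1" and u: "u = real N / x"
  shows "\<exists>l\<le>0. tprod m r x = x ^ N * exp l \<and>
    \<bar>l - (mu1 m r * u + mu2 m r * u\<^sup>2 / real N)\<bar> \<le> K * u ^ 3 / (real N)\<^sup>2"
proof (intro exI[of _ "\<Sum>j=1..m. real (r j) * ln (poly (touchard j) x / x ^ j)"] conjI)
  let ?t = "\<lambda>j. poly (touchard j) x / x ^ j"
  let ?l = "\<Sum>j=1..m. real (r j) * ln (?t j)"
  have x1: "x \<ge> 1" "x > 0" using X x by auto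
  have "0 \<le> K / x ^ 3" by (rule order_trans[OF abs_ge_zero K[of 0 x]]) (use x in auto)
  then have K0: "K \<ge> 0" using x1 by (simp add: zero_le_divide_iff)
  have t: "?t j > 0" "?t j \<le> 1" if "j \<in> {1..m}" for j
    using that X x x1 poly_touchard_pos[of j x] poly_touchard_le[of j x] by auto
  have "ln (?t j) \<le> 0" if "j \<in> {1..m}" for j using t[OF that] by simp
  then show "?l \<le> 0" by (intro sum_nonpos mult_nonneg_nonpos) auto
  have "tprod m r x = (\<Prod>j=1..m. (x ^ j) ^ r j * ?t j ^ r j)"
    unfolding tprod_def using x1 by (intro prod.cong refl) (simp add: power_divide)
  also have "\<dots> = x ^ N * (\<Prod>j=1..m. ?t j ^ r j)"
    unfolding prod.distrib power_mixed_size N(1) ..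
  also have "(\<Prod>j=1..m. ?t j ^ r j) = exp ?l"
    using t by (simp add: exp_sum exp_of_nat_mult)
  finally show "tprod m r x = x ^ N * exp ?l" .
  have N0: "real N > 0" using N by simp
  have mu: "mu1 m r * u = (\<Sum>j=1..m. real (r j) * (A_coeff j / x))"
    "mu2 m r * u\<^sup>2 / real N = (\<Sum>j=1..m. real (r j) * (E_coeff j / x\<^sup>2))"
    using N0 x1 unfolding u mu1_def mu2_def N(1)[symmetric]
    by (simp_all add: power_divide power2_eq_square sum_divide_distrib[symmetric] field_simps)
  have "\<bar>?l - (mu1 m r * u + mu2 m r * u\<^sup>2 / real N)\<bar> =
      \<bar>\<Sum>j=1..m. real (r j) * (ln (?t j) - (A_coeff j / x + E_coeff j / x\<^sup>2))\<bar>"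
    unfolding mu by (simp add: algebra_simps sum.distrib sum_subtractf)
  also have "\<dots> \<le> (\<Sum>j=1..m. real (r j) * (K / x ^ 3))"
  proof (intro order_trans[OF sum_abs] sum_mono)
    fix j assume "j \<in> {1..m}"
    then show "\<bar>real (r j) * (ln (?t j) - (A_coeff j / x + E_coeff j / x\<^sup>2))\<bar> \<le> real (r j) * (K / x ^ 3)"
      using mult_left_mono[OF K[of j x], of "real (r j)"] x by (simp add: abs_mult)
  qed
  also have "\<dots> = real (\<Sum>j=1..m. r j) * (K / x ^ 3)"
    by (simp only: of_nat_sum sum_distrib_right)
  also have "\<dots> \<le> real N * (K / x ^ 3)"
    using sum_le_mixed_size[of r m] N(1) K0 x1 by (intro mult_right_mono) (auto simp del: of_nat_sum)
  also have "\<dots> = K * u ^ 3 / (real N)\<^sup>2"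
    using N0 x1 by (simp add: u power_divide eval_nat_numeral field_simps)
  finally show "\<bar>?l - (mu1 m r * u + mu2 m r * u\<^sup>2 / real N)\<bar> \<le> K * u ^ 3 / (real N)\<^sup>2" .
qed

text \<open>The expansion of \<open>exp (a u + b u\<^sup>2 / n)\<close> at \<open>u = 1\<close>: to third order in \<open>u - 1\<close> for
  \<open>b = 0\<close>, and to first order in \<open>u - 1\<close> for the part linear in \<open>b / n\<close>. Since \<open>u - 1\<close> has size
  \<open>n\<^sup>-\<^sup>1\<^sup>/\<^sup>2\<close>, the remainder is of order \<open>n\<^sup>-\<^sup>2\<close>.\<close>

definition main_part :: "real \<Rightarrow> real \<Rightarrow> real \<Rightarrow> real \<Rightarrow> real" where
  "main_part a b n u = exp a * (1 + a * (u - 1) + (a * (u - 1))\<^sup>2 / 2 + (a * (u - 1)) ^ 3 / 6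
    + (1 + a * (u - 1)) * (b * u\<^sup>2 / n))"

text \<open>One polynomial in \<open>u\<close>, nonnegative for u >= 0, that majorises all
  remainders and can be integrated by moments. The first two terms come from Taylor truncation, u^3
  from the logarithm, u^4 and u^6 from squared second-order terms, and u^5 serves the range of small
  x.\<close>

definition error_part :: "real \<Rightarrow> real \<Rightarrow> real" where
  "error_part n u = (u - 1) ^ 4 + u\<^sup>2 * (u - 1)\<^sup>2 / n + (u ^ 3 + u ^ 4 + u ^ 5 + u ^ 6) / n\<^sup>2"

lemma error_part_ge:
  assumes "u \<ge> 0" "n > 0"
  shows "(u - 1) ^ 4 \<le> error_part n u" "u\<^sup>2 * (u - 1)\<^sup>2 / n \<le> error_part n u"
    "u ^ 3 / n\<^sup>2 \<le> error_part n u" "u ^ 4 / n\<^sup>2 \<le> error_part n u"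
    "u ^ 5 / n\<^sup>2 \<le> error_part n u" "u ^ 6 / n\<^sup>2 \<le> error_part n u" "0 \<le> error_part n u"
proof -
  have "(u - 1) ^ 4 \<ge> 0" "u\<^sup>2 * (u - 1)\<^sup>2 / n \<ge> 0"
    "u ^ 3 / n\<^sup>2 \<ge> 0" "u ^ 4 / n\<^sup>2 \<ge> 0" "u ^ 5 / n\<^sup>2 \<ge> 0" "u ^ 6 / n\<^sup>2 \<ge> 0"
    using assms by auto
  then show "(u - 1) ^ 4 \<le> error_part n u" "u\<^sup>2 * (u - 1)\<^sup>2 / n \<le> error_part n u"
    "u ^ 3 / n\<^sup>2 \<le> error_part n u" "u ^ 4 / n\<^sup>2 \<le> error_part n u"
    "u ^ 5 / n\<^sup>2 \<le> error_part n u" "u ^ 6 / n\<^sup>2 \<le> error_part n u" "0 \<le> error_part n u"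
    unfolding error_part_def add_divide_distrib by linarith+
qed

text \<open>Four replacements, one for each error bound: exp l is linearised at a u; the correction
  h is replaced by its main term y; exp(a u) is expanded at a to third order; and, in the product
  with y, only to first order.\<close>

lemma main_part_approx:
  assumes n: "n \<ge> 1" and u: "u \<ge> 0" and a: "a \<le> 0" "\<bar>a\<bar> \<le> M" "\<bar>b\<bar> \<le> M" and l: "l \<le> 0"
    and K0: "K \<ge> 0"
    and K: "\<bar>l - (a * u + b * u\<^sup>2 / n)\<bar> \<le> K * u ^ 3 / n\<^sup>2"
  shows "\<bar>exp l - main_part a b n u\<bar> \<le> (M\<^sup>2 + K\<^sup>2 + K + M ^ 4 + M ^ 3) * error_part n u"
proof -
  define d where "d = a * (u - 1)"
  define h where "h = l - a * u"
  define y where "y = b * u\<^sup>2 / n"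
  let ?Q = "error_part n u"
  have M0: "M \<ge> 0" using a by simp
  note Q = error_part_ge[OF u, of n]
  have au: "a * u \<le> 0" using a u by (simp add: mult_nonpos_nonneg)
  have yM: "\<bar>y\<bar> \<le> M * (u\<^sup>2 / n)"
    using a(3) n by (simp add: y_def abs_mult divide_right_mono mult_right_mono)
  have hy: "\<bar>h - y\<bar> \<le> K * (u ^ 3 / n\<^sup>2)" using K by (simp add: h_def y_def)
  have 1: "\<bar>exp l - exp (a * u) * (1 + h)\<bar> \<le> (M\<^sup>2 + K\<^sup>2) * ?Q"
  proof -
    have "\<bar>exp l - exp (a * u) * (1 + h)\<bar> \<le> h\<^sup>2 / 2"
      using exp_Taylor_nonpos[OF au l, of 2] by (simp add: h_def numeral_2_eq_2)
    also have "h\<^sup>2 / 2 \<le> y\<^sup>2 + (h - y)\<^sup>2"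
    proof -
      have "0 \<le> (h - 2 * y)\<^sup>2" by simp
      then show ?thesis by (simp add: power2_eq_square algebra_simps)
    qed
    also have "y\<^sup>2 \<le> M\<^sup>2 * ?Q"
    proof -
      have "y\<^sup>2 \<le> (M * (u\<^sup>2 / n))\<^sup>2" using power_mono[OF yM, of 2] by simp
      also have "\<dots> = M\<^sup>2 * (u ^ 4 / n\<^sup>2)" by (simp add: power_mult_distrib power_divide)
      also have "\<dots> \<le> M\<^sup>2 * ?Q" using Q n by (intro mult_left_mono) auto
      finally show ?thesis .
    qed
    also have "(h - y)\<^sup>2 \<le> K\<^sup>2 * ?Q"
    proof -
      have "(h - y)\<^sup>2 \<le> (K * (u ^ 3 / n\<^sup>2))\<^sup>2" using power_mono[OF hy, of 2] by simp
      also have "\<dots> = K\<^sup>2 * (u ^ 6 / n ^ 4)" by (simp add: power_mult_distrib power_divide)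
      also have "\<dots> \<le> K\<^sup>2 * (u ^ 6 / n\<^sup>2)"
        using n u by (intro mult_left_mono divide_left_mono power_increasing) auto
      also have "\<dots> \<le> K\<^sup>2 * ?Q" using Q n by (intro mult_left_mono) auto
      finally show ?thesis .
    qed
    finally show ?thesis by (simp add: algebra_simps)
  qed
  have 2: "\<bar>exp (a * u) * (1 + h) - exp (a * u) * (1 + y)\<bar> \<le> K * ?Q"
  proof -
    have "exp (a * u) * (1 + h) - exp (a * u) * (1 + y) = exp (a * u) * (h - y)"
      by (simp add: algebra_simps)
    then have "\<bar>exp (a * u) * (1 + h) - exp (a * u) * (1 + y)\<bar> = exp (a * u) * \<bar>h - y\<bar>"
      by (simp add: abs_mult)
    also have "\<dots> \<le> 1 * \<bar>h - y\<bar>" using au by (intro mult_right_mono) auto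
    also have "\<dots> \<le> K * (u ^ 3 / n\<^sup>2)" using hy by simp
    also have "\<dots> \<le> K * ?Q" using K0 Q n by (intro mult_left_mono) auto
    finally show ?thesis .
  qed
  have d: "a * u - a = d" by (simp add: d_def algebra_simps)
  have dM: "\<bar>d\<bar> \<le> M * \<bar>u - 1\<bar>" using a(2) by (simp add: d_def abs_mult mult_right_mono)
  have 3: "\<bar>exp (a * u) - exp a * (1 + d + d\<^sup>2 / 2 + d ^ 3 / 6)\<bar> \<le> M ^ 4 * ?Q"
  proof -
    have "\<bar>exp (a * u) - exp a * (1 + d + d\<^sup>2 / 2 + d ^ 3 / 6)\<bar> \<le> \<bar>d\<bar> ^ 4 / 24"
      using exp_Taylor_nonpos[OF a(1) au, of 4] by (simp add: d eval_nat_numeral)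
    also have "\<dots> \<le> \<bar>d\<bar> ^ 4" by simp
    also have "\<dots> \<le> (M * \<bar>u - 1\<bar>) ^ 4" using dM by (intro power_mono) auto
    also have "\<dots> = M ^ 4 * (u - 1) ^ 4" by (simp add: power_mult_distrib)
    also have "\<dots> \<le> M ^ 4 * ?Q" using Q n M0 by (intro mult_left_mono) auto
    finally show ?thesis .
  qed
  have 4: "\<bar>exp (a * u) * y - exp a * (1 + d) * y\<bar> \<le> M ^ 3 * ?Q"
  proof -
    have "\<bar>exp (a * u) - exp a * (1 + d)\<bar> \<le> d\<^sup>2 / 2"
      using exp_Taylor_nonpos[OF a(1) au, of 2] by (simp add: d numeral_2_eq_2)
    also have "\<dots> \<le> d\<^sup>2" by simp
    also have "\<dots> \<le> (M * \<bar>u - 1\<bar>)\<^sup>2" using power_mono[OF dM, of 2] by simp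
    finally have "\<bar>exp (a * u) - exp a * (1 + d)\<bar> \<le> M\<^sup>2 * (u - 1)\<^sup>2" by (simp add: power_mult_distrib)
    then have "\<bar>exp (a * u) - exp a * (1 + d)\<bar> * \<bar>y\<bar> \<le> M\<^sup>2 * (u - 1)\<^sup>2 * (M * (u\<^sup>2 / n))"
      using yM M0 by (intro mult_mono) auto
    also have "\<dots> = M ^ 3 * (u\<^sup>2 * (u - 1)\<^sup>2 / n)" by (simp add: power3_eq_cube power2_eq_square)
    also have "\<dots> \<le> M ^ 3 * ?Q" using Q n M0 by (intro mult_left_mono) auto
    finally show ?thesis by (simp add: abs_mult[symmetric] left_diff_distrib)
  qed
  have "exp l - main_part a b n u = (exp l - exp (a * u) * (1 + h))
      + (exp (a * u) * (1 + h) - exp (a * u) * (1 + y))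
      + (exp (a * u) - exp a * (1 + d + d\<^sup>2 / 2 + d ^ 3 / 6))
      + (exp (a * u) * y - exp a * (1 + d) * y)"
    unfolding main_part_def d_def[symmetric] y_def[symmetric] by (simp add: algebra_simps)
  also have "\<bar>\<dots>\<bar> \<le> (M\<^sup>2 + K\<^sup>2) * ?Q + K * ?Q + M ^ 4 * ?Q + M ^ 3 * ?Q"
    using 1 2 3 4 by linarith
  finally show ?thesis by (simp add: algebra_simps)
qed

text \<open>A crude bound for small x, that is large u, where the main part approximates nothing and
  only has to be negligible.\<close>

lemma abs_main_part_le:
  assumes n: "n \<ge> 1" and u: "u \<ge> 1" and a: "a \<le> 0" "\<bar>a\<bar> \<le> M" "\<bar>b\<bar> \<le> M"
  shows "\<bar>main_part a b n u\<bar> \<le> (1 + 2 * M + 2 * M\<^sup>2 + M ^ 3) * u ^ 3"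
proof -
  define d where "d = a * (u - 1)"
  define y where "y = b * u\<^sup>2 / n"
  have M0: "M \<ge> 0" using a by simp
  have u3: "1 \<le> u ^ 3" "u \<le> u ^ 3" "u\<^sup>2 \<le> u ^ 3"
    using u power_increasing[of 1 3 u] power_increasing[of 2 3 u] by auto
  have "\<bar>d\<bar> \<le> M * u" using a(2) u by (auto simp: d_def abs_mult intro!: mult_mono)
  then have d: "\<bar>d\<bar> \<le> M * u" "d\<^sup>2 \<le> M\<^sup>2 * u\<^sup>2" "\<bar>d\<bar> ^ 3 \<le> M ^ 3 * u ^ 3"
    using abs_le_square_iff[of d "M * u"] power_mono[of "\<bar>d\<bar>" "M * u" 3] M0 u
    by (auto simp: power_mult_distrib abs_mult)
  have y: "\<bar>y\<bar> \<le> M * u\<^sup>2"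
  proof -
    have "\<bar>y\<bar> = \<bar>b\<bar> * u\<^sup>2 / n" using n by (simp add: y_def abs_mult)
    also have "\<dots> \<le> \<bar>b\<bar> * u\<^sup>2 / 1" using n by (intro divide_left_mono) auto
    also have "\<dots> \<le> M * u\<^sup>2" using a(3) by (simp add: mult_right_mono)
    finally show ?thesis .
  qed
  have "\<bar>1 + d + d\<^sup>2 / 2 + d ^ 3 / 6 + (1 + d) * y\<bar> \<le> 1 + \<bar>d\<bar> + d\<^sup>2 + \<bar>d\<bar> ^ 3 + (\<bar>y\<bar> + \<bar>d\<bar> * \<bar>y\<bar>)"
  proof -
    have "\<bar>(1 + d) * y\<bar> \<le> \<bar>y\<bar> + \<bar>d\<bar> * \<bar>y\<bar>"
      using abs_triangle_ineq[of y "d * y"] by (simp add: abs_mult algebra_simps)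
    moreover have "\<bar>d ^ 3\<bar> = \<bar>d\<bar> ^ 3" by (simp add: power_abs)
    ultimately show ?thesis using zero_le_power2[of d] by linarith
  qed
  also have "\<bar>d\<bar> * \<bar>y\<bar> \<le> M * u * (M * u\<^sup>2)" using d y M0 u by (intro mult_mono) auto
  also have "\<dots> = M\<^sup>2 * u ^ 3" by (simp add: power3_eq_cube power2_eq_square)
  finally have "\<bar>1 + d + d\<^sup>2 / 2 + d ^ 3 / 6 + (1 + d) * y\<bar> \<le>
      1 + M * u + M\<^sup>2 * u\<^sup>2 + M ^ 3 * u ^ 3 + (M * u\<^sup>2 + M\<^sup>2 * u ^ 3)"
    using d y by linarith
  also have "\<dots> \<le> u ^ 3 + M * u ^ 3 + M\<^sup>2 * u ^ 3 + M ^ 3 * u ^ 3 + (M * u ^ 3 + M\<^sup>2 * u ^ 3)"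
    using u3 M0 by (intro add_mono mult_left_mono) auto
  also have "\<dots> = (1 + 2 * M + 2 * M\<^sup>2 + M ^ 3) * u ^ 3" by (simp add: algebra_simps)
  finally have *: "\<bar>1 + d + d\<^sup>2 / 2 + d ^ 3 / 6 + (1 + d) * y\<bar> \<le> (1 + 2 * M + 2 * M\<^sup>2 + M ^ 3) * u ^ 3" .
  have "\<bar>main_part a b n u\<bar> = exp a * \<bar>1 + d + d\<^sup>2 / 2 + d ^ 3 / 6 + (1 + d) * y\<bar>"
    by (simp add: main_part_def abs_mult d_def y_def)
  also have "\<dots> \<le> 1 * \<bar>1 + d + d\<^sup>2 / 2 + d ^ 3 / 6 + (1 + d) * y\<bar>"
    using a(1) by (intro mult_right_mono) auto
  finally show ?thesis using * by simp
qed


text \<open>Coefficients in powers of u, padded with zeros to degree 6 so that main part and error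
  part share one moment formula.\<close>

definition main_coeff :: "real \<Rightarrow> real \<Rightarrow> real \<Rightarrow> nat \<Rightarrow> real" where
  "main_coeff a b n k = exp a * [1 - a + a\<^sup>2 / 2 - a ^ 3 / 6, a - a\<^sup>2 + a ^ 3 / 2,
    a\<^sup>2 / 2 - a ^ 3 / 2 + (1 - a) * b / n, a ^ 3 / 6 + a * b / n, 0, 0, 0] ! k"

definition error_coeff :: "real \<Rightarrow> nat \<Rightarrow> real" where
  "error_coeff n k = [1, - 4, 6 + 1 / n, - 4 - 2 / n + 1 / n\<^sup>2, 1 + 1 / n + 1 / n\<^sup>2, 1 / n\<^sup>2, 1 / n\<^sup>2] ! k"

lemma sum_atMost_6:
  fixes f :: "nat \<Rightarrow> real"
  shows "(\<Sum>k\<le>6. f k) = f 0 + f 1 + f 2 + f 3 + f 4 + f 5 + f 6"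
  by (simp add: eval_nat_numeral)

lemma main_part_eq_sum: "main_part a b n u = (\<Sum>k\<le>6. main_coeff a b n k * u ^ k)"
  unfolding sum_atMost_6 main_part_def main_coeff_def
  by (simp add: power2_eq_square power3_eq_cube diff_divide_distrib add_divide_distrib algebra_simps)

lemma error_part_eq_sum: "error_part n u = (\<Sum>k\<le>6. error_coeff n k * u ^ k)"
  unfolding sum_atMost_6 error_part_def error_coeff_def
  by (simp add: eval_nat_numeral diff_divide_distrib add_divide_distrib algebra_simps)

lemma has_integral_inv_moment:
  assumes "real n + s > real k"
  shows "((\<lambda>x. x powr (real n + s - 1) * exp (- x) * (real n / x) ^ k) has_integral
    Gamma (real n + s) * inv_moment s k n) {0..}"
proof -
  have G: "Gamma (real n + s) > 0" using assms by (intro Gamma_real_pos) simp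
  have "((\<lambda>x. real n ^ k * (x powr (real n + s - real k - 1) / exp x)) has_integral
      real n ^ k * Gamma (real n + s - real k)) {0..}"
    using assms by (intro has_integral_mult_right Gamma_integral_real) simp
  also have "real n ^ k * Gamma (real n + s - real k) = Gamma (real n + s) * inv_moment s k n"
    using G by (simp add: inv_moment_def)
  finally show ?thesis
  proof (rule has_integral_eq[rotated])
    fix x :: real assume x: "x \<in> {0..}"
    show "real n ^ k * (x powr (real n + s - real k - 1) / exp x) =
        x powr (real n + s - 1) * exp (- x) * (real n / x) ^ k"
    proof (cases "x = 0")
      case False
      then have "x powr (real n + s - 1) = x powr (real n + s - real k - 1) * x ^ k"
        using x powr_add[of x "real n + s - real k - 1" "real k"] by (simp add: powr_realpow algebra_simps)
      then show ?thesis using False by (simp add: exp_minus power_divide field_simps)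
    qed simp
  qed
qed

lemma has_integral_sum_inv_moment:
  assumes "real n + s > 6"
  shows "((\<lambda>x. x powr (real n + s - 1) * exp (- x) * (\<Sum>k\<le>6. c k * (real n / x) ^ k)) has_integral
    Gamma (real n + s) * (\<Sum>k\<le>6. c k * inv_moment s k n)) {0..}"
proof -
  have "((\<lambda>x. \<Sum>k\<le>6. c k * (x powr (real n + s - 1) * exp (- x) * (real n / x) ^ k)) has_integral
      (\<Sum>k\<le>6. c k * (Gamma (real n + s) * inv_moment s k n))) {0..}"
    using assms by (intro has_integral_sum has_integral_mult_right has_integral_inv_moment) auto
  then show ?thesis by (simp add: sum_distrib_left mult_ac)
qed

lemma inv_moment_uniform:
  assumes "s > 0"
  shows "\<exists>D\<ge>0. \<forall>k\<le>6. \<forall>n\<ge>1.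
    \<bar>inv_moment s k n - (1 + (real k * (real k + 1) / 2 - real k * s) / real n)\<bar> \<le> D / (real n)\<^sup>2"
proof -
  obtain D where D: "\<And>k. D k \<ge> 0" "\<And>k n. n \<ge> 1 \<Longrightarrow>
      \<bar>inv_moment s k n - (1 + (real k * (real k + 1) / 2 - real k * s) / real n)\<bar> \<le> D k / (real n)\<^sup>2"
    using bigo_inverse_power_bound[OF inv_moment_expansion[OF assms]] by metis
  have "\<bar>inv_moment s k n - (1 + (real k * (real k + 1) / 2 - real k * s) / real n)\<bar>
      \<le> (\<Sum>k\<le>6. D k) / (real n)\<^sup>2" if "k \<le> 6" "n \<ge> 1" for k n
  proof -
    have "D k \<le> (\<Sum>k\<le>6. D k)" by (rule member_le_sum) (use that D in auto)
    then have "D k / (real n)\<^sup>2 \<le> (\<Sum>k\<le>6. D k) / (real n)\<^sup>2" by (rule divide_right_mono) simp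
    then show ?thesis using D(2)[OF that(2), of k] by linarith
  qed
  then show ?thesis using D(1) by (intro exI[of _ "\<Sum>k\<le>6. D k"]) (auto intro: sum_nonneg)
qed

text \<open>From the moments of u, the mean of u - 1 is (1 - s)/n, that of its square is 1/n, and
  that of its cube vanishes to this order. They produce (1 - s) a and a^2/2, and the term b u^2/n
  contributes b. The bounds depend on a, b through M alone.\<close>

lemma main_moment:
  assumes s: "s > 0" and M: "M \<ge> 0"
  shows "\<exists>K\<ge>0. \<forall>n\<ge>1. \<forall>a b. a \<le> 0 \<longrightarrow> \<bar>a\<bar> \<le> M \<longrightarrow> \<bar>b\<bar> \<le> M \<longrightarrow>
    \<bar>(\<Sum>k\<le>6. main_coeff a b (real n) k * inv_moment s k n) -
      exp a * (1 + ((1 - s) * a + a\<^sup>2 / 2 + b) / real n)\<bar> \<le> K / (real n)\<^sup>2"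
proof -
  obtain D where D: "D \<ge> 0" "\<And>k n. k \<le> 6 \<Longrightarrow> n \<ge> 1 \<Longrightarrow>
      \<bar>inv_moment s k n - (1 + (real k * (real k + 1) / 2 - real k * s) / real n)\<bar> \<le> D / (real n)\<^sup>2"
    using inv_moment_uniform[OF s] by blast
  define L where "L = M + M\<^sup>2 + M ^ 3"
  define K where "K = L * D + L * D + L * D + M * ((1 + M) * (3 + 2 * s + D) + M * (6 + 3 * s + D))"
  have L0: "L \<ge> 0" using M by (simp add: L_def)
  show ?thesis
  proof (intro exI[of _ K] conjI allI impI)
    show "K \<ge> 0" using M L0 D(1) s by (simp add: K_def)
    fix n :: nat and a b :: real assume n: "n \<ge> 1" and a: "a \<le> 0" "\<bar>a\<bar> \<le> M" "\<bar>b\<bar> \<le> M"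
    define t where "t = 1 / real n"
    define e where "e k = inv_moment s k n - (1 + (real k * (real k + 1) / 2 - real k * s) / real n)" for k
    have t: "0 < t" "t \<le> 1" using n by (auto simp: t_def)
    have e: "\<bar>e k\<bar> \<le> D * t\<^sup>2" if "k \<le> 6" for k
      using D(2)[OF that n] by (simp add: e_def t_def power_divide)
    have "Gamma (real n + s) > 0" using s by (intro Gamma_real_pos) simp
    then have g: "Gamma (real n + s) \<noteq> 0" by simp
    have m: "inv_moment s 0 n = 1" "inv_moment s 1 n = 1 + (1 - s) * t + e 1"
      "inv_moment s 2 n = 1 + (3 - 2 * s) * t + e 2" "inv_moment s 3 n = 1 + (6 - 3 * s) * t + e 3"
      using g by (simp_all add: e_def t_def inv_moment_def[of s 0]) 
    define c1 c2 c3 where "c1 = a - a\<^sup>2 + a ^ 3 / 2" and "c2 = a\<^sup>2 / 2 - a ^ 3 / 2" and "c3 = a ^ 3 / 6"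
    have a23: "a\<^sup>2 \<le> M\<^sup>2" "\<bar>a ^ 3\<bar> \<le> M ^ 3"
      using a power_mono[OF a(2), of 2] power_mono[OF a(2), of 3] by (auto simp: power_abs)
    have c: "\<bar>c1\<bar> \<le> L" "\<bar>c2\<bar> \<le> L" "\<bar>c3\<bar> \<le> L"
      using a a23 M zero_le_power2[of a] zero_le_power2[of M] zero_le_power[OF M, of 3] abs_ge_self[of "a^3"] abs_ge_minus_self[of "a^3"]
      unfolding c1_def c2_def c3_def L_def by linarith+
    have e2: "\<bar>(3 - 2 * s) * t + e 2\<bar> \<le> (3 + 2 * s + D) * t" "\<bar>(6 - 3 * s) * t + e 3\<bar> \<le> (6 + 3 * s + D) * t"
    proof -
      have "D * t\<^sup>2 \<le> D * t" using D(1) t by (intro mult_left_mono) (auto simp: power2_eq_square mult_left_le)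
      then have "\<bar>e 2\<bar> \<le> D * t" "\<bar>e 3\<bar> \<le> D * t" using e[of 2] e[of 3] by auto
      moreover have "\<bar>(3 - 2 * s) * t\<bar> \<le> (3 + 2 * s) * t" "\<bar>(6 - 3 * s) * t\<bar> \<le> (6 + 3 * s) * t"
        using s t by (auto simp: abs_mult intro!: mult_right_mono)
      ultimately show "\<bar>(3 - 2 * s) * t + e 2\<bar> \<le> (3 + 2 * s + D) * t" "\<bar>(6 - 3 * s) * t + e 3\<bar> \<le> (6 + 3 * s + D) * t"
        by (auto simp: distrib_right)
    qed
    let ?r = "b * t * ((1 - a) * ((3 - 2 * s) * t + e 2) + a * ((6 - 3 * s) * t + e 3))"
    have "(\<Sum>k\<le>6. main_coeff a b (real n) k * inv_moment s k n) -
        exp a * (1 + ((1 - s) * a + a\<^sup>2 / 2 + b) / real n) = exp a * (c1 * e 1 + c2 * e 2 + c3 * e 3 + ?r)"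
    proof -
      have bt: "b / real n = b * t" "x / real n = x * t" for x by (simp_all add: t_def)
      show ?thesis
        unfolding sum_atMost_6 main_coeff_def m bt
        by (simp add: c1_def c2_def c3_def m[unfolded One_nat_def] bt field_simps power2_eq_square power3_eq_cube)
    qed
    also have "\<bar>\<dots>\<bar> \<le> 1 * \<bar>c1 * e 1 + c2 * e 2 + c3 * e 3 + ?r\<bar>"
      unfolding abs_mult using a(1) by (intro mult_right_mono) auto
    also have "\<dots> \<le> \<bar>c1 * e 1\<bar> + \<bar>c2 * e 2\<bar> + \<bar>c3 * e 3\<bar> + \<bar>?r\<bar>"
    proof -
      have "\<bar>p + q + v + w\<bar> \<le> \<bar>p\<bar> + \<bar>q\<bar> + \<bar>v\<bar> + \<bar>w\<bar>" for p q v w :: real by linarith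
      then show ?thesis unfolding mult_1_left .
    qed
    also have "\<dots> \<le> L * (D * t\<^sup>2) + L * (D * t\<^sup>2) + L * (D * t\<^sup>2) +
        M * t * ((1 + M) * ((3 + 2 * s + D) * t) + M * ((6 + 3 * s + D) * t))"
    proof (intro add_mono)
      show "\<bar>c1 * e 1\<bar> \<le> L * (D * t\<^sup>2)" "\<bar>c2 * e 2\<bar> \<le> L * (D * t\<^sup>2)" "\<bar>c3 * e 3\<bar> \<le> L * (D * t\<^sup>2)"
        unfolding abs_mult using c e[of 1] e[of 2] e[of 3] L0 by (auto intro!: mult_mono)
      have "\<bar>(1 - a) * ((3 - 2 * s) * t + e 2)\<bar> \<le> (1 + M) * ((3 + 2 * s + D) * t)"
        "\<bar>a * ((6 - 3 * s) * t + e 3)\<bar> \<le> M * ((6 + 3 * s + D) * t)"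
      proof -
        have "\<bar>1 - a\<bar> \<le> 1 + M" "0 \<le> 1 + M" using a M by auto
        then show "\<bar>(1 - a) * ((3 - 2 * s) * t + e 2)\<bar> \<le> (1 + M) * ((3 + 2 * s + D) * t)"
          unfolding abs_mult by (intro mult_mono e2 abs_ge_zero)
        show "\<bar>a * ((6 - 3 * s) * t + e 3)\<bar> \<le> M * ((6 + 3 * s + D) * t)"
          unfolding abs_mult by (intro mult_mono e2 abs_ge_zero a M)
      qed
      then have "\<bar>(1 - a) * ((3 - 2 * s) * t + e 2) + a * ((6 - 3 * s) * t + e 3)\<bar> \<le>
          (1 + M) * ((3 + 2 * s + D) * t) + M * ((6 + 3 * s + D) * t)" by linarith
      moreover have "\<bar>b * t\<bar> \<le> M * t" using a(3) t by (simp add: abs_mult mult_right_mono)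
      ultimately show "\<bar>?r\<bar> \<le> M * t * ((1 + M) * ((3 + 2 * s + D) * t) + M * ((6 + 3 * s + D) * t))"
        unfolding abs_mult[of "b * t"] using M t by (intro mult_mono) auto
    qed
    also have "\<dots> = K * t\<^sup>2" by (simp add: K_def power2_eq_square algebra_simps)
    finally show "\<bar>(\<Sum>k\<le>6. main_coeff a b (real n) k * inv_moment s k n) -
        exp a * (1 + ((1 - s) * a + a\<^sup>2 / 2 + b) / real n)\<bar> \<le> K / (real n)\<^sup>2"
      by (simp add: t_def power_divide)
  qed
qed

text \<open>The 1/n coefficient of the k-th moment is quadratic in k, so its fourth difference
  vanishes and (u - 1)^4 has mean O(n^-2). The second difference makes u^2 (u - 1)^2 of order 1/n,
  which the extra factor 1/n completes.\<close>

lemma error_moment: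
  assumes s: "s > 0"
  shows "\<exists>K\<ge>0. \<forall>n\<ge>1. \<bar>\<Sum>k\<le>6. error_coeff (real n) k * inv_moment s k n\<bar> \<le> K / (real n)\<^sup>2"
proof -
  obtain D where D: "D \<ge> 0" "\<And>k n. k \<le> 6 \<Longrightarrow> n \<ge> 1 \<Longrightarrow>
      \<bar>inv_moment s k n - (1 + (real k * (real k + 1) / 2 - real k * s) / real n)\<bar> \<le> D / (real n)\<^sup>2"
    using inv_moment_uniform[OF s] by blast
  \<comment> \<open>15 = 1 + 4 + 6 + 4 and 4 = 1 + 2 + 1 are sums of absolute binomial coefficients;
    22 = 1 + 6 * 7 / 2 bounds the s-free part of a moment of order at most 6.\<close>
  define K where "K = 15 * D + (1 + 4 * D) + 4 * (22 + 6 * s + D)"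
  show ?thesis
  proof (intro exI[of _ K] conjI allI impI)
    show "K \<ge> 0" using D(1) s by (simp add: K_def)
    fix n :: nat assume n: "n \<ge> 1"
    define t where "t = 1 / real n"
    define e where "e k = inv_moment s k n - (1 + (real k * (real k + 1) / 2 - real k * s) / real n)" for k
    have t: "0 < t" "t \<le> 1" using n by (auto simp: t_def)
    have e: "\<bar>e k\<bar> \<le> D * t\<^sup>2" if "k \<le> 6" for k
      using D(2)[OF that n] by (simp add: e_def t_def power_divide)
    have tt: "D * t\<^sup>2 \<le> D * t" using D(1) t by (intro mult_left_mono) (auto simp: power2_eq_square mult_left_le)
    have tD: "D * t \<le> D" using D(1) t by (simp add: mult_left_le)
    have "Gamma (real n + s) > 0" using s by (intro Gamma_real_pos) simp
    then have g: "Gamma (real n + s) \<noteq> 0" by simp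
    have m: "inv_moment s 0 n = 1" "inv_moment s 1 n = 1 + (1 - s) * t + e 1"
      "inv_moment s 2 n = 1 + (3 - 2 * s) * t + e 2" "inv_moment s 3 n = 1 + (6 - 3 * s) * t + e 3"
      "inv_moment s 4 n = 1 + (10 - 4 * s) * t + e 4"
      using g by (simp_all add: e_def t_def inv_moment_def[of s 0])
    let ?S = "inv_moment s 3 n + inv_moment s 4 n + inv_moment s 5 n + inv_moment s 6 n"
    have M: "\<bar>inv_moment s k n\<bar> \<le> 22 + 6 * s + D" if k: "k \<le> 6" for k
    proof -
      define c where "c = real k * (real k + 1) / 2 - real k * s"
      have "real k * (real k + 1) \<le> 6 * (6 + 1)" "real k * s \<le> 6 * s"
        using k s by (intro mult_mono; simp)+
      moreover have "real k * (real k + 1) \<ge> 0" "real k * s \<ge> 0" using s by auto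
      moreover have "\<bar>p / 2 - q\<bar> \<le> 21 + 6 * s"
        if "p \<le> 6 * (6 + 1)" "q \<le> 6 * s" "p \<ge> 0" "q \<ge> 0" for p q :: real
        by (rule abs_leI) (use that s in auto)
      ultimately have "\<bar>c\<bar> \<le> 21 + 6 * s" unfolding c_def by blast
      moreover have "\<bar>c * t\<bar> \<le> \<bar>c\<bar>" using t by (simp add: abs_mult mult_left_le)
      moreover have "inv_moment s k n = 1 + c * t + e k" by (simp add: e_def c_def t_def)
      ultimately show ?thesis using e[OF k] tt tD by linarith
    qed
    have eq: "(\<Sum>k\<le>6. error_coeff (real n) k * inv_moment s k n) =
        (e 4 - 4 * e 3 + 6 * e 2 - 4 * e 1) + t * (t + (e 4 - 2 * e 3 + e 2)) + t\<^sup>2 * ?S"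
    proof -
      have bt: "1 / real n = t" "2 / real n = 2 * t" "1 / (real n)\<^sup>2 = t\<^sup>2" by (simp_all add: t_def power_divide)
      show ?thesis
        unfolding sum_atMost_6 error_coeff_def bt
        by (simp add: m[unfolded One_nat_def] algebra_simps power2_eq_square)
    qed
    have "\<bar>(e 4 - 4 * e 3 + 6 * e 2 - 4 * e 1) + t * (t + (e 4 - 2 * e 3 + e 2)) + t\<^sup>2 * ?S\<bar> \<le> 15 * (D * t\<^sup>2) + t * (t + 4 * (D * t)) + t\<^sup>2 * (4 * (22 + 6 * s + D))"
    proof -
      have b: "e k \<le> D * t\<^sup>2" "- e k \<le> D * t\<^sup>2" if "k \<le> 6" for k
        using e[OF that] by (simp_all only: abs_le_iff)
      have b4: "e 1 \<le> D * t\<^sup>2" "- e 1 \<le> D * t\<^sup>2" "e 2 \<le> D * t\<^sup>2" "- e 2 \<le> D * t\<^sup>2"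
        "e 3 \<le> D * t\<^sup>2" "- e 3 \<le> D * t\<^sup>2" "e 4 \<le> D * t\<^sup>2" "- e 4 \<le> D * t\<^sup>2"
        by (simp_all only: b numeral_le_iff one_le_numeral semiring_norm)
      have 1: "\<bar>e 4 - 4 * e 3 + 6 * e 2 - 4 * e 1\<bar> \<le> 15 * (D * t\<^sup>2)"
        by (rule abs_leI) (use b4 in linarith)+
      have "\<bar>t + (e 4 - 2 * e 3 + e 2)\<bar> \<le> t + 4 * (D * t)"
        by (rule abs_leI) (use b4 tt t in linarith)+
      then have 2: "\<bar>t * (t + (e 4 - 2 * e 3 + e 2))\<bar> \<le> t * (t + 4 * (D * t))"
        unfolding abs_mult using t by (intro mult_mono) auto
      have tri: "\<bar>p + q + v + w\<bar> \<le> \<bar>p\<bar> + \<bar>q\<bar> + \<bar>v\<bar> + \<bar>w\<bar>" for p q v w :: real by linarith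
      have M4: "\<bar>inv_moment s 3 n\<bar> + \<bar>inv_moment s 4 n\<bar> + \<bar>inv_moment s 5 n\<bar> + \<bar>inv_moment s 6 n\<bar>
          \<le> (22 + 6 * s + D) + (22 + 6 * s + D) + (22 + 6 * s + D) + (22 + 6 * s + D)"
        by (rule add_mono[OF add_mono[OF add_mono[OF M M] M] M]) simp_all
      have "\<bar>?S\<bar> \<le> 4 * (22 + 6 * s + D)"
        using order_trans[OF tri M4] by (rule order_trans) simp
      then have 3: "\<bar>t\<^sup>2 * ?S\<bar> \<le> t\<^sup>2 * (4 * (22 + 6 * s + D))"
        unfolding abs_mult by (intro mult_mono) auto
      show ?thesis
        by (rule order_trans[OF abs_triangle_ineq add_mono[OF order_trans[OF abs_triangle_ineq add_mono[OF 1 2]] 3]])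
    qed
    moreover have "15 * (D * t\<^sup>2) + t * (t + 4 * (D * t)) + t\<^sup>2 * (4 * (22 + 6 * s + D)) = K * t\<^sup>2"
      unfolding K_def by algebra
    ultimately show "\<bar>\<Sum>k\<le>6. error_coeff (real n) k * inv_moment s k n\<bar> \<le> K / (real n)\<^sup>2"
      unfolding eq by (simp add: t_def power_divide)
  qed
qed

lemma power_over_fact_le_exp:
  fixes x :: real
  assumes "x \<ge> 0"
  shows "x ^ n / fact n \<le> exp x"
proof -
  have "(\<Sum>k\<in>{n}. x ^ k /\<^sub>R fact k) \<le> (\<Sum>k. x ^ k /\<^sub>R fact k)"
    using assms summable_exp_generic[of x] by (intro sum_le_suminf) auto
  then show ?thesis by (simp add: exp_def divide_inverse mult.commute)
qed

text \<open>Gamma(n + s) grows like n! n^(s-1), while n^2 costs at most a factor of order e^n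
  n^(s-1), and (eX)^n / n! is bounded by exp(eX).\<close>

lemma power_le_Gamma:
  assumes s: "s > 0" and X: "X \<ge> 1"
  shows "\<exists>K\<ge>0. \<forall>n\<ge>1. X ^ n \<le> K * Gamma (real n + s) / (real n)\<^sup>2"
proof -
  define f where "f n = X ^ n * (real n)\<^sup>2 / Gamma (real n + s)" for n
  have "\<forall>\<^sub>F n in sequentially. Gamma (real n + s) / (fact n * real n powr (s - 1)) > 1 / 2"
    using Gamma_fact_ratio_tendsto[OF s] by (rule order_tendstoD) simp
  then have "\<forall>\<^sub>F n in sequentially. norm (f n) \<le> (12 * exp (exp 1 * X)) * norm (1 / real n ^ 0)"
    using eventually_ge_at_top[of 1]
  proof eventually_elim
    case (elim n)
    have n: "real n \<ge> 1" using elim by simp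
    have G: "fact n * real n powr (s - 1) \<le> 2 * Gamma (real n + s)"
      using elim n by (simp add: field_simps)
    have G0: "Gamma (real n + s) > 0" using s by (intro Gamma_real_pos) simp
    have "(real n)\<^sup>2 = real n powr (s - 1) * real n powr (3 - s)"
      using n by (simp flip: powr_add powr_numeral)
    also have "\<dots> \<le> real n powr (s - 1) * real n powr 3"
      using n s by (intro mult_left_mono powr_mono) auto
    also have "real n powr 3 = real n ^ 3" using n by simp
    also have "real n ^ 3 \<le> 6 * exp (real n)"
      using power_over_fact_le_exp[of "real n" 3] by (simp add: eval_nat_numeral)
    finally have "(real n)\<^sup>2 \<le> real n powr (s - 1) * (6 * exp (real n))" using n by simp
    then have "X ^ n * (real n)\<^sup>2 \<le> X ^ n * (real n powr (s - 1) * (6 * exp (real n)))"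
      using X by (intro mult_left_mono) auto
    also have "\<dots> = 6 * ((exp 1 * X) ^ n / fact n) * (fact n * real n powr (s - 1))"
      by (simp add: power_mult_distrib flip: exp_of_nat_mult)
    also have "\<dots> \<le> 6 * exp (exp 1 * X) * (2 * Gamma (real n + s))"
    proof (rule mult_mono)
      show "6 * ((exp 1 * X) ^ n / fact n) \<le> 6 * exp (exp 1 * X)"
        using power_over_fact_le_exp[of "exp 1 * X" n] X by simp
    qed (use G X in auto)
    finally have "f n \<le> 12 * exp (exp 1 * X)" using G0 by (simp add: f_def divide_le_eq)
    moreover have "f n \<ge> 0" using X G0 by (simp add: f_def)
    ultimately show ?case by simp
  qed
  then have "f \<in> O(\<lambda>n. 1 / real n ^ 0)" by (rule bigoI)
  then obtain K where K: "K \<ge> 0" "\<And>n. n \<ge> 1 \<Longrightarrow> \<bar>f n\<bar> \<le> K"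
    using bigo_inverse_power_bound[of f 0] by auto
  have "X ^ n \<le> K * Gamma (real n + s) / (real n)\<^sup>2" if "n \<ge> 1" for n
  proof -
    have "Gamma (real n + s) > 0" using s by (intro Gamma_real_pos) simp
    moreover have "f n \<le> K" using K(2)[OF that] by simp
    ultimately show ?thesis using that by (simp add: f_def field_simps)
  qed
  then show ?thesis using K(1) by blast
qed

text \<open>The weights r_j/N add up to at most 1, so both quantities are bounded in terms of
  \<open>m\<close> only. This is why the final constants do not depend on \<open>r\<close>.\<close>

lemma mu_bounds:
  assumes "mixed_size m r \<ge> 1"
  defines "M \<equiv> \<Sum>j=1..m. \<bar>A_coeff j\<bar> + \<bar>E_coeff j\<bar>"
  shows "mu1 m r \<le> 0" "\<bar>mu1 m r\<bar> \<le> M" "\<bar>mu2 m r\<bar> \<le> M"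
proof -
  let ?N = "real (mixed_size m r)"
  have N: "?N > 0" using assms by simp
  have M: "\<bar>A_coeff j\<bar> + \<bar>E_coeff j\<bar> \<le> M" if "j \<in> {1..m}" for j
    unfolding M_def by (rule member_le_sum[of j _ "\<lambda>j. \<bar>A_coeff j\<bar> + \<bar>E_coeff j\<bar>"]) (use that in auto)
  have M0: "M \<ge> 0" by (simp add: M_def sum_nonneg)
  have *: "\<bar>(\<Sum>j=1..m. real (r j) * c j) / ?N\<bar> \<le> M" if "\<And>j. j \<in> {1..m} \<Longrightarrow> \<bar>c j\<bar> \<le> M" for c
  proof -
    have "\<bar>\<Sum>j=1..m. real (r j) * c j\<bar> \<le> (\<Sum>j=1..m. real (r j) * M)"
      using that by (intro order_trans[OF sum_abs] sum_mono) (simp add: abs_mult mult_left_mono)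
    also have "\<dots> = real (\<Sum>j=1..m. r j) * M" by (simp only: of_nat_sum sum_distrib_right)
    also have "\<dots> \<le> ?N * M" using sum_le_mixed_size[of r m] M0 by (intro mult_right_mono) (auto simp del: of_nat_sum)
    finally show ?thesis using N by (simp add: abs_divide divide_le_eq mult.commute)
  qed
  show "\<bar>mu1 m r\<bar> \<le> M" unfolding mu1_def by (rule *) (use M in fastforce)
  show "\<bar>mu2 m r\<bar> \<le> M" unfolding mu2_def by (rule *) (use M in fastforce)
  have "real (r j) * A_coeff j \<le> 0" for j
    by (cases j) (auto simp: A_coeff_def intro!: mult_nonneg_nonpos)
  then show "mu1 m r \<le> 0" unfolding mu1_def using N by (intro divide_nonpos_nonneg sum_nonpos) auto
qed

text \<open>The integrand is compared pointwise with the Gamma weight times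
  \<open>main_part\<close>. For x > X the difference is at most a multiple of
  \<open>error_part\<close>; for x <= X both are bounded separately, the product by X^N, which
  \<open>power_le_Gamma\<close> makes negligible.\<close>

lemma H_mixed_integral_estimate:
  assumes s: "s > 0"
  shows "\<exists>K N0. \<forall>r N. N = mixed_size m r \<longrightarrow> N \<ge> N0 \<longrightarrow> N \<ge> 1 \<longrightarrow>
    \<bar>Gamma s * H s (mixed_multipartite m r) - Gamma (real N + s) *
      (exp (mu1 m r) * (1 + ((1 - s) * mu1 m r + (mu1 m r)\<^sup>2 / 2 + mu2 m r) / real N))\<bar>
    \<le> K * Gamma (real N + s) / (real N)\<^sup>2"
proof -
  obtain K X where KX: "K \<ge> 0" "X \<ge> 1" "X \<ge> 4 * real m"
    and KX': "\<And>j x. j \<le> m \<Longrightarrow> x \<ge> X \<Longrightarrow>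
      \<bar>ln (poly (touchard j) x / x ^ j) - (A_coeff j / x + E_coeff j / x\<^sup>2)\<bar> \<le> K / x ^ 3"
    using ln_touchard_expansion_uniform[of m] by blast
  define M where "M = (\<Sum>j=1..m. \<bar>A_coeff j\<bar> + \<bar>E_coeff j\<bar>)"
  have M0: "M \<ge> 0" by (simp add: M_def sum_nonneg)
  obtain K1 where K1: "K1 \<ge> 0" "\<And>n. n \<ge> 1 \<Longrightarrow> X ^ n \<le> K1 * Gamma (real n + s) / (real n)\<^sup>2"
    using power_le_Gamma[OF s KX(2)] by blast
  obtain K2 where K2: "K2 \<ge> 0" "\<And>n a b. n \<ge> 1 \<Longrightarrow> a \<le> 0 \<Longrightarrow> \<bar>a\<bar> \<le> M \<Longrightarrow> \<bar>b\<bar> \<le> M \<Longrightarrow>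
    \<bar>(\<Sum>k\<le>6. main_coeff a b (real n) k * inv_moment s k n) -
      exp a * (1 + ((1 - s) * a + a\<^sup>2 / 2 + b) / real n)\<bar> \<le> K2 / (real n)\<^sup>2"
    using main_moment[OF s M0] by blast
  obtain K3 where K3: "K3 \<ge> 0" "\<And>n. n \<ge> 1 \<Longrightarrow>
      \<bar>\<Sum>k\<le>6. error_coeff (real n) k * inv_moment s k n\<bar> \<le> K3 / (real n)\<^sup>2"
    using error_moment[OF s] by blast
  define P where "P = 1 + 2 * M + 2 * M\<^sup>2 + M ^ 3"
  \<comment> \<open>The summand P X^2 handles x <= X: there N <= u X, so u^3 is at most X^2 u^5/N^2,
    a term of \<open>error_part\<close>.\<close>
  define C where "C = (M\<^sup>2 + K\<^sup>2 + K + M ^ 4 + M ^ 3) + P * X\<^sup>2"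
  have P0: "P \<ge> 0" using M0 by (simp add: P_def)
  have C0: "C \<ge> 0" using M0 KX(1) P0 by (simp add: C_def)
  \<comment> \<open>N >= 7 makes inverse moments up to order 6 finite, and N >= X gives u >= 1
    whenever x <= X.\<close>
  define N0 where "N0 = max 7 (nat \<lceil>X\<rceil>)"
  have "\<bar>Gamma s * H s (mixed_multipartite m r) - Gamma (real N + s) *
      (exp (mu1 m r) * (1 + ((1 - s) * mu1 m r + (mu1 m r)\<^sup>2 / 2 + mu2 m r) / real N))\<bar>
    \<le> (C * K3 + K1 * (X powr s / s) + K2) * Gamma (real N + s) / (real N)\<^sup>2"
    if N: "N = mixed_size m r" "N \<ge> N0" "N \<ge> 1" for r N
  proof -
    let ?n = "real N" and ?a = "mu1 m r" and ?b = "mu2 m r"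
    let ?w = "\<lambda>x. x powr (?n + s - 1) * exp (- x)"
    let ?G = "Gamma (?n + s)"
    let ?S1 = "\<Sum>k\<le>6. main_coeff ?a ?b ?n k * inv_moment s k N"
    let ?S2 = "\<Sum>k\<le>6. error_coeff ?n k * inv_moment s k N"
    have n: "?n \<ge> 7" "?n \<ge> X" "?n \<ge> 1" using N by (auto simp: N0_def nat_le_iff ceiling_le_iff)
    have G0: "?G > 0" using n s by (intro Gamma_real_pos) simp
    have mu: "?a \<le> 0" "\<bar>?a\<bar> \<le> M" "\<bar>?b\<bar> \<le> M"
      using mu_bounds[of m r] N by (auto simp: M_def)
    have i1: "((\<lambda>x. x powr (s - 1) * exp (- x) * tprod m r x) has_integral
        Gamma s * H s (mixed_multipartite m r)) {0..}"
      using s by (rule has_integral_H_mixed)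
    have i2: "((\<lambda>x. ?w x * main_part ?a ?b ?n (?n / x)) has_integral ?G * ?S1) {0..}"
      unfolding main_part_eq_sum using n s by (intro has_integral_sum_inv_moment) simp
    have i3: "((\<lambda>x. ?w x * error_part ?n (?n / x)) has_integral ?G * ?S2) {0..}"
      unfolding error_part_eq_sum using n s by (intro has_integral_sum_inv_moment) simp
    have i4: "((\<lambda>x. if x \<in> {0..X} then X ^ N * x powr (s - 1) else 0) has_integral X ^ N * (X powr s / s)) {0..}"
    proof -
      have "((\<lambda>x. X ^ N * x powr (s - 1)) has_integral X ^ N * (X powr (s - 1 + 1) / (s - 1 + 1))) {0..X}"
        using s KX by (intro has_integral_mult_right has_integral_powr_from_0) auto
      then have "((\<lambda>x. X ^ N * x powr (s - 1)) has_integral X ^ N * (X powr s / s)) {0..X}" by simp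
      moreover have "{0..X} \<subseteq> {0..}" by auto
      ultimately show ?thesis by (subst has_integral_restrict) auto
    qed
    let ?D = "\<lambda>x. x powr (s - 1) * exp (- x) * tprod m r x - ?w x * main_part ?a ?b ?n (?n / x)"
    let ?g = "\<lambda>x. C * (?w x * error_part ?n (?n / x)) + (if x \<in> {0..X} then X ^ N * x powr (s - 1) else 0)"
    have bound: "norm (?D x) \<le> ?g x" if x: "x \<in> {0..}" for x
    proof (cases "x = 0")
      case True
      then show ?thesis using KX by simp
    next
      case False
      then have x0: "x > 0" using x by simp
      define u where "u = ?n / x"
      have u0: "u > 0" using n x0 by (simp add: u_def)
      have w0: "?w x > 0" using x0 by simp
      have Q0: "error_part ?n u \<ge> 0" by (rule error_part_ge) (use u0 n in auto)
      show ?thesis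
      proof (cases "x \<le> X")
        case True
        have u1: "u * X \<ge> ?n" "u \<ge> 1"
          using True x0 n KX by (auto simp: u_def field_simps mult_left_mono)
        have "\<bar>main_part ?a ?b ?n u\<bar> \<le> P * u ^ 3"
          unfolding P_def by (rule abs_main_part_le) (use n u1 mu in auto)
        also have "\<dots> \<le> P * (X\<^sup>2 * (u ^ 5 / ?n\<^sup>2))"
        proof (intro mult_left_mono P0)
          have "?n\<^sup>2 \<le> (u * X)\<^sup>2" using u1 n by (intro power_mono) auto
          then have "u ^ 3 * ?n\<^sup>2 \<le> u ^ 3 * (u * X)\<^sup>2" using u0 by (intro mult_left_mono) auto
          also have "\<dots> = X\<^sup>2 * u ^ 5" by (simp add: eval_nat_numeral)
          finally show "u ^ 3 \<le> X\<^sup>2 * (u ^ 5 / ?n\<^sup>2)" using n by (simp add: pos_le_divide_eq)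
        qed
        also have "\<dots> \<le> P * (X\<^sup>2 * error_part ?n u)"
          using P0 u0 n by (intro mult_left_mono error_part_ge) auto
        also have "\<dots> \<le> C * error_part ?n u"
          unfolding C_def mult.assoc[symmetric] using Q0 M0 KX(1) by (intro mult_right_mono) auto
        finally have 1: "?w x * \<bar>main_part ?a ?b ?n u\<bar> \<le> ?w x * (C * error_part ?n u)"
          using w0 by (intro mult_left_mono) auto
        have "\<bar>tprod m r x\<bar> \<le> X ^ N" unfolding N(1) by (rule abs_tprod_le) (use x True KX in auto)
        then have "exp (- x) * \<bar>tprod m r x\<bar> \<le> 1 * X ^ N" using x0 by (intro mult_mono) auto
        then have 2: "x powr (s - 1) * (exp (- x) * \<bar>tprod m r x\<bar>) \<le> x powr (s - 1) * X ^ N"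
          using x0 by (intro mult_left_mono) auto
        have "\<bar>?D x\<bar> \<le> x powr (s - 1) * (exp (- x) * \<bar>tprod m r x\<bar>) + ?w x * \<bar>main_part ?a ?b ?n u\<bar>"
          by (rule order_trans[OF abs_triangle_ineq4]) (simp add: abs_mult u_def)
        also have "\<dots> \<le> x powr (s - 1) * X ^ N + ?w x * (C * error_part ?n u)" using 1 2 by (rule add_mono[rotated])
        finally show ?thesis using True x0 by (simp add: u_def mult_ac)
      next
        case False
        then have xX: "x \<ge> X" by simp
        obtain l where l: "l \<le> 0" "tprod m r x = x ^ N * exp l"
          "\<bar>l - (?a * u + ?b * u\<^sup>2 / ?n)\<bar> \<le> K * u ^ 3 / ?n\<^sup>2"
          using tprod_log_expansion[OF KX' KX(2,3) xX N(1,3) u_def] by blast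
        have "\<bar>exp l - main_part ?a ?b ?n u\<bar> \<le> (M\<^sup>2 + K\<^sup>2 + K + M ^ 4 + M ^ 3) * error_part ?n u"
          by (rule main_part_approx) (use n u0 mu l KX in auto)
        also have "\<dots> \<le> C * error_part ?n u" using Q0 P0 by (intro mult_right_mono) (auto simp: C_def)
        finally have 1: "?w x * \<bar>exp l - main_part ?a ?b ?n u\<bar> \<le> ?w x * (C * error_part ?n u)"
          using w0 by (intro mult_left_mono) auto
        have "x powr (?n + s - 1) = x powr (s - 1) * x ^ N"
          using x0 powr_add[of x "s - 1" ?n] by (simp add: powr_realpow algebra_simps)
        then have "?D x = ?w x * (exp l - main_part ?a ?b ?n u)"
          by (simp add: l(2) u_def algebra_simps)
        then have "\<bar>?D x\<bar> = ?w x * \<bar>exp l - main_part ?a ?b ?n u\<bar>" by (simp add: abs_mult)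
        then show ?thesis using 1 False by (simp add: u_def mult_ac)
      qed
    qed
    have iD: "(?D has_integral (Gamma s * H s (mixed_multipartite m r) - ?G * ?S1)) {0..}"
      using i1 i2 by (rule has_integral_diff)
    have ig: "(?g has_integral (C * (?G * ?S2) + X ^ N * (X powr s / s))) {0..}"
      using i3 i4 by (intro has_integral_add has_integral_mult_right)
    have "norm (integral {0..} ?D) \<le> integral {0..} ?g"
      by (rule integral_norm_bound_integral) (use iD ig bound in auto)
    then have "\<bar>Gamma s * H s (mixed_multipartite m r) - ?G * ?S1\<bar> \<le> C * (?G * ?S2) + X ^ N * (X powr s / s)"
      using integral_unique[OF iD] integral_unique[OF ig] by simp
    also have "\<dots> \<le> C * (?G * (K3 / ?n\<^sup>2)) + K1 * ?G / ?n\<^sup>2 * (X powr s / s)"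
    proof (intro add_mono mult_left_mono mult_right_mono)
      show "?S2 \<le> K3 / ?n\<^sup>2" using K3(2)[OF N(3)] by linarith
    qed (use C0 G0 K1(2)[OF N(3)] s in auto)
    finally have 1: "\<bar>Gamma s * H s (mixed_multipartite m r) - ?G * ?S1\<bar> \<le>
        C * (?G * (K3 / ?n\<^sup>2)) + K1 * ?G / ?n\<^sup>2 * (X powr s / s)" .
    let ?E = "exp ?a * (1 + ((1 - s) * ?a + ?a\<^sup>2 / 2 + ?b) / ?n)"
    have 2: "\<bar>?G * ?S1 - ?G * ?E\<bar> \<le> ?G * (K2 / ?n\<^sup>2)"
    proof -
      have "?G * ?S1 - ?G * ?E = ?G * (?S1 - ?E)" by (rule right_diff_distrib[symmetric])
      then have "\<bar>?G * ?S1 - ?G * ?E\<bar> = ?G * \<bar>?S1 - ?E\<bar>" using G0 by (simp add: abs_mult)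
      also have "\<dots> \<le> ?G * (K2 / ?n\<^sup>2)" using G0 by (intro mult_left_mono K2 N mu) auto
      finally show ?thesis .
    qed
    have "\<bar>p - q\<bar> \<le> \<bar>p - v\<bar> + \<bar>v - q\<bar>" for p q v :: real by linarith
    then have "\<bar>Gamma s * H s (mixed_multipartite m r) - ?G * ?E\<bar> \<le>
        \<bar>Gamma s * H s (mixed_multipartite m r) - ?G * ?S1\<bar> + \<bar>?G * ?S1 - ?G * ?E\<bar>" .
    also have "\<dots> \<le> C * (?G * (K3 / ?n\<^sup>2)) + K1 * ?G / ?n\<^sup>2 * (X powr s / s) + ?G * (K2 / ?n\<^sup>2)"
      using 1 2 by (rule add_mono)
    also have "\<dots> = (C * K3 + K1 * (X powr s / s) + K2) * ?G / ?n\<^sup>2"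
      using s n by (simp add: field_simps)
    finally show ?thesis .
  qed
  then show ?thesis by blast
qed


section \<open>The normalised error for parts of bounded size\<close>

definition mixed_error :: "real \<Rightarrow> nat \<Rightarrow> (nat \<Rightarrow> nat) \<Rightarrow> real" where
  "mixed_error s m r = (let N = mixed_size m r; a = mu1 m r in
    Gamma s * H s (mixed_multipartite m r) / (fact N * real N powr (s - 1) * exp a)
    - (1 + (mu2 m r + (1 - s) * a + a\<^sup>2 / 2 + s * (s - 1) / 2) / real N))"

text \<open>Restriction leaves only finitely many functions \<open>r\<close> of bounded total size,
  so the small cases can be absorbed into a constant.\<close>

lemma mixed_error_restrict: "mixed_error s m (restrict r {1..m}) = mixed_error s m r"
proof -
  let ?r = "restrict r {1..m}"
  have "mixed_size m ?r = mixed_size m r" "mu1 m ?r = mu1 m r" "mu2 m ?r = mu2 m r"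
    by (simp_all add: mixed_size_def mu1_def mu2_def)
  moreover have "(SIGMA j:{1..m}. {..<?r j}) = (SIGMA j:{1..m}. {..<r j})" by auto
  then have "mixed_multipartite m ?r = mixed_multipartite m r" by (simp add: mixed_multipartite_def)
  ultimately show ?thesis by (simp add: mixed_error_def Let_def)
qed

text \<open>The normalised value is the product of Gamma(N + s)/(N! N^(s-1)) and the integral
  estimate divided by Gamma(N + s) exp(mu1). Each factor is 1 plus a 1/N term up to O(N^-2), so the
  1/N terms add.\<close>

lemma mixed_error_bound_large:
  assumes s: "s > 0"
  shows "\<exists>K N0. \<forall>r. mixed_size m r \<ge> N0 \<longrightarrow> mixed_size m r \<ge> 1 \<longrightarrow>
    \<bar>mixed_error s m r\<bar> \<le> K / (real (mixed_size m r))\<^sup>2"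
proof -
  obtain K N0 where K: "\<And>r N. N = mixed_size m r \<Longrightarrow> N \<ge> N0 \<Longrightarrow> N \<ge> 1 \<Longrightarrow>
    \<bar>Gamma s * H s (mixed_multipartite m r) - Gamma (real N + s) *
      (exp (mu1 m r) * (1 + ((1 - s) * mu1 m r + (mu1 m r)\<^sup>2 / 2 + mu2 m r) / real N))\<bar>
    \<le> K * Gamma (real N + s) / (real N)\<^sup>2"
    using H_mixed_integral_estimate[OF s] by blast
  obtain L where L: "L \<ge> 0" "\<And>n. n \<ge> 1 \<Longrightarrow>
    \<bar>Gamma (real n + s) / (fact n * real n powr (s - 1)) - (1 + s * (s - 1) / 2 / real n)\<bar> \<le> L / real n ^ 2"
    using bigo_inverse_power_bound[OF Gamma_fact_ratio[OF s]] by blast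
  define M where "M = (\<Sum>j=1..m. \<bar>A_coeff j\<bar> + \<bar>E_coeff j\<bar>)"
  define b where "b = s * (s - 1) / 2"
  define A where "A = (1 + s) * M + M\<^sup>2 + M"
  define T where "T = exp M * \<bar>K\<bar>"
  have M0: "M \<ge> 0" by (simp add: M_def sum_nonneg)
  have A0: "A \<ge> 0" using M0 s by (simp add: A_def)
  have "\<bar>mixed_error s m r\<bar> \<le> (A * \<bar>b\<bar> + L * (1 + A + T) + (1 + \<bar>b\<bar>) * T) / (real N)\<^sup>2"
    if N: "N = mixed_size m r" "N \<ge> N0" "N \<ge> 1" for r N
  proof -
    define t where "t = 1 / real N"
    define a where "a = mu1 m r"
    define al where "al = (1 - s) * a + a\<^sup>2 / 2 + mu2 m r"
    define F where "F = fact N * real N powr (s - 1)"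
    define G where "G = Gamma (real N + s)"
    define h where "h = Gamma s * H s (mixed_multipartite m r)"
    define eta where "eta = G / F - (1 + b * t)"
    define th where "th = (h / G - exp a * (1 + al * t)) * exp (- a)"
    have t: "0 < t" "t \<le> 1" using N by (auto simp: t_def)
    have F0: "F > 0" using N by (simp add: F_def)
    have G0: "G > 0" unfolding G_def using s by (intro Gamma_real_pos) simp
    have mu: "a \<le> 0" "\<bar>a\<bar> \<le> M" "\<bar>mu2 m r\<bar> \<le> M"
      using mu_bounds[of m r] N by (auto simp: M_def a_def)
    have eta: "\<bar>eta\<bar> \<le> L * t\<^sup>2"
      using L(2)[OF N(3)] by (simp add: eta_def G_def F_def b_def t_def power_divide)
    have th: "\<bar>th\<bar> \<le> T * t\<^sup>2"
    proof -
      have "\<bar>h - G * (exp a * (1 + al * t))\<bar> \<le> K * G * t\<^sup>2"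
        using K[OF N] by (simp add: h_def G_def a_def al_def t_def power_divide)
      also have "\<dots> \<le> \<bar>K\<bar> * G * t\<^sup>2" using G0 by (intro mult_right_mono) auto
      finally have "\<bar>h - G * (exp a * (1 + al * t))\<bar> \<le> G * (\<bar>K\<bar> * t\<^sup>2)" by (simp add: mult_ac)
      moreover have "h - G * (exp a * (1 + al * t)) = G * (h / G - exp a * (1 + al * t))"
        using G0 by (simp add: right_diff_distrib)
      ultimately have "\<bar>h / G - exp a * (1 + al * t)\<bar> \<le> \<bar>K\<bar> * t\<^sup>2" using G0 by (simp add: abs_mult)
      moreover have "exp (- a) \<le> exp M" using mu by simp
      ultimately have "\<bar>h / G - exp a * (1 + al * t)\<bar> * exp (- a) \<le> \<bar>K\<bar> * t\<^sup>2 * exp M"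
        by (intro mult_mono) auto
      then show ?thesis by (simp add: th_def T_def abs_mult mult_ac)
    qed
    have al: "\<bar>al\<bar> \<le> A"
    proof -
      have "\<bar>1 - s\<bar> * \<bar>a\<bar> \<le> (1 + s) * M" using s mu by (intro mult_mono) auto
      moreover have "a\<^sup>2 \<le> M\<^sup>2" using power_mono[OF mu(2), of 2] by simp
      moreover have "\<bar>al\<bar> \<le> \<bar>1 - s\<bar> * \<bar>a\<bar> + a\<^sup>2 + \<bar>mu2 m r\<bar>"
      proof -
        have "\<bar>p + q / 2 + v\<bar> \<le> \<bar>p\<bar> + q + \<bar>v\<bar>" if "q \<ge> 0" for p q v :: real using that by linarith
        from this[of "a\<^sup>2" "(1 - s) * a" "mu2 m r"] show ?thesis by (simp add: al_def abs_mult)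
      qed
      ultimately show ?thesis using mu by (simp add: A_def)
    qed
    have eq: "h / (F * exp a) = (1 + b * t + eta) * (1 + al * t + th)"
    proof -
      have e: "exp a * exp (- a) = 1" by (simp flip: exp_add)
      have "1 + al * t + th = h / G * exp (- a) + (1 + al * t) * (1 - exp a * exp (- a))"
        by (simp add: th_def algebra_simps)
      then have "1 + al * t + th = h / G * exp (- a)" by (simp add: e)
      moreover have "1 + b * t + eta = G / F" by (simp add: eta_def)
      moreover have "h / (F * exp a) = G / F * (h / G * exp (- a))"
        using G0 F0 by (simp add: exp_minus field_simps)
      ultimately show ?thesis by (simp only:)
    qed
    have "mixed_error s m r = h / (F * exp a) - (1 + (al + b) * t)"
    proof -
      have bt: "x / real N = x * t" for x by (simp add: t_def)
      show ?thesis
        unfolding mixed_error_def Let_def N(1)[symmetric] bt h_def F_def a_def al_def b_def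
        by (simp add: algebra_simps)
    qed
    then have eq2: "mixed_error s m r = al * b * t\<^sup>2 + eta * (1 + al * t + th) + (1 + b * t) * th"
      unfolding eq by (simp add: power2_eq_square algebra_simps)
    have "\<bar>p + q + v\<bar> \<le> \<bar>p\<bar> + \<bar>q\<bar> + \<bar>v\<bar>" for p q v :: real by linarith
    then have "\<bar>mixed_error s m r\<bar> \<le> \<bar>al * b * t\<^sup>2\<bar> + \<bar>eta * (1 + al * t + th)\<bar> + \<bar>(1 + b * t) * th\<bar>"
      unfolding eq2 .
    also have "\<dots> \<le> A * \<bar>b\<bar> * t\<^sup>2 + L * t\<^sup>2 * (1 + A + T) + (1 + \<bar>b\<bar>) * (T * t\<^sup>2)"
    proof (intro add_mono)
      show "\<bar>al * b * t\<^sup>2\<bar> \<le> A * \<bar>b\<bar> * t\<^sup>2"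
        using al by (auto simp: abs_mult intro!: mult_right_mono)
      have "t\<^sup>2 \<le> 1" using t by (simp add: power_le_one)
      moreover have "T \<ge> 0" by (simp add: T_def)
      ultimately have "T * t\<^sup>2 \<le> T" by (simp add: mult_left_le)
      then have th1: "\<bar>th\<bar> \<le> T" using th by linarith
      have alt: "\<bar>al * t\<bar> \<le> A" using mult_mono[OF al, of t 1] t A0 by (simp add: abs_mult)
      have "\<bar>1 + al * t + th\<bar> \<le> 1 + A + T" using th1 alt by linarith
      then show "\<bar>eta * (1 + al * t + th)\<bar> \<le> L * t\<^sup>2 * (1 + A + T)"
        unfolding abs_mult using eta L(1) by (intro mult_mono) auto
      have "\<bar>b * t\<bar> \<le> \<bar>b\<bar>" using t by (simp add: abs_mult mult_left_le)
      then have "\<bar>1 + b * t\<bar> \<le> 1 + \<bar>b\<bar>" by linarith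
      then show "\<bar>(1 + b * t) * th\<bar> \<le> (1 + \<bar>b\<bar>) * (T * t\<^sup>2)"
        unfolding abs_mult using th by (intro mult_mono) auto
    qed
    also have "\<dots> = (A * \<bar>b\<bar> + L * (1 + A + T) + (1 + \<bar>b\<bar>) * T) * t\<^sup>2" by (simp add: algebra_simps)
    finally show ?thesis by (simp add: t_def power_divide)
  qed
  then show ?thesis by blast
qed

lemma mixed_error_bound:
  assumes s: "s > 0"
  shows "\<exists>K. \<forall>r. mixed_size m r \<ge> 1 \<longrightarrow> \<bar>mixed_error s m r\<bar> \<le> K / (real (mixed_size m r))\<^sup>2"
proof -
  obtain K N0 where K: "\<And>r. mixed_size m r \<ge> N0 \<Longrightarrow> mixed_size m r \<ge> 1 \<Longrightarrow>
    \<bar>mixed_error s m r\<bar> \<le> K / (real (mixed_size m r))\<^sup>2"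
    using mixed_error_bound_large[OF s] by blast
  define R where "R = {1..m} \<rightarrow>\<^sub>E {..N0}"
  define B where "B = (\<Sum>r\<in>R. \<bar>mixed_error s m r\<bar>)"
  have fR: "finite R" unfolding R_def by (intro finite_PiE) auto
  have B0: "B \<ge> 0" by (simp add: B_def sum_nonneg)
  have "\<bar>mixed_error s m r\<bar> \<le> (\<bar>K\<bar> + B * (real N0)\<^sup>2) / (real (mixed_size m r))\<^sup>2"
    if r: "mixed_size m r \<ge> 1" for r
  proof (cases "mixed_size m r \<ge> N0")
    case True
    have "K / (real (mixed_size m r))\<^sup>2 \<le> (\<bar>K\<bar> + B * (real N0)\<^sup>2) / (real (mixed_size m r))\<^sup>2"
      using B0 by (intro divide_right_mono) (auto intro: add_increasing2)
    then show ?thesis using K[OF True r] by linarith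
  next
    case False
    have "r j \<le> N0" if "j \<in> {1..m}" for j
    proof -
      have "r j \<le> j * r j" using that by auto
      also have "\<dots> \<le> mixed_size m r"
        unfolding mixed_size_def by (rule member_le_sum) (use that in auto)
      finally show ?thesis using False by simp
    qed
    then have "restrict r {1..m} \<in> R" by (auto simp: R_def)
    then have "\<bar>mixed_error s m (restrict r {1..m})\<bar> \<le> B"
      unfolding B_def using fR by (intro member_le_sum[of _ R "\<lambda>r. \<bar>mixed_error s m r\<bar>"]) auto
    then have "\<bar>mixed_error s m r\<bar> * (real (mixed_size m r))\<^sup>2 \<le> B * (real N0)\<^sup>2"
      unfolding mixed_error_restrict using False B0 by (intro mult_mono power_mono) auto
    then show ?thesis using r by (simp add: pos_le_divide_eq)
  qed
  then show ?thesis by blast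
qed

theorem H_mixed_asymptotics:
  assumes s: "s > 0"
  shows "\<exists>K. \<forall>r N. N = mixed_size m r \<and> N \<ge> 1 \<longrightarrow>
    (\<exists>\<epsilon>. \<bar>\<epsilon>\<bar> \<le> K / real N ^ 2 \<and>
      H s (mixed_multipartite m r) =
        fact N * real N powr (s - 1) / Gamma s * exp (mu1 m r) *
        (1 + (mu2 m r + (1 - s) * mu1 m r + (mu1 m r)\<^sup>2 / 2 + s * (s - 1) / 2) / real N + \<epsilon>))"
proof -
  obtain K where K: "\<And>r. mixed_size m r \<ge> 1 \<Longrightarrow> \<bar>mixed_error s m r\<bar> \<le> K / (real (mixed_size m r))\<^sup>2"
    using mixed_error_bound[OF s] by blast
  show ?thesis
  proof (rule exI[of _ K], intro allI impI, elim conjE)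
    fix r N assume N: "N = mixed_size m r" "N \<ge> 1"
    define F where "F = fact N * real N powr (s - 1) * exp (mu1 m r)"
    have F0: "F \<noteq> 0" using N(2) by (simp add: F_def)
    have G0: "Gamma s > 0" using s by (rule Gamma_real_pos)
    have "1 + (mu2 m r + (1 - s) * mu1 m r + (mu1 m r)\<^sup>2 / 2 + s * (s - 1) / 2) / real N + mixed_error s m r
        = Gamma s * H s (mixed_multipartite m r) / F"
      by (simp add: mixed_error_def Let_def F_def flip: N(1))
    then have "H s (mixed_multipartite m r) =
        fact N * real N powr (s - 1) / Gamma s * exp (mu1 m r) *
        (1 + (mu2 m r + (1 - s) * mu1 m r + (mu1 m r)\<^sup>2 / 2 + s * (s - 1) / 2) / real N + mixed_error s m r)"
      using F0 G0 by (simp add: F_def)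
    then show "\<exists>\<epsilon>. \<bar>\<epsilon>\<bar> \<le> K / real N ^ 2 \<and>
      H s (mixed_multipartite m r) =
        fact N * real N powr (s - 1) / Gamma s * exp (mu1 m r) *
        (1 + (mu2 m r + (1 - s) * mu1 m r + (mu1 m r)\<^sup>2 / 2 + s * (s - 1) / 2) / real N + \<epsilon>)"
      using K[of r] N by (intro exI[of _ "mixed_error s m r"]) auto
  qed
qed

text \<open>The two graphs have different vertex types; instead of an isomorphism, the integrals are
  compared, whose integrands coincide.\<close>

lemma H_equal_eq_mixed:
  assumes s: "s > 0" and k: "k \<ge> 1"
  shows "H s (equal_multipartite k r) = H s (mixed_multipartite k (\<lambda>j. if j = k then r else 0))"
proof -
  let ?r = "\<lambda>j. if j = k then r else 0"
  have "tprod k ?r x = poly (touchard k) x ^ r" for x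
  proof -
    have "tprod k ?r x = (\<Prod>j=1..k. if j = k then poly (touchard k) x ^ r else 1)"
      unfolding tprod_def by (intro prod.cong refl) auto
    then show ?thesis using k by simp
  qed
  then have "Gamma s * H s (equal_multipartite k r) = Gamma s * H s (mixed_multipartite k ?r)"
    using has_integral_H[of "{..<r}" s "\<lambda>_. k"] has_integral_H_mixed[OF s, of k ?r] s
    by (intro has_integral_unique) (auto simp: equal_multipartite_def)
  then show ?thesis using Gamma_real_pos[OF s] by simp
qed

theorem H_equal_asymptotics:
  assumes s: "s > 0" and k: "k \<ge> 1"
  shows "\<exists>\<epsilon> :: nat \<Rightarrow> real. \<epsilon> \<in> O(\<lambda>r. 1 / real r ^ 2) \<and>
    (\<forall>r\<ge>1. H s (equal_multipartite k r) =
      fact (k * r) * real (k * r) powr (s - 1) / Gamma s * exp (- (real k - 1) / 2) *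
      (1 + Delta k s / real (k * r) + \<epsilon> r))"
proof -
  let ?r = "\<lambda>r j. if j = k then r else 0"
  obtain K where K: "\<And>r N. N = mixed_size k r \<Longrightarrow> N \<ge> 1 \<Longrightarrow>
    (\<exists>\<epsilon>. \<bar>\<epsilon>\<bar> \<le> K / real N ^ 2 \<and>
      H s (mixed_multipartite k r) =
        fact N * real N powr (s - 1) / Gamma s * exp (mu1 k r) *
        (1 + (mu2 k r + (1 - s) * mu1 k r + (mu1 k r)\<^sup>2 / 2 + s * (s - 1) / 2) / real N + \<epsilon>))"
    using H_mixed_asymptotics[OF s, of k] by blast
  have ex: "\<exists>\<epsilon>. \<bar>\<epsilon>\<bar> \<le> K / real (k * r) ^ 2 \<and> H s (equal_multipartite k r) =
      fact (k * r) * real (k * r) powr (s - 1) / Gamma s * exp (- (real k - 1) / 2) *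
      (1 + Delta k s / real (k * r) + \<epsilon>)" if r: "r \<ge> 1" for r
  proof -
    have sum: "(\<Sum>j=1..k. real (if j = k then r else 0) * f j) = real r * f k" for f :: "nat \<Rightarrow> real"
    proof -
      have "(\<Sum>j=1..k. real (if j = k then r else 0) * f j) = (\<Sum>j=1..k. if j = k then real r * f k else 0)"
        by (intro sum.cong refl) auto
      then show ?thesis using k by simp
    qed
    have size: "mixed_size k (?r r) = k * r"
    proof -
      have "mixed_size k (?r r) = (\<Sum>j=1..k. if j = k then k * r else 0)"
        unfolding mixed_size_def by (intro sum.cong refl) auto
      then show ?thesis using k by simp
    qed
    have k0: "real k > 0" "real r > 0" using k r by auto
    have mu: "mu1 k (?r r) = - (real k - 1) / 2" "mu2 k (?r r) = E_coeff k / real k"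
      using k0 unfolding mu1_def mu2_def size sum by (simp_all add: A_coeff_def field_simps)
    \<comment> \<open>\<open>E_coeff k / real k\<close> equals -(k-1)(4k-5)/12 and half the square
      of \<open>mu1\<close> equals (k-1)^2/8; together they give -(k-1)(5k-7)/24.\<close>
    have Delta: "mu2 k (?r r) + (1 - s) * mu1 k (?r r) + (mu1 k (?r r))\<^sup>2 / 2 + s * (s - 1) / 2 = Delta k s"
      unfolding mu using k0
      by (simp add: Delta_def E_coeff_def A_coeff_def B_coeff_def field_simps power2_eq_square)
    show ?thesis
      using K[OF size[symmetric], unfolded Delta, unfolded mu(1)] k r
      unfolding H_equal_eq_mixed[OF s k] by simp
  qed
  then obtain e where e: "\<And>r. r \<ge> 1 \<Longrightarrow> \<bar>e r\<bar> \<le> K / real (k * r) ^ 2 \<and> H s (equal_multipartite k r) =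
      fact (k * r) * real (k * r) powr (s - 1) / Gamma s * exp (- (real k - 1) / 2) *
      (1 + Delta k s / real (k * r) + e r)" by metis
  have "e \<in> O(\<lambda>r. 1 / real r ^ 2)"
  proof (rule bigoI[of _ "K / real k ^ 2"], rule eventually_sequentiallyI[of 1])
    fix r :: nat assume "r \<ge> 1"
    then show "norm (e r) \<le> K / real k ^ 2 * norm (1 / real r ^ 2)"
      using e[of r] by (simp add: power_mult_distrib)
  qed
  then show ?thesis using e by blast
qed

theorem theorem10:
  fixes s :: real
  assumes "s > 0"
  shows
    "(\<forall>G :: 'v graph. simple_graph G \<and> connected_graph G \<longrightarrow> H s G = s * tutte G (1 + s) 0)
     \<and>
     (\<forall>k\<ge>1. \<exists>\<epsilon> :: nat \<Rightarrow> real. \<epsilon> \<in> O(\<lambda>r. 1 / real r ^ 2) \<and>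
        (\<forall>r\<ge>1. H s (equal_multipartite k r) =
           fact (k * r) * real (k * r) powr (s - 1) / Gamma s * exp (- (real k - 1) / 2) *
           (1 + Delta k s / real (k * r) + \<epsilon> r)))
     \<and>
     (\<forall>k\<ge>1. Delta k 1 = - ((real k - 1) * (5 * real k - 7)) / 24)
     \<and>
     (\<forall>m\<ge>1. \<exists>K::real. \<forall>r :: nat \<Rightarrow> nat. \<forall>N. N = mixed_size m r \<and> N \<ge> 1 \<longrightarrow>
        (\<exists>\<epsilon>. \<bar>\<epsilon>\<bar> \<le> K / real N ^ 2 \<and>
           H s (mixed_multipartite m r) =
             fact N * real N powr (s - 1) / Gamma s * exp (mu1 m r) *
             (1 + (mu2 m r + (1 - s) * mu1 m r + (mu1 m r)\<^sup>2 / 2 + s * (s - 1) / 2) / real N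
                + \<epsilon>)))
     \<and>
     (\<forall>\<gamma> :: nat \<Rightarrow> rat. acyclic_orientation_expansion \<gamma> \<longrightarrow>
        (\<forall>J\<ge>1. \<forall>C::real. \<exists>K::real. \<forall>n\<ge>1. \<forall>m\<ge>1. real m \<le> C * real n ^ J \<longrightarrow>
           (\<exists>\<epsilon>. \<bar>\<epsilon>\<bar> \<le> K / real n \<and>
              H s (equal_multipartite m n) =
                fact (m * n) * real (m * n) powr (s - 1) / Gamma s *
                exp (- real m / 2 + 1 / 2
                     + (\<Sum>j=1..J. of_rat (\<gamma> j) * real m / real n ^ j) + \<epsilon>))))"
proof (intro conjI allI impI)
  show "H s G = s * tutte G (1 + s) 0" if "simple_graph G \<and> connected_graph G" for G :: "'v graph"
    using that H_eq_tutte by blast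
  show "\<exists>\<epsilon> :: nat \<Rightarrow> real. \<epsilon> \<in> O(\<lambda>r. 1 / real r ^ 2) \<and>
      (\<forall>r\<ge>1. H s (equal_multipartite k r) =
         fact (k * r) * real (k * r) powr (s - 1) / Gamma s * exp (- (real k - 1) / 2) *
         (1 + Delta k s / real (k * r) + \<epsilon> r))" if "k \<ge> 1" for k
    using assms that by (rule H_equal_asymptotics)
  show "Delta k 1 = - ((real k - 1) * (5 * real k - 7)) / 24" for k
    by (simp add: Delta_def)
qed (rule H_mixed_asymptotics[OF assms] H_equal_uniform_asymptotics[OF assms]; assumption)+

end
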